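(* Let $X$ be a domain in $\mathbb{C}^n$, let $K$ be a sesqui-holomorphic non-degenerate positive semi-definite kernel on $X$, and let $F$ be the RKHS over $X$ with reproducing kernel $K$. The following are equivalent: (i) $K$ is projectively invariant; (ii) for every $\Phi\in Aut(X)$ there is a function $\omega_\Phi^K:X\to\mathbb{C}$ such that the weighted composition operator $W_{\omega_\Phi^K,\Phi}$ is (well-defined and) unitary on $F$; (iii) each of $\tilde\sigma^K$, $\delta_1^K$ and $\delta_2^K$ is automorphism-invariant; (iii$'$) at least one of $\tilde\sigma^K$, $\delta_1^K$ and $\delta_2^K$ is automorphism-invariant; (iv) for every $\Phi\in Aut(X)$ there are $y\in X$ and a nonempty open set $U\subset X$ such that for every $x\in U$ $$\frac{|K(\Phi(x),\Phi(y))|^2}{K(\Phi(x),\Phi(x))\,K(\Phi(y),\Phi(y))}=\frac{|K(x,y)|^2}{K(x,x)\,K(y,y)}.$$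
   Context: A domain is an open connected set; $Aut(X)$ is the group of biholomorphisms of $X$ onto itself. A function $L:X\times X\to\mathbb{C}$ is sesqui-holomorphic if it is holomorphic in the first and antiholomorphic in the second variable; $\widehat{L}(x)=L(x,x)$; $L$ is non-degenerate if $\widehat{L}(x)>0$ for all $x$. Non-degenerate $L,M$ are rescallings of each other if there is $\omega:X\to\mathbb{C}$ with $M(x,y)=\omega(x)\overline{\omega(y)}L(x,y)$ for all $x,y$. For $\Phi:X\to X$, $[L\circ\Phi](x,y)=L(\Phi(x),\Phi(y))$. A sesqui-holomorphic non-degenerate $L$ is projectively invariant if $L\circ\Phi$ is a rescalling of $L$ for every $\Phi\in Aut(X)$. The RKHS $F$ with kernel $K$ is the unique Hilbert space of functions on $X$ with $K(\cdot,x)\in F$ and $f(x)=\langle f,K(\cdot,x)\rangle_F$ for all $f\in F$, $x\in X$. For $\omega:X\to\mathbb{C}$ and $\Phi:X\to X$ with $\omega\cdot(f\circ\Phi)\in F$ for all $f\in F$, the operator $W_{\omega,\Phi}:F\to F$ is $[W_{\omega,\Phi}f](x)=\omega(x)f(\Phi(x))$. $\tilde\sigma^K$ is the (possibly degenerate) Hermitean form on $X$ with potential $\log\widehat{K}$: $$\tilde\sigma^K=\sum_{j,k=1}^n\frac{\partial^2\log\widehat{K}}{\partial z_j\partial\overline{z_k}}\,dz_j\otimes d\overline{z_k},$$ equivalently the pull-back of the form $\tilde\sigma_g(f,h)=\frac{\langle f,h\rangle}{\|g\|^2}-\frac{\langle f,g\rangle\langle g,h\rangle}{\|g\|^4}$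 on $F^*\setminus\{0\}$ via the evaluation map $x\mapsto\langle\cdot,K(\cdot,x)\rangle_F$. Further, $$\delta_1^K(x,y)=\sqrt{1-\frac{|K(x,y)|^2}{K(x,x)K(y,y)}},\qquad \delta_2^K(x,y)=\sqrt{2-2\frac{|K(x,y)|}{\sqrt{K(x,x)K(y,y)}}}.$$ $\tilde\sigma^K$ is automorphism-invariant if its pull-back under every $\Phi\in Aut(X)$ equals $\tilde\sigma^K$; $\delta_i^K$ is automorphism-invariant if $\delta_i^K(\Phi(x),\Phi(y))=\delta_i^K(x,y)$ for all $\Phi\in Aut(X)$, $x,y\in X$. *)

theory Defs
  imports "HOL-Analysis.Analysis"
begin

text \<open>
  Functions on a subset \<open>X\<close> of \<open>complex ^ 'n\<close> are total HOL functions of which only the values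
  on \<open>X\<close> matter. For \<open>X\<close> open, holomorphy on \<open>X\<close> is complex Frechet differentiability at every
  point, i.e. real differentiability with a complex-linear derivative.
\<close>

definition holomorphic_fun_on :: "(complex ^ 'n \<Rightarrow> complex) \<Rightarrow> (complex ^ 'n) set \<Rightarrow> bool" where
  "holomorphic_fun_on f X \<longleftrightarrow>
     (\<forall>z\<in>X. \<exists>D. (f has_derivative D) (at z) \<and> (\<forall>c v. D (c *s v) = c * D v))"

definition holomorphic_map_on ::
    "(complex ^ 'n \<Rightarrow> complex ^ 'm) \<Rightarrow> (complex ^ 'n) set \<Rightarrow> bool" where
  "holomorphic_map_on \<Phi> X \<longleftrightarrow> (\<forall>i. holomorphic_fun_on (\<lambda>z. \<Phi> z $ i) X)"

definition Aut :: "(complex ^ 'n) set \<Rightarrow> (complex ^ 'n \<Rightarrow> complex ^ 'n) set" where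
  "Aut X = {\<Phi>. bij_betw \<Phi> X X \<and> holomorphic_map_on \<Phi> X \<and> holomorphic_map_on (inv_into X \<Phi>) X}"

definition sesqui_holomorphic ::
    "(complex ^ 'n) set \<Rightarrow> (complex ^ 'n \<Rightarrow> complex ^ 'n \<Rightarrow> complex) \<Rightarrow> bool" where
  "sesqui_holomorphic X L \<longleftrightarrow>
     (\<forall>y\<in>X. holomorphic_fun_on (\<lambda>x. L x y) X) \<and>
     (\<forall>x\<in>X. holomorphic_fun_on (\<lambda>y. cnj (L x y)) X)"

definition nondegenerate :: "'a set \<Rightarrow> ('a \<Rightarrow> 'a \<Rightarrow> complex) \<Rightarrow> bool" where
  "nondegenerate X L \<longleftrightarrow> (\<forall>x\<in>X. L x x \<in> \<real> \<and> Re (L x x) > 0)"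

definition psd_kernel :: "'a set \<Rightarrow> ('a \<Rightarrow> 'a \<Rightarrow> complex) \<Rightarrow> bool" where
  "psd_kernel X L \<longleftrightarrow>
     (\<forall>S c. finite S \<and> S \<subseteq> X \<longrightarrow>
        (\<Sum>x\<in>S. \<Sum>y\<in>S. c x * cnj (c y) * L x y) \<in> \<real>\<^sub>\<ge>\<^sub>0)"

definition rescaling :: "'a set \<Rightarrow> ('a \<Rightarrow> 'a \<Rightarrow> complex) \<Rightarrow> ('a \<Rightarrow> 'a \<Rightarrow> complex) \<Rightarrow> bool" where
  "rescaling X L M \<longleftrightarrow>
     (\<exists>\<omega>. \<forall>x\<in>X. \<forall>y\<in>X. M x y = \<omega> x * cnj (\<omega> y) * L x y)"

definition projectively_invariant ::
    "(complex ^ 'n) set \<Rightarrow> (complex ^ 'n \<Rightarrow> complex ^ 'n \<Rightarrow> complex) \<Rightarrow> bool" where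
  "projectively_invariant X L \<longleftrightarrow> (\<forall>\<Phi>\<in>Aut X. rescaling X L (\<lambda>x y. L (\<Phi> x) (\<Phi> y)))"

text \<open>
  Elements of a space of functions on \<open>X\<close> are represented by their extension by zero to the whole
  type, so that equality of elements is equality of HOL functions. The inner product is linear in
  the first argument.
\<close>

locale hilbert_function_space =
  fixes X :: "'a set"
    and F :: "('a \<Rightarrow> complex) set"
    and ip :: "('a \<Rightarrow> complex) \<Rightarrow> ('a \<Rightarrow> complex) \<Rightarrow> complex"
  assumes zero_outside: "\<And>f x. f \<in> F \<Longrightarrow> x \<notin> X \<Longrightarrow> f x = 0"
    and zero_mem: "(\<lambda>x. 0) \<in> F"
    and add_mem: "\<And>f g. f \<in> F \<Longrightarrow> g \<in> F \<Longrightarrow> (\<lambda>x. f x + g x) \<in> F"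
    and scale_mem: "\<And>c f. f \<in> F \<Longrightarrow> (\<lambda>x. c * f x) \<in> F"
    and ip_add: "\<And>f g h. f \<in> F \<Longrightarrow> g \<in> F \<Longrightarrow> h \<in> F \<Longrightarrow> ip (\<lambda>x. f x + g x) h = ip f h + ip g h"
    and ip_scale: "\<And>c f h. f \<in> F \<Longrightarrow> h \<in> F \<Longrightarrow> ip (\<lambda>x. c * f x) h = c * ip f h"
    and ip_cnj: "\<And>f g. f \<in> F \<Longrightarrow> g \<in> F \<Longrightarrow> ip g f = cnj (ip f g)"
    and ip_pos: "\<And>f. f \<in> F \<Longrightarrow> f \<noteq> (\<lambda>x. 0) \<Longrightarrow> Re (ip f f) > 0"
    and complete: "\<And>s :: nat \<Rightarrow> 'a \<Rightarrow> complex.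
      (\<And>k. s k \<in> F) \<Longrightarrow>
      (\<And>e. e > 0 \<Longrightarrow> \<exists>N. \<forall>k\<ge>N. \<forall>l\<ge>N.
         sqrt (Re (ip (\<lambda>x. s k x - s l x) (\<lambda>x. s k x - s l x))) < e) \<Longrightarrow>
      \<exists>f\<in>F. (\<lambda>k. sqrt (Re (ip (\<lambda>x. s k x - f x) (\<lambda>x. s k x - f x)))) \<longlonglongrightarrow> 0"

definition kernel_section :: "'a set \<Rightarrow> ('a \<Rightarrow> 'a \<Rightarrow> complex) \<Rightarrow> 'a \<Rightarrow> 'a \<Rightarrow> complex" where
  "kernel_section X K y = (\<lambda>x. if x \<in> X then K x y else 0)"

locale rkhs = hilbert_function_space X F ip
  for X :: "'a set" and F ip +
  fixes K :: "'a \<Rightarrow> 'a \<Rightarrow> complex"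
  assumes kernel_mem: "\<And>y. y \<in> X \<Longrightarrow> kernel_section X K y \<in> F"
    and reproducing: "\<And>f y. f \<in> F \<Longrightarrow> y \<in> X \<Longrightarrow> f y = ip f (kernel_section X K y)"

definition weighted_comp ::
    "'a set \<Rightarrow> ('a \<Rightarrow> complex) \<Rightarrow> ('a \<Rightarrow> 'a) \<Rightarrow> ('a \<Rightarrow> complex) \<Rightarrow> ('a \<Rightarrow> complex)" where
  "weighted_comp X \<omega> \<Phi> f = (\<lambda>x. if x \<in> X then \<omega> x * f (\<Phi> x) else 0)"

definition unitary_on ::
    "('a \<Rightarrow> complex) set \<Rightarrow> (('a \<Rightarrow> complex) \<Rightarrow> ('a \<Rightarrow> complex) \<Rightarrow> complex) \<Rightarrow>
     (('a \<Rightarrow> complex) \<Rightarrow> ('a \<Rightarrow> complex)) \<Rightarrow> bool" where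
  "unitary_on F ip T \<longleftrightarrow>
     bij_betw T F F \<and>
     (\<forall>f\<in>F. \<forall>g\<in>F. T (\<lambda>x. f x + g x) = (\<lambda>x. T f x + T g x)) \<and>
     (\<forall>c. \<forall>f\<in>F. T (\<lambda>x. c * f x) = (\<lambda>x. c * T f x)) \<and>
     (\<forall>f\<in>F. \<forall>g\<in>F. ip (T f) (T g) = ip f g)"

definition partial_deriv :: "(complex ^ 'n) \<Rightarrow> (complex ^ 'n \<Rightarrow> complex) \<Rightarrow> complex ^ 'n \<Rightarrow> complex" where
  "partial_deriv v u z = vector_derivative (\<lambda>t::real. u (z + t *\<^sub>R v)) (at 0)"

text \<open>The Wirtinger derivatives with respect to the \<open>j\<close>-th coordinate and its conjugate.\<close>

definition wirtinger :: "'n \<Rightarrow> (complex ^ 'n \<Rightarrow> complex) \<Rightarrow> complex ^ 'n \<Rightarrow> complex" where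
  "wirtinger j u z =
     (partial_deriv (axis j 1) u z - \<i> * partial_deriv (axis j \<i>) u z) / 2"

definition wirtinger_cnj :: "'n \<Rightarrow> (complex ^ 'n \<Rightarrow> complex) \<Rightarrow> complex ^ 'n \<Rightarrow> complex" where
  "wirtinger_cnj j u z =
     (partial_deriv (axis j 1) u z + \<i> * partial_deriv (axis j \<i>) u z) / 2"

text \<open>\<open>kernel_form K z v w\<close> is the value of the form at the point \<open>z\<close> on the tangent vectors \<open>v\<close>, \<open>w\<close>.\<close>

definition kernel_form ::
    "(complex ^ 'n \<Rightarrow> complex ^ 'n \<Rightarrow> complex) \<Rightarrow>
     complex ^ 'n \<Rightarrow> complex ^ 'n \<Rightarrow> complex ^ 'n \<Rightarrow> complex" where
  "kernel_form K z v w =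
     (\<Sum>j\<in>UNIV. \<Sum>k\<in>UNIV.
        wirtinger j (wirtinger_cnj k (\<lambda>x. complex_of_real (ln (Re (K x x))))) z
          * (v $ j) * cnj (w $ k))"

definition delta1 :: "('a \<Rightarrow> 'a \<Rightarrow> complex) \<Rightarrow> 'a \<Rightarrow> 'a \<Rightarrow> real" where
  "delta1 K x y = sqrt (1 - (cmod (K x y))\<^sup>2 / (Re (K x x) * Re (K y y)))"

definition delta2 :: "('a \<Rightarrow> 'a \<Rightarrow> complex) \<Rightarrow> 'a \<Rightarrow> 'a \<Rightarrow> real" where
  "delta2 K x y = sqrt (2 - 2 * (cmod (K x y) / sqrt (Re (K x x) * Re (K y y))))"

definition pullback_form ::
    "(complex ^ 'n \<Rightarrow> complex ^ 'n) \<Rightarrow>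
     (complex ^ 'n \<Rightarrow> complex ^ 'n \<Rightarrow> complex ^ 'n \<Rightarrow> complex) \<Rightarrow>
     complex ^ 'n \<Rightarrow> complex ^ 'n \<Rightarrow> complex ^ 'n \<Rightarrow> complex" where
  "pullback_form \<Phi> s z v w =
     s (\<Phi> z) (frechet_derivative \<Phi> (at z) v) (frechet_derivative \<Phi> (at z) w)"

definition aut_invariant_form ::
    "(complex ^ 'n) set \<Rightarrow> (complex ^ 'n \<Rightarrow> complex ^ 'n \<Rightarrow> complex ^ 'n \<Rightarrow> complex) \<Rightarrow> bool" where
  "aut_invariant_form X s \<longleftrightarrow> (\<forall>\<Phi>\<in>Aut X. \<forall>z\<in>X. \<forall>v w. pullback_form \<Phi> s z v w = s z v w)"

definition aut_invariant_dist ::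
    "(complex ^ 'n) set \<Rightarrow> (complex ^ 'n \<Rightarrow> complex ^ 'n \<Rightarrow> real) \<Rightarrow> bool" where
  "aut_invariant_dist X d \<longleftrightarrow> (\<forall>\<Phi>\<in>Aut X. \<forall>x\<in>X. \<forall>y\<in>X. d (\<Phi> x) (\<Phi> y) = d x y)"

end

theory Submission
  imports Defs "HOL-Complex_Analysis.Complex_Analysis"
begin

text \<open>
  For an automorphism \<open>\<Phi>\<close> put \<open>L x y = K (\<Phi> x) (\<Phi> y)\<close>; everything is a statement about the pair \<open>K, L\<close>.

  Rescaling is equivalent to the cross ratio identity
  \<open>L x x' * K x y * K y x' * L y y = L x y * L y x' * K x x' * K y y\<close> for one fixed \<open>y\<close>. Its diagonal
  \<open>x = x'\<close> is condition (iv), and a sesqui-holomorphic function that vanishes on the diagonal of a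
  nonempty open set vanishes identically (polarization and the identity theorem), so (iv) on a small
  set gives the cross ratio identity everywhere. On \<open>{K x y \<noteq> 0}\<close> the multiplier is a constant times
  \<open>L x y / K x y\<close>; near the zeros of \<open>K x y\<close> one moves to another base point. The distances are
  functions of the normalized kernel in (iv). For the Hermitean form put \<open>\<rho> = L / K\<close> near the diagonal:
  equality of the forms says \<open>\<partial>\<^sub>x (\<partial>\<^sub>y \<rho> / \<rho>) = 0\<close> on the diagonal, hence off the diagonal by
  polarization, so \<open>\<rho> x y * \<rho> z z = \<rho> x z * \<rho> z y\<close>.

  All of this needs joint regularity of \<open>K\<close>, which is only assumed to be holomorphic in each variable
  separately; this is Hartogs' theorem on separate analyticity. Its core is Hartogs' lemma on sequences of
  holomorphic functions, proved here without subharmonic functions: by dominated convergence and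
  averaging over rotations, most of the \<open>N\<close>-th roots of a suitable unimodular number are good points for
  the Taylor polynomial of the \<open>k\<close>-th function; multiplying by the few linear factors that vanish at the
  bad points and interpolating at the \<open>N\<close> nodes bounds the polynomial.

  The equivalence with (ii) holds for arbitrary kernels: the weighted composition operator permutes the
  multiples of the kernel sections isometrically, and these span a dense subspace.
\<close>

section \<open>Holomorphy along complex lines\<close>

text \<open>Everything is reduced to one complex variable along affine complex lines; no power
  series in several variables occur. The price is that joint continuity has to be carried along,
  since it is what lets derivatives pass under Cauchy integrals. The hard input is local boundedness
  of a separately holomorphic function. Baire's theorem bounds it only for the second variable near
  some point y1, not near the prescribed y0. The Taylor series around y1 does reach y0, but the
  bound there depends on the first variable; Hartogs' lemma removes this dependence at the cost of
  an arbitrarily small loss of radius. A rescaling puts no regularity on its multiplier \<omega>.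
  That makes patching by pointwise chosen base points legitimate, but it also means that \<omega>
  can never be differentiated. Invariance of the form under rescaling is therefore read off from an
  identity in which \<omega> occurs only through a factor independent of the variable of
  differentiation.\<close>

lemma norm_smult_vec: "norm (c *s (v :: complex ^ 'n)) = cmod c * norm v"
  by (simp add: norm_vec_def norm_mult L2_set_right_distrib vector_scalar_mult_def)

lemma continuous_on_smult_vec [continuous_intros]:
  fixes g :: "'a::topological_space \<Rightarrow> complex ^ 'n"
  assumes "continuous_on S f" "continuous_on S g"
  shows "continuous_on S (\<lambda>x. f x *s g x)"
  unfolding vector_scalar_mult_def using assms by (intro continuous_intros)

lemma open_line_preimage:
  fixes v :: "complex ^ 'n"
  assumes "open W" shows "open {t. x + t *s v \<in> W}"
proof -
  have "open ((\<lambda>t. x + t *s v) -` W)"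
    using assms by (intro open_vimage) (auto intro!: continuous_intros)
  then show ?thesis by (simp add: vimage_def)
qed

lemma convex_line_preimage:
  fixes v :: "complex ^ 'n"
  assumes "convex W" shows "convex {t. x + t *s v \<in> W}"
proof (rule convexI)
  fix s t u w assume st: "s \<in> {t. x + t *s v \<in> W}" "t \<in> {t. x + t *s v \<in> W}" and uw: "0 \<le> (u::real)" "0 \<le> w" "u + w = 1"
  have "(u + w) *\<^sub>R x + (u *\<^sub>R s + w *\<^sub>R t) *s v = u *\<^sub>R (x + s *s v) + w *\<^sub>R (x + t *s v)"
    by (simp add: vec_eq_iff algebra_simps scaleR_conv_of_real[where 'a = complex])
  moreover have "u *\<^sub>R (x + s *s v) + w *\<^sub>R (x + t *s v) \<in> W"
    by (rule convexD[OF assms]) (use st uw in \<open>auto simp only: mem_Collect_eq\<close>)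
  ultimately show "u *\<^sub>R s + w *\<^sub>R t \<in> {t. x + t *s v \<in> W}"
    unfolding mem_Collect_eq uw(3) scaleR_one by metis
qed

definition line_hol :: "(complex ^ 'n \<Rightarrow> complex) \<Rightarrow> (complex ^ 'n) set \<Rightarrow> bool" where
  "line_hol f W \<longleftrightarrow> (\<forall>x\<in>W. \<forall>v. (\<lambda>t. f (x + t *s v)) field_differentiable at 0)"

lemma line_hol_subset: "line_hol f W \<Longrightarrow> V \<subseteq> W \<Longrightarrow> line_hol f V"
  by (auto simp: line_hol_def)

lemma line_hol_field_differentiable:
  assumes "line_hol f W" "x + t0 *s v \<in> W"
  shows "(\<lambda>t. f (x + t *s v)) field_differentiable at t0"
proof -
  have "(\<lambda>s. f ((x + t0 *s v) + s *s v)) field_differentiable at (t0 - t0)"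
    using assms by (simp add: line_hol_def)
  then have "((\<lambda>s. f ((x + t0 *s v) + s *s v)) \<circ> (\<lambda>t. t - t0)) field_differentiable at t0"
    by (intro field_differentiable_compose field_differentiable_diff) auto
  moreover have "(\<lambda>s. f ((x + t0 *s v) + s *s v)) \<circ> (\<lambda>t. t - t0) = (\<lambda>t. f (x + t *s v))"
    by (simp add: fun_eq_iff add.assoc flip: vector_sadd_rdistrib)
  ultimately show ?thesis by simp
qed

lemma line_hol_holomorphic_on:
  assumes "line_hol f W" "\<And>t. t \<in> T \<Longrightarrow> x + t *s v \<in> W"
  shows "(\<lambda>t. f (x + t *s v)) holomorphic_on T"
  unfolding holomorphic_on_def
  using line_hol_field_differentiable[OF assms(1) assms(2)] field_differentiable_at_within by blast

lemma holomorphic_fun_on_line_deriv: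
  fixes f :: "complex ^ 'n \<Rightarrow> complex"
  assumes D: "(f has_derivative D) (at x)" and lin: "\<And>c v. D (c *s v) = c * D v"
  shows "((\<lambda>t. f (x + t *s v)) has_field_derivative D v) (at 0)"
proof -
  have "bounded_linear (\<lambda>t. t *s v)"
  proof (rule bounded_linear_intro)
    show "norm (t *s v) \<le> norm t * norm v" for t by (simp add: norm_smult_vec)
    show "(r *\<^sub>R t) *s v = r *\<^sub>R (t *s v)" for r t
      by (simp add: vec_eq_iff scaleR_conv_of_real[where 'a = complex])
  qed (simp add: vector_sadd_rdistrib)
  then have "((\<lambda>t. x + t *s v) has_derivative (\<lambda>t. t *s v)) (at 0)"
    by (auto intro!: derivative_eq_intros bounded_linear_imp_has_derivative)
  then have "((\<lambda>t. f (x + t *s v)) has_derivative (\<lambda>t. D (t *s v))) (at 0)"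
    by (rule has_derivative_compose) (use D in simp)
  moreover have "(\<lambda>t. D (t *s v)) = (*) (D v)" by (auto simp: lin mult.commute)
  ultimately show ?thesis by (simp add: has_field_derivative_def)
qed

lemma holomorphic_fun_on_imp_line_hol:
  assumes "holomorphic_fun_on f X" shows "line_hol f X"
  unfolding line_hol_def field_differentiable_def
proof (intro ballI allI)
  fix x v assume "x \<in> X"
  then obtain D where D: "(f has_derivative D) (at x)" "\<forall>c v. D (c *s v) = c * D v"
    using assms unfolding holomorphic_fun_on_def by blast
  show "\<exists>f'. ((\<lambda>t. f (x + t *s v)) has_field_derivative f') (at 0)"
    by (rule exI, rule holomorphic_fun_on_line_deriv[OF D(1)]) (use D(2) in simp)
qed

text \<open>A complex line meets a ball in a convex, hence connected, set of parameters, so the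
  one-variable identity theorem on the line from x through y carries the zeros near x to y.\<close>

lemma line_hol_eq_0_ball:
  assumes f: "line_hol f (ball c e)" and U: "open U" "x \<in> U" "x \<in> ball c e" "\<And>y. y \<in> U \<Longrightarrow> f y = 0"
    and y: "y \<in> ball c e"
  shows "f y = 0"
proof -
  define T where "T = {t. x + t *s (y - x) \<in> ball c e}"
  define T0 where "T0 = {t. x + t *s (y - x) \<in> U}"
  have "convex T" unfolding T_def by (intro convex_line_preimage convex_ball)
  have "(\<lambda>t. f (x + t *s (y - x))) 1 = 0"
  proof (rule analytic_continuation_open[of "T \<inter> T0" T "\<lambda>t. f (x + t *s (y - x))" "\<lambda>_. 0"])
    show "open (T \<inter> T0)" "open T"
      unfolding T_def T0_def by (intro open_Int open_line_preimage open_ball U(1))+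
    have "0 \<in> T \<inter> T0" using U(2,3) by (simp add: T_def T0_def)
    then show "T \<inter> T0 \<noteq> {}" by blast
    show "connected T" using \<open>convex T\<close> by (rule convex_connected)
    show "(\<lambda>t. f (x + t *s (y - x))) holomorphic_on T"
      by (rule line_hol_holomorphic_on[OF f]) (simp add: T_def)
    show "1 \<in> T" using y by (simp add: T_def)
    show "f (x + z *s (y - x)) = 0" if "z \<in> T \<inter> T0" for z
      using that by (intro U(4)) (simp add: T0_def)
  qed auto
  then show ?thesis by simp
qed

text \<open>The interior of the zero set is clopen in X: a ball around a limit point meets it in a
  nonempty open set, and the version for balls then fills the whole ball.\<close>

lemma line_hol_eq_0:
  assumes X: "open X" "connected X" and f: "line_hol f X"
    and U: "open U" "U \<subseteq> X" "U \<noteq> {}" "\<And>y. y \<in> U \<Longrightarrow> f y = 0" and y: "y \<in> X"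
  shows "f y = 0"
proof -
  define Z where "Z = interior {x \<in> X. f x = 0}"
  have "openin (top_of_set X) Z"
    using interior_subset unfolding Z_def by (intro open_subset) blast+
  moreover have "closedin (top_of_set X) Z"
    unfolding closedin_limpt
  proof (intro conjI allI impI)
    show "Z \<subseteq> X" using interior_subset unfolding Z_def by blast
    fix c assume c: "c islimpt Z \<and> c \<in> X"
    obtain e where e: "e > 0" "ball c e \<subseteq> X" using X(1) c openE by blast
    obtain x where x: "x \<in> Z" "x \<in> ball c e"
      using c e(1) by (auto simp: islimpt_approachable dist_commute)
    have Z0: "f y = 0" if "y \<in> Z" for y
      using that interior_subset unfolding Z_def by blast
    have "open Z" by (simp add: Z_def)
    then have "f y = 0" if "y \<in> ball c e" for y
      using line_hol_eq_0_ball[OF line_hol_subset[OF f e(2)], of Z x y] x Z0 that by blast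
    then have "ball c e \<subseteq> {x \<in> X. f x = 0}" using e by blast
    then have "ball c e \<subseteq> Z" unfolding Z_def by (intro interior_maximal) auto
    then show "c \<in> Z" using e(1) by auto
  qed
  moreover have "Z \<noteq> {}"
  proof -
    have "U \<subseteq> Z" unfolding Z_def using U by (intro interior_maximal) auto
    then show ?thesis using U(3) by blast
  qed
  ultimately have "Z = X" using X(2)[unfolded connected_clopen, rule_format, of Z] by simp
  then show ?thesis using y interior_subset unfolding Z_def by blast
qed

text \<open>Cauchy's formula as an integral over a fixed real interval: in this shape the library
  theorems on continuity and differentiation of parameter integrals apply.\<close>

lemma deriv_eq_circle_integral:
  assumes r: "r > 0" and f: "\<And>t. cmod t \<le> r \<Longrightarrow> f field_differentiable at t"
  shows "deriv f 0 = integral (cbox 0 1) (\<lambda>\<theta>::real. f (r * cis (2 * pi * \<theta>)) * cis (- (2 * pi * \<theta>))) / r"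
proof -
  have "((\<lambda>u. f u / (u - 0) ^ Suc 1) has_contour_integral ((2 * pi * \<i>) / fact 1 * (deriv ^^ 1) f 0)) (circlepath 0 r)"
  proof (rule Cauchy_has_contour_integral_higher_derivative_circlepath[of 0 r f 0 1])
    show "continuous_on (cball 0 r) f"
      using f by (intro continuous_at_imp_continuous_on) (auto intro: field_differentiable_imp_continuous_at)
    show "f holomorphic_on ball 0 r"
      unfolding holomorphic_on_def by (rule ballI, rule field_differentiable_at_within, rule f) auto
    show "0 \<in> ball 0 r" using r by simp
  qed
  then have "((\<lambda>x. f (circlepath 0 r x) / (circlepath 0 r x - 0) ^ Suc 1 * vector_derivative (circlepath 0 r) (at x within {0..1}))
     has_integral (2 * pi * \<i>) * deriv f 0) {0..1}"
    unfolding has_contour_integral_def by simp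
  then have "((\<lambda>\<theta>. (2 * pi * \<i>) * (f (r * cis (2 * pi * \<theta>)) * cis (- (2 * pi * \<theta>)) / r)) has_integral (2 * pi * \<i>) * deriv f 0) {0..1}"
  proof (rule has_integral_eq[rotated])
    fix x :: real assume x: "x \<in> {0..1}"
    have c: "circlepath 0 r x = r * cis (2 * pi * x)"
      by (simp add: circlepath cis_conv_exp mult_ac)
    have v: "vector_derivative (circlepath 0 r) (at x within {0..1}) = 2 * pi * \<i> * (r * cis (2 * pi * x))"
      using x by (simp add: vector_derivative_circlepath01 cis_conv_exp mult_ac)
    have alg: "F / (of_real r * q) ^ Suc 1 * (P * (of_real r * q)) = P * (F * inverse q / of_real r)"
      if "q \<noteq> 0" for F P q :: complex
      using that r by (simp add: field_simps power2_eq_square)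
    have "cis (- (2 * pi * x)) = inverse (cis (2 * pi * x))" by simp
    then show "f (circlepath 0 r x) / (circlepath 0 r x - 0) ^ Suc 1 * vector_derivative (circlepath 0 r) (at x within {0..1})
        = (2 * pi * \<i>) * (f (r * cis (2 * pi * x)) * cis (- (2 * pi * x)) / r)"
      unfolding c v by (simp only: alg[OF cis_neq_zero] diff_0_right)
  qed
  then have "((\<lambda>\<theta>. r / (2 * pi * \<i>) * ((2 * pi * \<i>) * (f (r * cis (2 * pi * \<theta>)) * cis (- (2 * pi * \<theta>)) / r)))
      has_integral r / (2 * pi * \<i>) * ((2 * pi * \<i>) * deriv f 0)) {0..1}"
    by (rule has_integral_mult_right)
  moreover have e1: "r / (2 * pi * \<i>) * ((2 * pi * \<i>) * (F / r)) = F" for F :: complex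
    using r by simp
  moreover have cancel: "a / c * (c * F) = a * F" if "c \<noteq> 0" for a c F :: complex
    using that by simp
  have e2: "r / (2 * pi * \<i>) * ((2 * pi * \<i>) * F) = r * F" for F :: complex
    by (rule cancel) simp
  ultimately have "((\<lambda>\<theta>. f (r * cis (2 * pi * \<theta>)) * cis (- (2 * pi * \<theta>))) has_integral r * deriv f 0) {0..1}"
    by (simp only: e1 e2)
  then have "integral {0..1} (\<lambda>\<theta>. f (r * cis (2 * pi * \<theta>)) * cis (- (2 * pi * \<theta>))) = r * deriv f 0"
    by (rule integral_unique)
  then show ?thesis using r by simp
qed

text \<open>Sesqui-holomorphic functions: holomorphic in the first, antiholomorphic in the second variable. Complex
  differentiability is only required along lines; together with joint continuity this is stable under the
  directional derivatives below.\<close>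

definition bihol :: "(complex ^ 'm) set \<Rightarrow> (complex ^ 'n) set \<Rightarrow> (complex ^ 'm \<Rightarrow> complex ^ 'n \<Rightarrow> complex) \<Rightarrow> bool" where
  "bihol V W G \<longleftrightarrow> (\<forall>y\<in>W. line_hol (\<lambda>x. G x y) V) \<and> (\<forall>x\<in>V. line_hol (\<lambda>y. cnj (G x y)) W) \<and>
     continuous_on (V \<times> W) (\<lambda>p. G (fst p) (snd p))"

section \<open>Holomorphic and antiholomorphic directional derivatives\<close>

definition dl :: "complex ^ 'm \<Rightarrow> (complex ^ 'm \<Rightarrow> complex ^ 'n \<Rightarrow> complex) \<Rightarrow> complex ^ 'm \<Rightarrow> complex ^ 'n \<Rightarrow> complex" where
  "dl v G x y = deriv (\<lambda>t. G (x + t *s v) y) 0"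

text \<open>The antiholomorphic derivative \<open>dr\<close> is conjugate-linear in the direction.\<close>

definition dr :: "complex ^ 'n \<Rightarrow> (complex ^ 'm \<Rightarrow> complex ^ 'n \<Rightarrow> complex) \<Rightarrow> complex ^ 'm \<Rightarrow> complex ^ 'n \<Rightarrow> complex" where
  "dr v G x y = cnj (deriv (\<lambda>t. cnj (G x (y + t *s v))) 0)"

text \<open>Exchanging the variables under conjugation preserves \<open>bihol\<close>, so facts
  about \<open>dr\<close> can be transferred from \<open>dl\<close>.\<close>

definition adj :: "('a \<Rightarrow> 'b \<Rightarrow> complex) \<Rightarrow> 'b \<Rightarrow> 'a \<Rightarrow> complex" where
  "adj G y x = cnj (G x y)"

lemma dr_eq_adj: "dr v G = adj (dl v (adj G))"
  by (simp add: dr_def dl_def adj_def fun_eq_iff)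

lemma bihol_adj:
  assumes G: "bihol V W G" shows "bihol W V (adj G)"
proof -
  have c: "continuous_on (V \<times> W) (\<lambda>p. G (fst p) (snd p))"
    using G unfolding bihol_def by (elim conjE)
  have sw: "continuous_on (W \<times> V) (\<lambda>p. (snd p, fst p))"
    by (intro continuous_on_Pair continuous_on_snd continuous_on_fst continuous_on_id)
  have "(\<lambda>p. (snd p, fst p)) ` (W \<times> V) \<subseteq> V \<times> W" by auto
  from continuous_on_compose2[OF c sw this]
  have "continuous_on (W \<times> V) (\<lambda>p. G (snd p) (fst p))" unfolding fst_conv snd_conv .
  then have "continuous_on (W \<times> V) (\<lambda>p. cnj (G (snd p) (fst p)))" by (rule continuous_on_cnj)
  with G show ?thesis unfolding bihol_def adj_def complex_cnj_cnj by (elim conjE) (intro conjI)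
qed

lemma bihol_line_hol:
  assumes "bihol V W G"
  shows "y \<in> W \<Longrightarrow> line_hol (\<lambda>x. G x y) V" "x \<in> V \<Longrightarrow> line_hol (\<lambda>y. cnj (G x y)) W"
  using assms by (auto simp: bihol_def)

lemma bihol_subset:
  assumes G: "bihol V W G" and sub: "V' \<subseteq> V" "W' \<subseteq> W" shows "bihol V' W' G"
  unfolding bihol_def
proof (intro conjI ballI)
  fix y assume "y \<in> W'"
  then show "line_hol (\<lambda>x. G x y) V'"
    using G sub by (intro line_hol_subset[OF _ sub(1)]) (auto simp: bihol_def)
next
  fix x assume "x \<in> V'"
  then show "line_hol (\<lambda>y. cnj (G x y)) W'"
    using G sub by (intro line_hol_subset[OF _ sub(2)]) (auto simp: bihol_def)
next
  show "continuous_on (V' \<times> W') (\<lambda>p. G (fst p) (snd p))"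
  proof (rule continuous_on_subset)
    show "continuous_on (V \<times> W) (\<lambda>p. G (fst p) (snd p))"
      using G unfolding bihol_def by (elim conjE)
    show "V' \<times> W' \<subseteq> V \<times> W" by (rule Sigma_mono[OF sub])
  qed
qed

lemma continuous_on_bihol:
  assumes "bihol V W G" "continuous_on S f" "continuous_on S g" "\<And>p. p \<in> S \<Longrightarrow> f p \<in> V" "\<And>p. p \<in> S \<Longrightarrow> g p \<in> W"
  shows "continuous_on S (\<lambda>p. G (f p) (g p))"
proof -
  have a: "continuous_on S (\<lambda>p. (f p, g p))" using assms by (intro continuous_intros)
  have b: "continuous_on (V \<times> W) (\<lambda>p. G (fst p) (snd p))"
    using assms(1) unfolding bihol_def by (elim conjE)
  have c: "(\<lambda>p. (f p, g p)) ` S \<subseteq> V \<times> W" using assms(4,5) by auto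
  from continuous_on_compose2[OF b a c] show ?thesis unfolding fst_conv snd_conv .
qed

lemma dl_integral:
  assumes G: "bihol V W G" and y: "y \<in> W" and r: "r > 0" and V: "\<And>t. cmod t \<le> r \<Longrightarrow> x + t *s v \<in> V"
  shows "dl v G x y = integral (cbox 0 1) (\<lambda>\<theta>::real. G (x + (r * cis (2 * pi * \<theta>)) *s v) y * cis (- (2 * pi * \<theta>))) / r"
proof -
  have "(\<lambda>t. G (x + t *s v) y) field_differentiable at t" if "cmod t \<le> r" for t
    using line_hol_field_differentiable[OF bihol_line_hol(1)[OF G y] V[OF that]] .
  from deriv_eq_circle_integral[OF r this] show ?thesis unfolding dl_def .
qed

text \<open>The radius r serves all base points near x at once, so that Cauchy integrals at
  different base points run over the same circle of parameters.\<close>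

lemma open_line_radius:
  assumes "open V" "x \<in> (V :: (complex ^ 'n) set)"
  obtains \<rho> r where "\<rho> > 0" "r > 0" "\<forall>x'\<in>ball x \<rho>. \<forall>t. cmod t \<le> r \<longrightarrow> x' + t *s v \<in> V"
proof -
  obtain e where e: "e > 0" "ball x e \<subseteq> V" using assms openE by blast
  \<comment> \<open>The summand 1 keeps the denominator positive for v = 0.\<close>
  define r where "r = e / (2 * (1 + norm v))"
  have n: "1 + norm v > 0" by (smt (verit) norm_ge_zero)
  have r: "r > 0" using e n by (simp add: r_def)
  have "x' + t *s v \<in> V" if "x' \<in> ball x (e/2)" "cmod t \<le> r" for x' t
  proof -
    have "cmod t * norm v \<le> r * norm v" using that(2) by (intro mult_right_mono) auto
    also have "\<dots> < r * (1 + norm v)" using r by (intro mult_strict_left_mono) auto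
    also have "\<dots> = e / 2" using n by (simp add: r_def divide_simps)
    finally have "norm (t *s v) < e / 2" by (simp add: norm_smult_vec)
    moreover have "norm (x' - x) < e / 2" using that(1) by (simp add: dist_norm norm_minus_commute)
    ultimately have "norm ((x' - x) + t *s v) < e" by (intro norm_triangle_lt) simp
    then have "x' + t *s v \<in> ball x e" by (simp add: dist_norm norm_minus_commute algebra_simps)
    then show ?thesis using e by blast
  qed
  with r e(1) show thesis by (intro that[of "e/2" r]) auto
qed

text \<open>Near each x the Cauchy integral can use one fixed radius and then has a jointly
  continuous integrand; the local statements are glued over an open cover of V.\<close>

lemma continuous_on_dl:
  assumes G: "bihol V W G" and o: "open V" "open W"
  shows "continuous_on (V \<times> W) (\<lambda>p. dl v G (fst p) (snd p))"
proof -
  have "\<exists>S. open S \<and> x \<in> S \<and> S \<subseteq> V \<and> continuous_on (S \<times> W) (\<lambda>p. dl v G (fst p) (snd p))" if x: "x \<in> V" for x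
  proof -
    obtain \<rho> r where r': "\<rho> > 0" "r > 0" "\<forall>x'\<in>ball x \<rho>. \<forall>t. cmod t \<le> r \<longrightarrow> x' + t *s v \<in> V"
      by (rule open_line_radius[OF o(1) x, of v])
    note r = r'(1,2) r'(3)[rule_format]
    have sub: "ball x \<rho> \<subseteq> V"
    proof
      fix y assume "y \<in> ball x \<rho>"
      from r(3)[OF this, of 0] r(2) show "y \<in> V" by simp
    qed
    have cont: "continuous_on ((ball x \<rho> \<times> W) \<times> cbox 0 1) (\<lambda>q. G (fst (fst q) + (r * cis (2 * pi * snd q)) *s v) (snd (fst q)))"
      by (rule continuous_on_bihol[OF G]) (use r in \<open>auto simp: norm_mult intro!: continuous_intros\<close>)
    have "continuous_on (ball x \<rho> \<times> W) (\<lambda>p. integral (cbox 0 1) (\<lambda>\<theta>::real. G (fst p + (r * cis (2 * pi * \<theta>)) *s v) (snd p) * cis (- (2 * pi * \<theta>))) / r)"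
      using r(2)
      by (intro continuous_on_divide integral_continuous_on_param continuous_on_const)
         (auto simp: split_beta intro!: continuous_on_mult cont[unfolded box_real] continuous_intros)
    then have "continuous_on (ball x \<rho> \<times> W) (\<lambda>p. dl v G (fst p) (snd p))"
    proof (rule continuous_on_eq)
      fix p assume p: "p \<in> ball x \<rho> \<times> W"
      then show "integral (cbox 0 1) (\<lambda>\<theta>::real. G (fst p + (r * cis (2 * pi * \<theta>)) *s v) (snd p) * cis (- (2 * pi * \<theta>))) / r
         = dl v G (fst p) (snd p)"
        by (intro dl_integral[OF G _ r(2) r(3), symmetric]) auto
    qed
    with r(1) sub show ?thesis by (intro exI[of _ "ball x \<rho>"]) auto
  qed
  then have "\<forall>x\<in>V. \<exists>S. open S \<and> x \<in> S \<and> S \<subseteq> V \<and> continuous_on (S \<times> W) (\<lambda>p. dl v G (fst p) (snd p))"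
    by (intro ballI)
  from bchoice[OF this] obtain S where
    S: "\<forall>x\<in>V. open (S x) \<and> x \<in> S x \<and> S x \<subseteq> V \<and> continuous_on (S x \<times> W) (\<lambda>p. dl v G (fst p) (snd p))"
    by (elim exE)
  have "continuous_on (\<Union>x\<in>V. S x \<times> W) (\<lambda>p. dl v G (fst p) (snd p))"
    using S o(2) by (intro continuous_on_open_UN open_Times) auto
  also have "(\<Union>x\<in>V. S x \<times> W) = V \<times> W" using S by blast
  finally show ?thesis .
qed

lemma has_field_derivative_dl:
  assumes "bihol V W G" "y \<in> W" "x + s *s w \<in> V"
  shows "((\<lambda>s. G (x + s *s w) y) has_field_derivative dl w G (x + s *s w) y) (at s)"
proof -
  have "(\<lambda>t. G ((x + s *s w) + t *s w) y) field_differentiable at 0"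
    using bihol_line_hol(1)[OF assms(1,2)] assms(3) unfolding line_hol_def by blast
  then have 1: "((\<lambda>t. G ((x + s *s w) + t *s w) y) has_field_derivative dl w G (x + s *s w) y) (at 0)"
    unfolding dl_def DERIV_deriv_iff_field_differentiable .
  have "(x + s *s w) + t *s w = x + (t + s) *s w" for t
    by (simp only: vector_sadd_rdistrib add.assoc add.commute[of "t *s w"])
  with 1 have "((\<lambda>t. G (x + (t + s) *s w) y) has_field_derivative dl w G (x + s *s w) y) (at 0)"
    by (simp only:)
  then show ?thesis
    using DERIV_shift[of "\<lambda>s. G (x + s *s w) y" "dl w G (x + s *s w) y" 0 s] by (simp only: add_0_left)
qed

lemma has_field_derivative_dr:
  assumes "bihol V W G" "x \<in> V" "y + s *s w \<in> W"
  shows "((\<lambda>s. cnj (G x (y + s *s w))) has_field_derivative cnj (dr w G x (y + s *s w))) (at s)"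
  using has_field_derivative_dl[OF bihol_adj[OF assms(1)] assms(2,3)]
  by (simp only: dr_eq_adj adj_def complex_cnj_cnj)

lemma continuous_on_dl_comp:
  assumes "bihol V W G" "open V" "open W"
    "continuous_on S f" "continuous_on S g" "\<And>p. p \<in> S \<Longrightarrow> f p \<in> V" "\<And>p. p \<in> S \<Longrightarrow> g p \<in> W"
  shows "continuous_on S (\<lambda>p. dl v G (f p) (g p))"
proof -
  have "continuous_on S (\<lambda>p. (f p, g p))" using assms by (intro continuous_intros)
  from continuous_on_compose2[OF continuous_on_dl[OF assms(1-3), of v] this] assms(6,7)
  show ?thesis by (simp add: image_subset_iff)
qed

lemma continuous_on_dr_comp:
  assumes "bihol V W G" "open V" "open W"
    "continuous_on S f" "continuous_on S g" "\<And>p. p \<in> S \<Longrightarrow> f p \<in> V" "\<And>p. p \<in> S \<Longrightarrow> g p \<in> W"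
  shows "continuous_on S (\<lambda>p. dr v G (f p) (g p))"
  unfolding dr_eq_adj adj_def[of "dl v (adj G)"]
  by (intro continuous_on_cnj continuous_on_dl_comp[OF bihol_adj[OF assms(1)] assms(3,2,5,4,7,6)])

lemma ball_line_subset:
  fixes x w :: "complex ^ 'n"
  assumes "\<rho> > 0"
  obtains \<delta> where "\<delta> > 0" "\<forall>s\<in>ball 0 \<delta>. x + s *s w \<in> ball x \<rho>"
proof -
  have "open {s. x + s *s w \<in> ball x \<rho>}" by (intro open_line_preimage open_ball)
  moreover have "0 \<in> {s. x + s *s w \<in> ball x \<rho>}" using assms by simp
  ultimately obtain \<delta> where "\<delta> > 0" "ball 0 \<delta> \<subseteq> {s. x + s *s w \<in> ball x \<rho>}"
    using openE by blast
  then show thesis using that by blast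
qed

text \<open>Differentiability of \<open>dl v G\<close> in another direction w: the Cauchy integral
  in direction v is differentiated under the integral sign, where the derivative
  \<open>dl w G\<close> of the integrand is already known to be continuous.\<close>

lemma dl_line_hol:
  assumes G: "bihol V W G" and o: "open V" "open W" and y: "y \<in> W"
  shows "line_hol (\<lambda>x. dl v G x y) V"
  unfolding line_hol_def
proof (intro ballI allI)
  fix x w assume x: "x \<in> V"
  obtain \<rho> r where r': "\<rho> > 0" "r > 0" "\<forall>x'\<in>ball x \<rho>. \<forall>t. cmod t \<le> r \<longrightarrow> x' + t *s v \<in> V"
    by (rule open_line_radius[OF o(1) x, of v])
  note r = r'(1,2) r'(3)[rule_format]
  obtain \<delta> where d': "\<delta> > 0" "\<forall>s\<in>ball 0 \<delta>. x + s *s w \<in> ball x \<rho>"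
    by (rule ball_line_subset[OF r(1), of x w])
  note d = d'(1) d'(2)[rule_format]
  define \<gamma> where "\<gamma> \<theta> = r * cis (2 * pi * \<theta>)" for \<theta> :: real
  have \<gamma>: "cmod (\<gamma> \<theta>) \<le> r" for \<theta> using r(2) by (simp add: \<gamma>_def norm_mult)
  have \<gamma>c: "continuous_on S (\<lambda>q. \<gamma> (snd q))" "continuous_on T \<gamma>" for S :: "(complex \<times> real) set" and T
    unfolding \<gamma>_def by (intro continuous_intros)+
  have inV: "x + \<gamma> \<theta> *s v + s *s w \<in> V" if "s \<in> ball 0 \<delta>" for s \<theta>
    using r(3)[OF d(2)[OF that] \<gamma>[of \<theta>]] by (simp add: ac_simps)
  define I where "I s = integral (cbox 0 1) (\<lambda>\<theta>::real. G (x + \<gamma> \<theta> *s v + s *s w) y * cis (- (2 * pi * \<theta>)))" for s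
  have "(I has_field_derivative integral (cbox 0 1) (\<lambda>\<theta>::real. dl w G (x + \<gamma> \<theta> *s v + 0 *s w) y * cis (- (2 * pi * \<theta>)))) (at 0 within ball 0 \<delta>)"
    unfolding I_def
  proof (rule leibniz_rule_field_derivative)
    fix s :: complex and \<theta> :: real assume s: "s \<in> ball 0 \<delta>"
    show "((\<lambda>s. G (x + \<gamma> \<theta> *s v + s *s w) y * cis (- (2 * pi * \<theta>))) has_field_derivative
       dl w G (x + \<gamma> \<theta> *s v + s *s w) y * cis (- (2 * pi * \<theta>))) (at s within ball 0 \<delta>)"
      by (rule DERIV_cmult_right, rule has_field_derivative_at_within, rule has_field_derivative_dl[OF G y inV[OF s]])
  next
    fix s :: complex assume s: "s \<in> ball 0 \<delta>"
    have "continuous_on (cbox 0 1) (\<lambda>\<theta>. G (x + \<gamma> \<theta> *s v + s *s w) y)"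
      by (rule continuous_on_bihol[OF G]) (use inV[OF s] y in \<open>auto intro!: continuous_intros \<gamma>c\<close>)
    then have "continuous_on (cbox 0 1) (\<lambda>\<theta>. G (x + \<gamma> \<theta> *s v + s *s w) y * cis (- (2 * pi * \<theta>)))"
      by (rule continuous_on_mult) (intro continuous_intros)
    then show "(\<lambda>\<theta>. G (x + \<gamma> \<theta> *s v + s *s w) y * cis (- (2 * pi * \<theta>))) integrable_on cbox 0 1"
      by (rule integrable_continuous)
  next
    have "continuous_on (ball 0 \<delta> \<times> cbox 0 1) (\<lambda>q. dl w G (x + \<gamma> (snd q) *s v + fst q *s w) y)"
      by (rule continuous_on_dl_comp[OF G o]) (use inV y in \<open>auto intro!: continuous_intros \<gamma>c\<close>)
    then show "continuous_on (ball 0 \<delta> \<times> cbox 0 1) (\<lambda>(s, \<theta>). dl w G (x + \<gamma> \<theta> *s v + s *s w) y * cis (- (2 * pi * \<theta>)))"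
      unfolding split_beta by (rule continuous_on_mult) (intro continuous_intros)
  qed (use d(1) in auto)
  then have "I field_differentiable at 0"
    using d(1) at_within_open[of "0::complex" "ball 0 \<delta>"] by (auto simp: field_differentiable_def)
  then have "(\<lambda>s. I s / r) field_differentiable at 0"
    using r(2) by (intro field_differentiable_divide) auto
  then obtain D where "((\<lambda>s. I s / r) has_field_derivative D) (at 0)"
    by (auto simp: field_differentiable_def)
  then have "((\<lambda>s. dl v G (x + s *s w) y) has_field_derivative D) (at 0)"
  proof (rule has_field_derivative_transform_within_open)
    show "I s / r = dl v G (x + s *s w) y" if "s \<in> ball 0 \<delta>" for s
      unfolding I_def \<gamma>_def
      by (subst dl_integral[OF G y r(2) r(3)[OF d(2)[OF that]]]) (simp_all add: ac_simps)
  qed (use d in auto)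
  then show "(\<lambda>s. dl v G (x + s *s w) y) field_differentiable at 0"
    by (auto simp: field_differentiable_def)
qed

text \<open>The derivative is stated explicitly as a Cauchy integral of \<open>dr w G\<close>,
  because this is at the same time Cauchy's formula for \<open>dl v (dr w G)\<close>; the
  commutation of the two derivatives follows by comparison.\<close>

lemma dl_dr_deriv:
  assumes G: "bihol V W G" and o: "open V" "open W" and x: "x \<in> V" and y: "y \<in> W"
    and r: "r > 0" "\<And>t. cmod t \<le> r \<Longrightarrow> x + t *s v \<in> V"
  shows "((\<lambda>s. cnj (dl v G x (y + s *s w))) has_field_derivative
     cnj (integral (cbox 0 1) (\<lambda>\<theta>::real. dr w G (x + (r * cis (2 * pi * \<theta>)) *s v) y * cis (- (2 * pi * \<theta>))) / r)) (at 0)"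
proof -
  obtain \<rho> where \<rho>: "\<rho> > 0" "ball y \<rho> \<subseteq> W" using o(2) y openE by blast
  obtain \<delta> where d': "\<delta> > 0" "\<forall>s\<in>ball 0 \<delta>. y + s *s w \<in> ball y \<rho>"
    by (rule ball_line_subset[OF \<rho>(1), of y w])
  note d = d'(1) d'(2)[rule_format]
  define \<gamma> where "\<gamma> \<theta> = r * cis (2 * pi * \<theta>)" for \<theta> :: real
  have \<gamma>: "cmod (\<gamma> \<theta>) \<le> r" for \<theta> using r(1) by (simp add: \<gamma>_def norm_mult)
  have \<gamma>c: "continuous_on S (\<lambda>q. \<gamma> (snd q))" "continuous_on T \<gamma>" for S :: "(complex \<times> real) set" and T
    unfolding \<gamma>_def by (intro continuous_intros)+
  have inV: "x + \<gamma> \<theta> *s v \<in> V" for \<theta> using r(2) \<gamma> by blast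
  have inW: "y + s *s w \<in> W" if "s \<in> ball 0 \<delta>" for s using d(2)[OF that] \<rho>(2) by blast
  define I where "I s = integral (cbox 0 1) (\<lambda>\<theta>::real. cnj (G (x + \<gamma> \<theta> *s v) (y + s *s w)) * cis (2 * pi * \<theta>))" for s
  have "(I has_field_derivative integral (cbox 0 1) (\<lambda>\<theta>::real. cnj (dr w G (x + \<gamma> \<theta> *s v) (y + 0 *s w)) * cis (2 * pi * \<theta>))) (at 0 within ball 0 \<delta>)"
    unfolding I_def
  proof (rule leibniz_rule_field_derivative)
    fix s :: complex and \<theta> :: real assume s: "s \<in> ball 0 \<delta>"
    show "((\<lambda>s. cnj (G (x + \<gamma> \<theta> *s v) (y + s *s w)) * cis (2 * pi * \<theta>)) has_field_derivative
       cnj (dr w G (x + \<gamma> \<theta> *s v) (y + s *s w)) * cis (2 * pi * \<theta>)) (at s within ball 0 \<delta>)"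
      by (rule DERIV_cmult_right, rule has_field_derivative_at_within, rule has_field_derivative_dr[OF G inV inW[OF s]])
  next
    fix s :: complex assume s: "s \<in> ball 0 \<delta>"
    have "continuous_on (cbox 0 1) (\<lambda>\<theta>. G (x + \<gamma> \<theta> *s v) (y + s *s w))"
      by (rule continuous_on_bihol[OF G]) (use inW[OF s] inV in \<open>auto intro!: continuous_intros \<gamma>c\<close>)
    then have "continuous_on (cbox 0 1) (\<lambda>\<theta>. cnj (G (x + \<gamma> \<theta> *s v) (y + s *s w)) * cis (2 * pi * \<theta>))"
      by (rule continuous_on_mult[OF continuous_on_cnj]) (intro continuous_intros)
    then show "(\<lambda>\<theta>. cnj (G (x + \<gamma> \<theta> *s v) (y + s *s w)) * cis (2 * pi * \<theta>)) integrable_on cbox 0 1"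
      by (rule integrable_continuous)
  next
    have "continuous_on (ball 0 \<delta> \<times> cbox 0 1) (\<lambda>q. dr w G (x + \<gamma> (snd q) *s v) (y + fst q *s w))"
      by (rule continuous_on_dr_comp[OF G o]) (use inV inW in \<open>auto intro!: continuous_intros \<gamma>c\<close>)
    then show "continuous_on (ball 0 \<delta> \<times> cbox 0 1) (\<lambda>(s, \<theta>). cnj (dr w G (x + \<gamma> \<theta> *s v) (y + s *s w)) * cis (2 * pi * \<theta>))"
      unfolding split_beta by (rule continuous_on_mult[OF continuous_on_cnj]) (intro continuous_intros)
  qed (use d(1) in auto)
  then have "(I has_field_derivative integral (cbox 0 1) (\<lambda>\<theta>::real. cnj (dr w G (x + \<gamma> \<theta> *s v) y) * cis (2 * pi * \<theta>))) (at 0)"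
    using d(1) at_within_open[of "0::complex" "ball 0 \<delta>"] by simp
  then have "((\<lambda>s. I s / r) has_field_derivative integral (cbox 0 1) (\<lambda>\<theta>::real. cnj (dr w G (x + \<gamma> \<theta> *s v) y) * cis (2 * pi * \<theta>)) / r) (at 0)"
    by (rule DERIV_cdivide)
  then have "((\<lambda>s. cnj (dl v G x (y + s *s w))) has_field_derivative integral (cbox 0 1) (\<lambda>\<theta>::real. cnj (dr w G (x + \<gamma> \<theta> *s v) y) * cis (2 * pi * \<theta>)) / r) (at 0)"
  proof (rule has_field_derivative_transform_within_open)
    show "I s / r = cnj (dl v G x (y + s *s w))" if "s \<in> ball 0 \<delta>" for s
      unfolding I_def \<gamma>_def
      by (subst dl_integral[OF G inW[OF that] r])
         (simp_all add: Henstock_Kurzweil_Integration.integral_cnj cis_cnj)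
  qed (use d in auto)
  then show ?thesis
    by (simp add: \<gamma>_def Henstock_Kurzweil_Integration.integral_cnj cis_cnj)
qed

lemma bihol_dl:
  assumes G: "bihol V W G" and o: "open V" "open W"
  shows "bihol V W (dl v G)"
  unfolding bihol_def
proof (intro conjI ballI)
  fix x assume x: "x \<in> V"
  obtain \<rho> r where r': "\<rho> > 0" "r > 0" "\<forall>x'\<in>ball x \<rho>. \<forall>t. cmod t \<le> r \<longrightarrow> x' + t *s v \<in> V"
    by (rule open_line_radius[OF o(1) x, of v])
  note r = r'(1,2) r'(3)[rule_format]
  have "x \<in> ball x \<rho>" using r(1) by simp
  then show "line_hol (\<lambda>y. cnj (dl v G x y)) W"
    unfolding line_hol_def field_differentiable_def
    using dl_dr_deriv[OF G o x _ r(2) r(3)] by blast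
qed (use dl_line_hol[OF G o] continuous_on_dl[OF G o] in auto)

lemma bihol_dr:
  assumes G: "bihol V W G" and o: "open V" "open W"
  shows "bihol V W (dr v G)"
  unfolding dr_eq_adj by (intro bihol_adj bihol_dl G o)

lemma dl_dr_commute:
  assumes G: "bihol V W G" and o: "open V" "open W" and x: "x \<in> V" and y: "y \<in> W"
  shows "dr w (dl v G) x y = dl v (dr w G) x y"
proof -
  obtain \<rho> r where r': "\<rho> > 0" "r > 0" "\<forall>x'\<in>ball x \<rho>. \<forall>t. cmod t \<le> r \<longrightarrow> x' + t *s v \<in> V"
    by (rule open_line_radius[OF o(1) x, of v])
  note r = r'(1,2) r'(3)[rule_format]
  have x': "x \<in> ball x \<rho>" using r(1) by simp
  have "dr w (dl v G) x y = integral (cbox 0 1) (\<lambda>\<theta>::real. dr w G (x + (r * cis (2 * pi * \<theta>)) *s v) y * cis (- (2 * pi * \<theta>))) / r"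
    using DERIV_imp_deriv[OF dl_dr_deriv[where w = w, OF G o x y r(2) r(3)[OF x']]]
    by (simp only: dr_def[of w "dl v G" x y] complex_cnj_cnj)
  also have "\<dots> = dl v (dr w G) x y"
    by (rule dl_integral[OF bihol_dr[OF G o] y r(2) r(3)[OF x'], symmetric])
  finally show ?thesis .
qed

section \<open>Polarization\<close>

text \<open>Total differentiability at the origin from one continuous partial derivative and the
  value of the other at the origin, followed by the chain rule along the diagonal.\<close>

lemma has_vector_derivative_diagonal:
  fixes f :: "real \<Rightarrow> real \<Rightarrow> complex"
  assumes e: "e > 0" and d1: "((\<lambda>t. f t 0) has_vector_derivative a) (at 0)"
    and d2: "\<And>t s. t \<in> ball 0 e \<Longrightarrow> s \<in> ball 0 e \<Longrightarrow> ((\<lambda>s. f t s) has_vector_derivative f2 t s) (at s)"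
    and c: "continuous_on (ball 0 e \<times> ball 0 e) (\<lambda>p. f2 (fst p) (snd p))"
  shows "((\<lambda>t. f t t) has_vector_derivative a + f2 0 0) (at 0)"
proof -
  have c': "continuous_on (ball 0 e \<times> ball 0 e) (\<lambda>p. blinfun_scaleR_left (f2 (fst p) (snd p)))"
    by (rule bounded_linear.continuous_on[OF bounded_linear_blinfun_scaleR_left c])
  have "((\<lambda>(t, s). f t s) has_derivative (\<lambda>(t, s). t *\<^sub>R a + blinfun_scaleR_left (f2 0 0) s))
      (at (0, 0) within ball 0 e \<times> ball 0 e)"
  proof (rule has_derivative_partialsI[where f = f and fy = "\<lambda>t s. blinfun_scaleR_left (f2 t s)" and fx = "\<lambda>t. t *\<^sub>R a"])
    show "((\<lambda>t. f t 0) has_derivative (\<lambda>t. t *\<^sub>R a)) (at 0 within ball 0 e)"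
      using d1 unfolding has_vector_derivative_def by (rule has_derivative_at_withinI)
    show "((\<lambda>s. f t s) has_derivative blinfun_apply (blinfun_scaleR_left (f2 t s))) (at s within ball 0 e)"
      if "t \<in> ball 0 e" "s \<in> ball 0 e" for t s
    proof -
      have "blinfun_apply (blinfun_scaleR_left (f2 t s)) = (\<lambda>h. h *\<^sub>R f2 t s)"
        by (simp add: fun_eq_iff)
      then show ?thesis
        using has_derivative_at_withinI[OF d2[OF that, unfolded has_vector_derivative_def], of "ball 0 e"] by simp
    qed
    show "continuous (at (0, 0) within ball 0 e \<times> ball 0 e) (\<lambda>(t, s). blinfun_scaleR_left (f2 t s))"
      using c'[unfolded continuous_on_eq_continuous_within, rule_format, of "(0, 0)"] e
      unfolding split_beta by simp
  qed (use e in auto)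
  then have "((\<lambda>(t, s). f t s) has_derivative (\<lambda>(t, s). t *\<^sub>R a + s *\<^sub>R f2 0 0)) (at (0, 0))"
    using e by (subst (asm) at_within_open) (auto intro: open_Times)
  moreover have "((\<lambda>t. (t, t)) has_derivative (\<lambda>t. (t, t))) (at (0::real))"
    by (auto intro!: derivative_eq_intros)
  ultimately have "((\<lambda>t. case (t, t) of (t, s) \<Rightarrow> f t s) has_derivative (\<lambda>t. case (t, t) of (t, s) \<Rightarrow> t *\<^sub>R a + s *\<^sub>R f2 0 0)) (at 0)"
    by (rule has_derivative_compose[rotated])
  then show ?thesis by (simp add: has_vector_derivative_def scaleR_add_right)
qed

section \<open>Calculus of the directional derivatives\<close>

lemma dl_deriv:
  assumes "bihol V W G" "x \<in> V" "y \<in> W"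
  shows "((\<lambda>t. G (x + t *s v) y) has_field_derivative dl v G x y) (at 0)"
  using has_field_derivative_dl[OF assms(1,3), of x 0 v] assms(2) by simp

lemma dr_deriv:
  assumes "bihol V W G" "x \<in> V" "y \<in> W"
  shows "((\<lambda>t. cnj (G x (y + t *s v))) has_field_derivative cnj (dr v G x y)) (at 0)"
  using has_field_derivative_dr[OF assms(1,2), of y 0 v] assms(3) by simp

lemma dl_eqI:
  assumes "((\<lambda>t. G (x + t *s v) y) has_field_derivative D) (at 0)" shows "dl v G x y = D"
  unfolding dl_def using assms by (rule DERIV_imp_deriv)

lemma dr_eqI:
  assumes "((\<lambda>t. cnj (G x (y + t *s v))) has_field_derivative cnj D) (at 0)" shows "dr v G x y = D"
  unfolding dr_def DERIV_imp_deriv[OF assms] by (rule complex_cnj_cnj)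

lemma dl_vector_derivative:
  assumes "bihol V W G" "y \<in> W" "x + of_real s *s v \<in> V"
  shows "((\<lambda>t. G (x + of_real t *s v) y) has_vector_derivative dl v G (x + of_real s *s v) y) (at s)"
  by (rule has_vector_derivative_real_field[OF has_field_derivative_dl[OF assms]])

lemma dr_vector_derivative:
  assumes "bihol V W G" "x \<in> V" "y + of_real s *s v \<in> W"
  shows "((\<lambda>t. G x (y + of_real t *s v)) has_vector_derivative dr v G x (y + of_real s *s v)) (at s)"
proof -
  have "((\<lambda>t. cnj (G x (y + of_real t *s v))) has_vector_derivative cnj (dr v G x (y + of_real s *s v))) (at s)"
    by (rule has_vector_derivative_real_field[OF has_field_derivative_dr[OF assms]])
  then have "((\<lambda>t. cnj (cnj (G x (y + of_real t *s v)))) has_vector_derivative cnj (cnj (dr v G x (y + of_real s *s v)))) (at s)"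
    by (rule has_vector_derivative_cnj)
  then show ?thesis unfolding complex_cnj_cnj .
qed

lemma real_line_in_open:
  fixes x v w :: "complex ^ 'n"
  assumes "open V" "x \<in> V"
  obtains e where "e > 0" "\<forall>t\<in>ball 0 e. \<forall>s\<in>ball 0 e. x + complex_of_real t *s v + complex_of_real s *s w \<in> V"
proof -
  have "open ((\<lambda>p. x + complex_of_real (fst p) *s v + complex_of_real (snd p) *s w) -` V)"
    by (rule open_vimage[OF assms(1)]) (intro continuous_intros)
  moreover have "(0, 0) \<in> (\<lambda>p. x + complex_of_real (fst p) *s v + complex_of_real (snd p) *s w) -` V"
    using assms(2) by simp
  ultimately obtain A B where AB': "open A" "open B" "(0, 0) \<in> A \<times> B"
    "A \<times> B \<subseteq> (\<lambda>p. x + complex_of_real (fst p) *s v + complex_of_real (snd p) *s w) -` V"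
    by (rule open_prod_elim)
  then have AB: "open A" "open B" "0 \<in> A" "0 \<in> B" by auto
  obtain a where a: "a > 0" "ball 0 a \<subseteq> A" using AB openE by blast
  obtain b where b: "b > 0" "ball 0 b \<subseteq> B" using AB openE by blast
  have "\<forall>t\<in>ball 0 (min a b). \<forall>s\<in>ball 0 (min a b). x + complex_of_real t *s v + complex_of_real s *s w \<in> V"
    using a b AB'(4) by (fastforce simp: subset_iff)
  with a b show thesis by (intro that[of "min a b"]) auto
qed

text \<open>The parameter is real, since the dependence on a complex t would be holomorphic through
  the first argument and antiholomorphic through the second.\<close>

lemma diagonal_vector_derivative:
  assumes G: "bihol V W G" and o: "open V" "open W" and x: "x \<in> V" and y: "y \<in> W"
  shows "((\<lambda>t::real. G (x + of_real t *s v) (y + of_real t *s w)) has_vector_derivative dl v G x y + dr w G x y) (at 0)"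
proof -
  obtain a where a: "a > 0" "\<forall>t\<in>ball 0 a. \<forall>s\<in>ball 0 a. x + complex_of_real t *s v + complex_of_real s *s 0 \<in> V"
    by (rule real_line_in_open[OF o(1) x])
  obtain b where b: "b > 0" "\<forall>t\<in>ball 0 b. \<forall>s\<in>ball 0 b. y + complex_of_real t *s w + complex_of_real s *s 0 \<in> W"
    by (rule real_line_in_open[OF o(2) y])
  define e where "e = min a b"
  have e: "e > 0" using a b by (simp add: e_def)
  have V: "x + complex_of_real t *s v \<in> V" if "t \<in> ball 0 e" for t
    using a(1) a(2)[rule_format, of t 0] that by (simp add: e_def)
  have W: "y + complex_of_real t *s w \<in> W" if "t \<in> ball 0 e" for t
    using b(1) b(2)[rule_format, of t 0] that by (simp add: e_def)
  have "((\<lambda>t. G (x + of_real t *s v) (y + of_real t *s w)) has_vector_derivative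
      dl v G x y + dr w G (x + of_real 0 *s v) (y + of_real 0 *s w)) (at 0)"
  proof (rule has_vector_derivative_diagonal[where f = "\<lambda>t s. G (x + of_real t *s v) (y + of_real s *s w)"
        and ?f2.0 = "\<lambda>t s. dr w G (x + of_real t *s v) (y + of_real s *s w)", OF e])
    show "((\<lambda>t. G (x + of_real t *s v) (y + of_real 0 *s w)) has_vector_derivative dl v G x y) (at 0)"
      using dl_vector_derivative[OF G y, of x 0 v] x by simp
    show "((\<lambda>s. G (x + of_real t *s v) (y + of_real s *s w)) has_vector_derivative
        dr w G (x + of_real t *s v) (y + of_real s *s w)) (at s)" if "t \<in> ball 0 e" "s \<in> ball 0 e" for t s
      by (rule dr_vector_derivative[OF G V[OF that(1)] W[OF that(2)]])
    show "continuous_on (ball 0 e \<times> ball 0 e) (\<lambda>p. dr w G (x + of_real (fst p) *s v) (y + of_real (snd p) *s w))"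
    proof (rule continuous_on_dr_comp[OF G o])
      show "x + of_real (fst p) *s v \<in> V" if "p \<in> ball 0 e \<times> ball 0 e" for p
        using that by (intro V) auto
      show "y + of_real (snd p) *s w \<in> W" if "p \<in> ball 0 e \<times> ball 0 e" for p
        using that by (intro W) auto
    qed (intro continuous_intros)+
  qed
  then show ?thesis by simp
qed

text \<open>Additivity in the direction is not built into a derivative along lines. It comes from
  the continuity of \<open>dl\<close>: G at x + t v + s w is differentiated along the diagonal t =
  s.\<close>

lemma dl_add:
  assumes G: "bihol V W G" and o: "open V" "open W" and x: "x \<in> V" and y: "y \<in> W"
  shows "dl (v + w) G x y = dl v G x y + dl w G x y"
proof -
  obtain e where e: "e > 0" "\<forall>t\<in>ball 0 e. \<forall>s\<in>ball 0 e. x + complex_of_real t *s v + complex_of_real s *s w \<in> V"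
    by (rule real_line_in_open[OF o(1) x])
  have "((\<lambda>t. G (x + of_real t *s v + of_real t *s w) y) has_vector_derivative
      dl v G x y + dl w G (x + of_real 0 *s v + of_real 0 *s w) y) (at 0)"
  proof (rule has_vector_derivative_diagonal[where f = "\<lambda>t s. G (x + of_real t *s v + of_real s *s w) y"
        and ?f2.0 = "\<lambda>t s. dl w G (x + of_real t *s v + of_real s *s w) y", OF e(1)])
    show "((\<lambda>t. G (x + of_real t *s v + of_real 0 *s w) y) has_vector_derivative dl v G x y) (at 0)"
      using dl_vector_derivative[OF G y, of x 0 v] x by simp
    show "((\<lambda>s. G (x + of_real t *s v + of_real s *s w) y) has_vector_derivative
        dl w G (x + of_real t *s v + of_real s *s w) y) (at s)" if "t \<in> ball 0 e" "s \<in> ball 0 e" for t s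
      using e(2) that by (intro dl_vector_derivative[OF G y]) blast
    show "continuous_on (ball 0 e \<times> ball 0 e) (\<lambda>p. dl w G (x + of_real (fst p) *s v + of_real (snd p) *s w) y)"
      by (rule continuous_on_dl_comp[OF G o]) (use e(2) y in \<open>auto intro!: continuous_intros\<close>)
  qed
  then have "((\<lambda>t. G (x + of_real t *s (v + w)) y) has_vector_derivative dl v G x y + dl w G x y) (at 0)"
    by (simp add: vector_add_ldistrib add.assoc)
  moreover have "((\<lambda>t. G (x + of_real t *s (v + w)) y) has_vector_derivative dl (v + w) G x y) (at 0)"
    using dl_vector_derivative[OF G y, of x 0 "v + w"] x by simp
  ultimately show ?thesis by (metis vector_derivative_at)
qed

lemma dl_scale:
  assumes G: "bihol V W G" and x: "x \<in> V" and y: "y \<in> W"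
  shows "dl (c *s v) G x y = c * dl v G x y"
proof (rule dl_eqI)
  have "((\<lambda>t. G (x + t *s v) y) has_field_derivative dl v G x y) (at (0 * c))"
    using dl_deriv[OF G x y] by simp
  moreover have "((\<lambda>t. t * c) has_field_derivative c) (at 0)" by (auto intro!: derivative_eq_intros)
  ultimately have "((\<lambda>t. G (x + (t * c) *s v) y) has_field_derivative dl v G x y * c) (at 0)"
    by (rule DERIV_chain2)
  then show "((\<lambda>t. G (x + t *s (c *s v)) y) has_field_derivative c * dl v G x y) (at 0)"
    by (simp add: mult.commute)
qed

lemma dr_scale:
  assumes G: "bihol V W G" and x: "x \<in> V" and y: "y \<in> W"
  shows "dr (c *s v) G x y = cnj c * dr v G x y"
  by (simp add: dr_eq_adj adj_def[of "dl _ _"] dl_scale[OF bihol_adj[OF G] y x])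

lemma dl_sum:
  assumes G: "bihol V W G" and o: "open V" "open W" and x: "x \<in> V" and y: "y \<in> W"
    and S: "finite S"
  shows "dl (\<Sum>j\<in>S. c j *s e j) G x y = (\<Sum>j\<in>S. c j * dl (e j) G x y)"
  using S
proof induction
  case empty
  have "dl (0 *s 0) G x y = 0 * dl 0 G x y" by (rule dl_scale[OF G x y])
  then show ?case by simp
next
  case (insert j S)
  then show ?case by (simp add: dl_add[OF G o x y] dl_scale[OF G x y])
qed

lemma dr_sum:
  assumes G: "bihol V W G" and o: "open V" "open W" and x: "x \<in> V" and y: "y \<in> W"
    and S: "finite S"
  shows "dr (\<Sum>j\<in>S. c j *s e j) G x y = (\<Sum>j\<in>S. cnj (c j) * dr (e j) G x y)"
  by (simp add: dr_eq_adj adj_def[of "dl _ _"] dl_sum[OF bihol_adj[OF G] o(2,1) y x S])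

text \<open>Differentiating G x x = 0 in direction v gives \<open>dl\<close> + \<open>dr\<close> =
  0; in direction \<i> v, by linearity of \<open>dl\<close> and conjugate-linearity of
  \<open>dr\<close>, it gives \<open>dl\<close> - \<open>dr\<close> = 0.\<close>

lemma dl_zero_on_diagonal:
  assumes G: "bihol V V G" and o: "open V" and z: "\<And>x. x \<in> V \<Longrightarrow> G x x = 0" and x: "x \<in> V"
  shows "dl v G x x = 0"
proof -
  have *: "dl u G x x + dr u G x x = 0" for u
  proof -
    obtain e where e: "e > 0" "\<forall>t\<in>ball 0 e. \<forall>s\<in>ball 0 e. x + complex_of_real t *s u + complex_of_real s *s 0 \<in> V"
      by (rule real_line_in_open[OF o x])
    have "G (x + of_real t *s u) (x + of_real t *s u) = 0" if "t \<in> ball 0 e" for t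
      using e(1) e(2)[rule_format, of t 0] that by (intro z) simp
    then have "((\<lambda>t::real. 0 :: complex) has_vector_derivative dl u G x x + dr u G x x) (at 0)"
      using e(1) by (intro has_vector_derivative_transform_within_open[OF diagonal_vector_derivative[OF G o o x x], of "ball 0 e"]) auto
    moreover have "((\<lambda>t::real. 0 :: complex) has_vector_derivative 0) (at 0)" by (rule has_vector_derivative_const)
    ultimately show ?thesis by (metis vector_derivative_at)
  qed
  have "\<i> * dl v G x x - \<i> * dr v G x x = 0"
    using *[of "\<i> *s v"] by (simp add: dl_scale[OF G x x] dr_scale[OF G x x])
  then have "dl v G x x = dr v G x x" by (simp add: right_diff_distrib[symmetric])
  with *[of v] show ?thesis by simp
qed

lemma higher_deriv_eq_dl:
  assumes G: "bihol V W G" and o: "open V" "open W" and y: "y \<in> W" and t: "x + t *s v \<in> V"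
  shows "(deriv ^^ n) (\<lambda>t. G (x + t *s v) y) t = (dl v ^^ n) G (x + t *s v) y"
  using t
proof (induction n arbitrary: t)
  case (Suc n)
  have b: "bihol V W ((dl v ^^ n) G)"
    by (induction n) (use G in \<open>auto intro: bihol_dl o\<close>)
  have "((\<lambda>t. (dl v ^^ n) G (x + t *s v) y) has_field_derivative dl v ((dl v ^^ n) G) (x + t *s v) y) (at t)"
    by (rule has_field_derivative_dl[OF b y Suc.prems])
  then have "((deriv ^^ n) (\<lambda>t. G (x + t *s v) y) has_field_derivative dl v ((dl v ^^ n) G) (x + t *s v) y) (at t)"
    by (rule has_field_derivative_transform_within_open[OF _ open_line_preimage[OF o(1), of x v]])
       (simp_all add: Suc)
  then show ?case by (simp add: DERIV_imp_deriv)
qed simp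

text \<open>Vanishing on the diagonal is inherited by all iterates of \<open>dl v\<close>. With v =
  x - y, the one-variable function G (y + t v) y thus has zero Taylor series at t = 0 and vanishes
  at t = 1.\<close>

lemma polarization:
  assumes G: "bihol (ball c e) (ball c e) G" and z: "\<And>x. x \<in> ball c e \<Longrightarrow> G x x = 0"
    and x: "x \<in> ball c e" and y: "y \<in> ball c e"
  shows "G x y = 0"
proof -
  define v where "v = x - y"
  define T where "T = {t. y + t *s v \<in> ball c e}"
  have D: "bihol (ball c e) (ball c e) ((dl v ^^ n) G) \<and> (\<forall>x\<in>ball c e. (dl v ^^ n) G x x = 0)" for n
  proof (induction n)
    case (Suc n)
    then have b: "bihol (ball c e) (ball c e) ((dl v ^^ n) G)" and zz: "\<And>x. x \<in> ball c e \<Longrightarrow> (dl v ^^ n) G x x = 0"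
      by auto
    show ?case
      using bihol_dl[OF b open_ball open_ball, of v] dl_zero_on_diagonal[OF b open_ball zz, of _ v] by simp
  qed (use G z in auto)
  define f where "f t = G (y + t *s v) y" for t
  have "f 1 = 0"
  proof (rule holomorphic_fun_eq_0_on_connected[of f T 0 1])
    show "f holomorphic_on T"
      unfolding f_def using line_hol_holomorphic_on[OF bihol_line_hol(1)[OF G y], of T y v]
      by (simp add: T_def)
    show "connected T"
      unfolding T_def by (intro convex_connected convex_line_preimage convex_ball)
    show T0: "0 \<in> T" using y by (simp add: T_def)
    show "1 \<in> T" using x by (simp add: T_def v_def)
    show "(deriv ^^ n) f 0 = 0" for n
      using higher_deriv_eq_dl[OF G open_ball open_ball y, of y 0 v n] D[of n] y by (simp add: f_def[abs_def])
    show "open T" unfolding T_def by (intro open_line_preimage open_ball)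
  qed
  then show ?thesis by (simp add: f_def v_def)
qed

section \<open>Hartogs' lemma\<close>

text \<open>Discrete Fourier inversion on a rotated set of N-th roots of unity. Orthogonality is the
  vanishing of a geometric sum, and a degree below N excludes aliasing.\<close>

lemma coeff_roots_of_unity:
  fixes Q :: "complex poly"
  assumes deg: "degree Q < N" and z: "cmod z = 1" and m: "m < N"
  shows "(\<Sum>j<N. poly Q (z * cis (2 * pi * real j / real N)) * cnj (z * cis (2 * pi * real j / real N)) ^ m)
           = of_nat N * coeff Q m"
proof -
  define \<omega> where "\<omega> l = cis (2 * pi * real l / real N)" for l :: nat
  have N: "N > 0" using m by simp
  have \<omega>N: "\<omega> l ^ N = 1" for l
    using N cis_multiple_2pi[of "real l"] by (simp add: \<omega>_def Complex.DeMoivre)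
  have sw: "\<omega> j ^ l = \<omega> l ^ j" for j l
    by (simp add: \<omega>_def Complex.DeMoivre mult_ac)
  have inv: "\<omega> j * cnj (\<omega> j) = 1" for j
    by (simp add: \<omega>_def cis_cnj cis_mult)
  have zinv: "z * cnj z = 1"
    using z by (simp add: complex_norm_square[symmetric])
  have orth: "(\<Sum>j<N. \<omega> j ^ l * cnj (\<omega> j) ^ m) = (if l = m then of_nat N else 0)" if l: "l < N" for l
  proof -
    define q where "q = \<omega> l * cnj (\<omega> m)"
    have eq: "\<omega> j ^ l * cnj (\<omega> j) ^ m = q ^ j" for j
      unfolding q_def power_mult_distrib sw[of j] complex_cnj_power[symmetric] by simp
    have qN: "q ^ N = 1"
      unfolding q_def power_mult_distrib by (simp add: \<omega>N flip: complex_cnj_power)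
    show ?thesis
    proof (cases "l = m")
      case True
      then have "q = 1" by (simp add: q_def inv)
      then show ?thesis using True unfolding eq by simp
    next
      case False
      have "q \<noteq> 1"
      proof
        assume "q = 1"
        then have "\<omega> l = \<omega> m"
          using inv[of m] by (metis mult.assoc mult.commute mult.right_neutral q_def)
        moreover have "inj_on \<omega> {..<N}"
          using Complex.bij_betw_roots_unity[OF N] unfolding \<omega>_def bij_betw_def by simp
        ultimately show False using False l m by (auto dest: inj_onD)
      qed
      with qN False show ?thesis by (simp add: eq geometric_sum)
    qed
  qed
  have "(\<Sum>j<N. poly Q (z * \<omega> j) * cnj (z * \<omega> j) ^ m)
      = (\<Sum>j<N. \<Sum>l\<le>degree Q. coeff Q l * z ^ l * cnj z ^ m * (\<omega> j ^ l * cnj (\<omega> j) ^ m))"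
    by (intro sum.cong refl) (simp add: poly_altdef sum_distrib_left sum_distrib_right power_mult_distrib mult_ac)
  also have "\<dots> = (\<Sum>l\<le>degree Q. coeff Q l * z ^ l * cnj z ^ m * (\<Sum>j<N. \<omega> j ^ l * cnj (\<omega> j) ^ m))"
    by (subst sum.swap) (simp add: sum_distrib_left)
  also have "\<dots> = (\<Sum>l\<le>degree Q. if l = m then of_nat N * coeff Q m * (z ^ m * cnj z ^ m) else 0)"
    using deg by (intro sum.cong refl) (auto simp: orth)
  also have "\<dots> = of_nat N * coeff Q m"
    by (auto simp: zinv coeff_eq_0 simp flip: power_mult_distrib)
  finally show ?thesis by (simp add: \<omega>_def)
qed

text \<open>By Fourier inversion every coefficient is at most B in modulus, and the geometric series
  with ratio 1/2 contributes the factor 2.\<close>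

lemma poly_bound_roots_of_unity:
  fixes Q :: "complex poly"
  assumes deg: "degree Q < N" and z: "cmod z = 1"
    and B: "\<And>j. j < N \<Longrightarrow> cmod (poly Q (z * cis (2 * pi * real j / real N))) \<le> B"
    and w: "cmod w \<le> 1/2"
  shows "cmod (poly Q w) \<le> 2 * B"
proof -
  have N: "N > 0" using deg by simp
  have B0: "B \<ge> 0" using B[OF N] norm_ge_zero order_trans by blast
  have co: "cmod (coeff Q m) \<le> B" if m: "m < N" for m
  proof -
    have "real N * cmod (coeff Q m) = cmod (of_nat N * coeff Q m)" by (simp add: norm_mult)
    also have "\<dots> \<le> (\<Sum>j<N. cmod (poly Q (z * cis (2 * pi * real j / real N)) * cnj (z * cis (2 * pi * real j / real N)) ^ m))"
      unfolding coeff_roots_of_unity[OF deg z m, symmetric] by (rule norm_sum)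
    also have "\<dots> \<le> (\<Sum>j<N. B)"
      using B z by (intro sum_mono) (simp add: norm_mult norm_power)
    finally show ?thesis using N by simp
  qed
  have "cmod (poly Q w) \<le> (\<Sum>m\<le>degree Q. cmod (coeff Q m * w ^ m))"
    unfolding poly_altdef by (rule norm_sum)
  also have "\<dots> \<le> (\<Sum>m\<le>degree Q. B * (1/2) ^ m)"
    unfolding norm_mult norm_power using w deg B0
    by (intro sum_mono mult_mono co power_mono) auto
  also have "\<dots> = B * (\<Sum>m<Suc (degree Q). (1/2) ^ m)"
    by (simp add: sum_distrib_left lessThan_Suc_atMost)
  also have "\<dots> \<le> B * 2"
  proof (rule mult_left_mono[OF _ B0])
    have "(\<Sum>m<Suc (degree Q). (1/2::real) ^ m) = 2 - 2 * (1/2) ^ Suc (degree Q)"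
      by (subst sum_gp_strict) (simp add: field_simps)
    then show "(\<Sum>m<Suc (degree Q). (1/2::real) ^ m) \<le> 2"
      using zero_le_power[of "1/2::real" "Suc (degree Q)"] by linarith
  qed
  finally show ?thesis by simp
qed

text \<open>Otherwise the number of bad points would exceed \<eta> N for every shift in [0, 1/N).
  Its integral over these shifts is at most the measure of B, because the half-open intervals
  \<open>I j\<close> are disjoint; this contradicts \<open>m\<close>.\<close>

lemma exists_few_bad_translates:
  fixes B :: "real set"
  assumes B: "B \<in> sets borel" "B \<subseteq> {0..1}" and N: "N > 0" and m: "measure lborel B < \<eta>"
  shows "\<exists>\<theta>. 0 \<le> \<theta> \<and> \<theta> < 1 / real N \<and> real (card {j. j < N \<and> \<theta> + real j / real N \<in> B}) \<le> \<eta> * real N"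
proof (rule ccontr)
  assume "\<not> ?thesis"
  then have big: "\<eta> * real N < real (card {j. j < N \<and> \<theta> + real j / real N \<in> B})"
      if "0 \<le> \<theta>" "\<theta> < 1 / real N" for \<theta>
    using that by (auto simp: not_le)
  define I where "I j = {real j / real N..<real (Suc j) / real N}" for j
  define A where "A j = {\<theta> \<in> {0..<1/real N}. \<theta> + real j / real N \<in> B}" for j
  have A': "A j = {0..<1/real N} \<inter> (\<lambda>t. t + real j / real N) -` B" for j
    by (auto simp: A_def)
  have AB: "A j \<in> sets borel" for j
    unfolding A' using measurable_sets[of "\<lambda>t. t + real j / real N" borel borel B] B(1) by auto
  have fin: "emeasure lborel (A j) < \<infinity>" for j
  proof -
    have "emeasure lborel (A j) \<le> emeasure lborel {0..1/real N}"
      using AB by (intro emeasure_mono) (auto simp: A_def)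
    also have "\<dots> < \<infinity>" by (simp add: emeasure_lborel_Icc_eq)
    finally show ?thesis .
  qed
  have meq: "measure lborel (A j) = measure lborel (B \<inter> I j)" for j
  proof -
    have "(+) (real j / real N) ` A j = B \<inter> I j"
    proof (intro equalityI subsetI)
      fix x assume x: "x \<in> B \<inter> I j"
      have "real j / real N \<le> x" "x < real j / real N + 1 / real N"
        using x by (auto simp: I_def add_divide_distrib)
      then have "x - real j / real N \<in> A j"
        using x by (auto simp: A_def)
      then show "x \<in> (+) (real j / real N) ` A j" by force
    qed (use N in \<open>auto simp: A_def I_def field_simps\<close>)
    moreover have "measure lebesgue ((+) (real j / real N) ` A j) = measure lebesgue (A j)"
      by (rule measure_translation)
    ultimately show ?thesis
      using AB B(1) by (simp add: I_def measure_completion)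
  qed
  have Bfin: "emeasure lborel (B \<inter> I j) < \<infinity>" for j
  proof -
    have "emeasure lborel (B \<inter> I j) \<le> emeasure lborel {0..1::real}"
      using B by (intro emeasure_mono) auto
    also have "\<dots> < \<infinity>" by simp
    finally show ?thesis .
  qed
  have disj: "disjoint_family_on (\<lambda>j. B \<inter> I j) {..<N}"
  proof (unfold disjoint_family_on_def, intro ballI impI)
    fix i j :: nat assume "i \<noteq> j"
    then consider "Suc i \<le> j" | "Suc j \<le> i" by linarith
    then show "(B \<inter> I i) \<inter> (B \<inter> I j) = {}"
    proof cases
      case 1
      then have "real (Suc i) / real N \<le> real j / real N" by (intro divide_right_mono) auto
      then show ?thesis by (auto simp: I_def)
    next
      case 2
      then have "real (Suc j) / real N \<le> real i / real N" by (intro divide_right_mono) auto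
      then show ?thesis by (auto simp: I_def)
    qed
  qed
  have intA: "integrable lborel (indicator (A j) :: real \<Rightarrow> real)" for j
    using AB fin by (simp add: integrable_indicator_iff)
  have "\<eta> = (\<integral>\<theta>. \<eta> * real N * indicator {0..<1/real N} \<theta> \<partial>lborel)"
    using N by simp
  also have "\<dots> \<le> (\<integral>\<theta>. (\<Sum>j<N. indicator (A j) \<theta>) \<partial>lborel)"
  proof (rule integral_mono)
    show "integrable lborel (\<lambda>\<theta>. \<eta> * real N * indicator {0..<1/real N} \<theta>)"
      using N by (intro integrable_mult_right) (simp add: integrable_indicator_iff)
    show "integrable lborel (\<lambda>\<theta>. (\<Sum>j<N. indicator (A j) \<theta>) :: real)"
      using intA by (intro Bochner_Integration.integrable_sum)
    fix \<theta> :: real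
    show "\<eta> * real N * indicator {0..<1/real N} \<theta> \<le> (\<Sum>j<N. indicator (A j) \<theta>)"
    proof (cases "\<theta> \<in> {0..<1/real N}")
      case True
      have "(\<Sum>j<N. indicator (A j) \<theta> :: real) = real (card {j. j < N \<and> \<theta> \<in> A j})"
        by (simp add: indicator_def sum.If_cases) (rule arg_cong[where f = card], auto)
      also have "{j. j < N \<and> \<theta> \<in> A j} = {j. j < N \<and> \<theta> + real j / real N \<in> B}"
        using True by (auto simp: A_def)
      finally show ?thesis using big[of \<theta>] True by simp
    qed (simp add: sum_nonneg)
  qed
  also have "\<dots> = (\<Sum>j<N. measure lborel (A j))"
    using intA by (subst Bochner_Integration.integral_sum) auto
  also have "\<dots> = measure lborel (\<Union>j<N. B \<inter> I j)"
    unfolding meq using B(1) Bfin disj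
    by (subst measure_finite_Union) (auto simp: I_def less_top)
  also have "\<dots> \<le> measure lborel B"
  proof (rule measure_mono_fmeasurable)
    have "emeasure lborel B \<le> emeasure lborel {0..1::real}"
      using B by (intro emeasure_mono) auto
    then show "B \<in> fmeasurable lborel" using B(1) by (intro fmeasurableI) (auto intro: le_less_trans)
  qed (use B(1) in \<open>auto simp: I_def\<close>)
  finally show False using m by simp
qed

text \<open>The index from which x stays outside B k may depend on x; dominated convergence, with
  the indicator of [0,1] as majorant, still makes the measures small.\<close>

lemma measure_tendsto_0_of_finitely_often:
  fixes B :: "nat \<Rightarrow> real set"
  assumes B: "\<And>k. B k \<in> sets borel" "\<And>k. B k \<subseteq> {0..1}" and f: "\<And>x. eventually (\<lambda>k. x \<notin> B k) sequentially"
  shows "(\<lambda>k. measure lborel (B k)) \<longlonglongrightarrow> 0"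
proof -
  have "(\<lambda>k. \<integral>x. indicator (B k) x \<partial>lborel) \<longlonglongrightarrow> integral\<^sup>L lborel (\<lambda>x::real. 0::real)"
  proof (rule integral_dominated_convergence[where w = "indicator {0..1::real}"])
    show "integrable lborel (indicator {0..1} :: real \<Rightarrow> real)"
      by (simp add: integrable_indicator_iff)
    show "AE x in lborel. (\<lambda>k. indicator (B k) x) \<longlonglongrightarrow> (0::real)"
    proof (rule AE_I2)
      fix x :: real
      show "(\<lambda>k. indicator (B k) x) \<longlonglongrightarrow> (0::real)"
        using f[of x] by (intro tendsto_eventually) (auto elim!: eventually_mono)
    qed
    show "AE x in lborel. norm (indicator (B k) x :: real) \<le> indicator {0..1} x" for k
      using B(2)[of k] by (intro AE_I2) (auto simp: indicator_def)
  qed (use B in auto)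
  then show ?thesis using B(1) by simp
qed

text \<open>The index \<open>\<alpha>\<close> costs nothing and allows the lemma to be iterated over the coordinates of several variables.\<close>

lemma hartogs_family:
  fixes g :: "nat \<Rightarrow> 'a \<Rightarrow> complex \<Rightarrow> complex"
  assumes hol: "\<And>k \<alpha>. \<alpha> \<in> S \<Longrightarrow> g k \<alpha> holomorphic_on ball 0 3"
    and bound: "\<And>k \<alpha> w. \<alpha> \<in> S \<Longrightarrow> cmod w \<le> 2 \<Longrightarrow> cmod (g k \<alpha> w) \<le> A * M ^ k"
    and pt: "\<And>w. cmod w = 1 \<Longrightarrow> \<exists>C. \<forall>k. \<forall>\<alpha>\<in>S. cmod (g k \<alpha> w) \<le> C"
    and e: "e > 0"
  shows "\<exists>C. \<forall>k. \<forall>\<alpha>\<in>S. \<forall>w. cmod w \<le> 1/2 \<longrightarrow> cmod (g k \<alpha> w) \<le> C * (1 + e) ^ k"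
proof -
  define A' where "A' = \<bar>A\<bar>"
  define M' where "M' = max \<bar>M\<bar> 1"
  have A'0: "A' \<ge> 0" and M'1: "M' \<ge> 1" by (auto simp: A'_def M'_def)
  have bound': "cmod (g k \<alpha> w) \<le> A' * M' ^ k" if "\<alpha> \<in> S" "cmod w \<le> 2" for k \<alpha> w
  proof -
    have "A * M ^ k \<le> A' * \<bar>M\<bar> ^ k"
      unfolding A'_def using abs_ge_self[of "A * M ^ k"] by (simp add: abs_mult power_abs)
    also have "\<dots> \<le> A' * M' ^ k"
      by (intro mult_left_mono power_mono) (auto simp: A'_def M'_def)
    finally show ?thesis using bound[OF that, of k] by simp
  qed
  \<comment> \<open>Cauchy's inequality on the circle of radius 2 bounds the m-th Taylor coefficient
    by A' M'^k / 2^m. Cutting the series beyond degree b k therefore leaves a tail on the unit disc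
    that is bounded independently of k.\<close>
  obtain b :: nat where b: "M' \<le> 2 ^ b"
  proof -
    obtain n where "M' < 2 ^ n" using real_arch_pow[of 2 M'] by auto
    then show thesis using that[of n] by simp
  qed
  obtain \<eta> where \<eta>: "\<eta> > 0" "\<eta> < 1/2" "4 powr (2 * \<eta> * (real b + 1)) \<le> 1 + e / 2"
  proof -
    define \<eta> where "\<eta> = min (1/4) (log 4 (1 + e/2) / (2 * (real b + 1)))"
    have "log 4 (1 + e/2) > 0" using e by simp
    then have "\<eta> > 0" by (auto simp: \<eta>_def intro!: divide_pos_pos)
    moreover have "\<eta> < 1/2" by (simp add: \<eta>_def min_def)
    moreover have "2 * \<eta> * (real b + 1) \<le> log 4 (1 + e/2)"
    proof -
      have "\<eta> \<le> log 4 (1 + e/2) / (2 * (real b + 1))" by (simp add: \<eta>_def)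
      then show ?thesis by (subst (asm) pos_le_divide_eq) (auto simp: mult_ac)
    qed
    then have "4 powr (2 * \<eta> * (real b + 1)) \<le> 4 powr (log 4 (1 + e/2))"
      by (intro powr_mono) auto
    moreover have "4 powr (log 4 (1 + e/2)) = 1 + e/2" using e by (intro powr_log_cancel) auto
    ultimately show thesis by (intro that[of \<eta>]) linarith+
  qed
  \<comment> \<open>The threshold k tends to infinity, so every \<theta> lies in only finitely many
    B k, while it grows slowly enough to be absorbed by the gap between 1 + e/2 and 1 + e. As a
    union of open sets cut by an interval, B k is measurable for an index set S of any size.\<close>
  define B where "B k = {0..1} \<inter> (\<Union>\<alpha>\<in>S. {\<theta>::real. real k < cmod (g k \<alpha> (cis (2 * pi * \<theta>)))})" for k
  have B1: "B k \<in> sets borel" for k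
  proof -
    have "open {\<theta>::real. real k < cmod (g k \<alpha> (cis (2 * pi * \<theta>)))}" if "\<alpha> \<in> S" for \<alpha>
    proof (rule open_Collect_less)
      have "continuous_on (ball 0 3) (g k \<alpha>)"
        using hol[OF that] holomorphic_on_imp_continuous_on by blast
      then have "continuous_on UNIV (\<lambda>\<theta>::real. g k \<alpha> (cis (2 * pi * \<theta>)))"
        by (rule continuous_on_compose2) (auto intro!: continuous_intros)
      then show "continuous_on UNIV (\<lambda>\<theta>::real. cmod (g k \<alpha> (cis (2 * pi * \<theta>))))"
        by (intro continuous_intros)
    qed auto
    then have "open (\<Union>\<alpha>\<in>S. {\<theta>::real. real k < cmod (g k \<alpha> (cis (2 * pi * \<theta>)))})" by blast
    then show ?thesis unfolding B_def by (intro sets.Int) auto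
  qed
  have "(\<lambda>k. measure lborel (B k)) \<longlonglongrightarrow> 0"
  proof (rule measure_tendsto_0_of_finitely_often)
    fix \<theta> :: real
    obtain C where C: "\<And>k \<alpha>. \<alpha> \<in> S \<Longrightarrow> cmod (g k \<alpha> (cis (2 * pi * \<theta>))) \<le> C"
      using pt[of "cis (2 * pi * \<theta>)"] by auto
    have "eventually (\<lambda>k. C < real k) sequentially"
      using eventually_gt_at_top[of "nat \<lceil>C\<rceil>"] by eventually_elim linarith
    then show "eventually (\<lambda>k. \<theta> \<notin> B k) sequentially"
    proof eventually_elim
      case (elim k)
      have "cmod (g k \<alpha> (cis (2 * pi * \<theta>))) \<le> real k" if "\<alpha> \<in> S" for \<alpha>
        using C[OF that, of k] elim by linarith
      then show ?case by (force simp: B_def)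
    qed
  qed (use B1 in \<open>auto simp: B_def\<close>)
  then have "eventually (\<lambda>k. measure lborel (B k) < \<eta>) sequentially"
    using \<eta>(1) by (rule order_tendstoD)
  then obtain k0 where k0: "\<And>k. k \<ge> k0 \<Longrightarrow> measure lborel (B k) < \<eta>"
    by (auto simp: eventually_sequentially)
  have main: "cmod (g k \<alpha> w) \<le> 2 * A' + 2 * (real k + 2 * A') * (1 + e/2) ^ (k + 1)"
    if k: "k \<ge> k0" and \<alpha>: "\<alpha> \<in> S" and w: "cmod w \<le> 1/2" for k \<alpha> w
  proof -
    define d where "d = Suc (b * k)"
    \<comment> \<open>Room for two factors: the Taylor polynomial has degree below d, and the
      product over the bad nodes has degree at most d.\<close>
    define N where "N = 2 * d"
    define a where "a m = (deriv ^^ m) (g k \<alpha>) 0 / fact m" for m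
    define P where "P = Abs_poly (\<lambda>m. if m < d then a m else 0)"
    have coeffP: "coeff P m = (if m < d then a m else 0)" for m
      unfolding P_def by (subst coeff_Abs_poly[where n = d]) auto
    have degP: "degree P < d"
    proof -
      have "degree P \<le> d - 1" by (rule degree_le) (auto simp: coeffP)
      then show ?thesis by (simp add: d_def)
    qed
    have polyP: "poly P z = (\<Sum>m<d. a m * z ^ m)" for z
    proof -
      have "poly P z = (\<Sum>m\<le>degree P. coeff P m * z ^ m)" by (rule poly_altdef)
      also have "\<dots> = (\<Sum>m<d. coeff P m * z ^ m)"
        using degP by (intro sum.mono_neutral_left) (auto simp: coeff_eq_0)
      finally show ?thesis by (simp add: coeffP)
    qed
    have hk: "g k \<alpha> holomorphic_on ball 0 3" using hol \<alpha> by blast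
    have a_le: "cmod (a m) \<le> A' * M' ^ k / 2 ^ m" for m
    proof -
      have "cmod ((deriv ^^ m) (g k \<alpha>) 0) \<le> fact m * (A' * M' ^ k) / 2 ^ m"
      proof (rule Cauchy_inequality)
        show "g k \<alpha> holomorphic_on ball 0 2"
          using hk by (rule holomorphic_on_subset) auto
        show "continuous_on (cball 0 2) (g k \<alpha>)"
          by (rule continuous_on_subset[OF holomorphic_on_imp_continuous_on[OF hk]]) auto
      qed (use bound' \<alpha> in auto)
      then show ?thesis by (simp add: a_def norm_divide field_simps)
    qed
    have tail: "cmod (g k \<alpha> z - poly P z) \<le> 2 * A'" if z: "cmod z \<le> 1" for z
    proof -
      have "(\<lambda>n. a n * (z - 0) ^ n) sums g k \<alpha> z"
        unfolding a_def by (rule holomorphic_power_series[OF hk]) (use z in auto)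
      then have "(\<lambda>n. a (n + d) * z ^ (n + d)) sums (g k \<alpha> z - (\<Sum>m<d. a m * z ^ m))"
        by (subst sums_iff_shift) simp
      then have s: "(\<lambda>n. a (n + d) * z ^ (n + d)) sums (g k \<alpha> z - poly P z)"
        by (simp add: polyP)
      have t: "cmod (a (n + d) * z ^ (n + d)) \<le> A' * (1/2) ^ n" for n
      proof -
        have "cmod (a (n + d) * z ^ (n + d)) \<le> A' * M' ^ k / 2 ^ (n + d) * 1"
          unfolding norm_mult norm_power using z A'0 M'1
          by (intro mult_mono a_le power_le_one) auto
        also have "M' ^ k \<le> 2 ^ d"
        proof -
          have "M' ^ k \<le> (2 ^ b) ^ k" using b M'1 by (intro power_mono) auto
          also have "\<dots> = 2 ^ (b * k)" by (simp add: power_mult)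
          also have "\<dots> \<le> 2 ^ d" by (simp add: d_def)
          finally show ?thesis .
        qed
        then have "A' * M' ^ k / 2 ^ (n + d) * 1 \<le> A' * 2 ^ d / 2 ^ (n + d) * 1"
          using A'0 by (intro mult_right_mono divide_right_mono mult_left_mono) auto
        also have "\<dots> = A' * (1/2) ^ n" by (simp add: power_add field_simps)
        finally show ?thesis .
      qed
      have gs: "(\<lambda>n. A' * (1/2) ^ n) sums (A' * (1 / (1 - 1/2)))"
        by (intro sums_mult geometric_sums) auto
      have "cmod (\<Sum>n. a (n + d) * z ^ (n + d)) \<le> (\<Sum>n. A' * (1/2) ^ n)"
        using t sums_summable[OF gs] by (rule norm_suminf_le)
      then show ?thesis using s gs by (simp add: sums_iff mult.commute)
    qed
    have N0: "N > 0" by (simp add: N_def d_def)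
    obtain \<theta> where \<theta>0: "0 \<le> \<theta>" "\<theta> < 1 / real N" and \<theta>: "real (card {j. j < N \<and> \<theta> + real j / real N \<in> B k}) \<le> \<eta> * real N"
      using exists_few_bad_translates[OF B1 _ N0 k0[OF k]] by (auto simp: B_def)
    define \<zeta> where "\<zeta> j = cis (2 * pi * \<theta>) * cis (2 * pi * real j / real N)" for j :: nat
    have \<zeta>_eq: "\<zeta> j = cis (2 * pi * (\<theta> + real j / real N))" for j
      by (simp add: \<zeta>_def cis_mult algebra_simps)
    define J where "J = {j. j < N \<and> \<theta> + real j / real N \<in> B k}"
    have finJ: "finite J" by (simp add: J_def)
    have cJ: "real (card J) \<le> \<eta> * real N" using \<theta> by (simp add: J_def)
    have "\<eta> * real N \<le> 1/2 * real N" using \<eta>(2) by (intro mult_right_mono) auto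
    then have cJd: "card J \<le> d" using cJ by (simp add: N_def)
    \<comment> \<open>On the unit circle R is at most 2^card J in modulus, and for |w| \<le> 1/2 it
      is at least 2^-card J. Multiplying by R and dividing it out again costs 4^card J.\<close>
    define R where "R = (\<Prod>j\<in>J. [:- \<zeta> j, 1:])"
    have degR: "degree R \<le> card J"
      using degree_prod_sum_le[OF finJ, of "\<lambda>j. [:- \<zeta> j, 1:]"] by (simp add: R_def o_def)
    have polyR: "poly R z = (\<Prod>j\<in>J. z - \<zeta> j)" for z
      by (simp add: R_def poly_prod)
    have n\<zeta>: "cmod (\<zeta> j) = 1" for j by (simp add: \<zeta>_eq)
    have good: "cmod (g k \<alpha> (\<zeta> j)) \<le> real k" if "j < N" "j \<notin> J" for j
    proof -
      have "real j / real N + 1 / real N \<le> 1"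
        using that(1) N0 by (simp add: add_divide_distrib[symmetric])
      then have "\<theta> + real j / real N \<in> {0..1}"
        using \<theta>0 by simp
      then show ?thesis
        using that \<alpha> unfolding J_def B_def \<zeta>_eq by (auto simp: not_less)
    qed
    have "cmod (poly (P * R) w) \<le> 2 * ((real k + 2 * A') * 2 ^ card J)"
    proof (rule poly_bound_roots_of_unity[of _ N "cis (2 * pi * \<theta>)"])
      show "degree (P * R) < N"
        using degree_mult_le[of P R] degP degR cJd by (simp add: N_def)
      fix j assume j: "j < N"
      show "cmod (poly (P * R) (cis (2 * pi * \<theta>) * cis (2 * pi * real j / real N))) \<le> (real k + 2 * A') * 2 ^ card J"
        unfolding \<zeta>_def[symmetric]
      proof (cases "j \<in> J")
        case True
        then have "poly R (\<zeta> j) = 0" using finJ by (auto simp: polyR)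
        then show "cmod (poly (P * R) (\<zeta> j)) \<le> (real k + 2 * A') * 2 ^ card J"
          using A'0 by simp
      next
        case False
        have "cmod (poly P (\<zeta> j)) \<le> real k + 2 * A'"
          using good[OF j False] tail[of "\<zeta> j"] norm_triangle_ineq4[of "g k \<alpha> (\<zeta> j)" "g k \<alpha> (\<zeta> j) - poly P (\<zeta> j)"]
          by (simp add: n\<zeta>)
        moreover have "cmod (poly R (\<zeta> j)) \<le> 2 ^ card J"
        proof -
          have "cmod (poly R (\<zeta> j)) \<le> (\<Prod>i\<in>J. 2)"
            unfolding polyR prod_norm[symmetric]
            by (intro prod_mono) (auto intro: order_trans[OF norm_triangle_ineq4] simp: n\<zeta>)
          then show ?thesis by simp
        qed
        ultimately show "cmod (poly (P * R) (\<zeta> j)) \<le> (real k + 2 * A') * 2 ^ card J"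
          using A'0 by (simp add: norm_mult mult_mono)
      qed
    qed (use w in auto)
    moreover have "(1/2) ^ card J \<le> cmod (poly R w)"
    proof -
      have "(\<Prod>i\<in>J. 1/2) \<le> cmod (poly R w)"
        unfolding polyR prod_norm[symmetric]
      proof (intro prod_mono conjI)
        fix i
        show "1/2 \<le> cmod (w - \<zeta> i)"
          using w norm_triangle_ineq2[of "\<zeta> i" w] by (simp add: n\<zeta> norm_minus_commute)
      qed auto
      then show ?thesis by simp
    qed
    then have "cmod (poly P w) * (1/2) ^ card J \<le> cmod (poly (P * R) w)"
      by (simp add: norm_mult mult_left_mono)
    ultimately have "cmod (poly P w) * (1/2) ^ card J \<le> 2 * ((real k + 2 * A') * 2 ^ card J)"
      by (rule order_trans[rotated])
    then have "cmod (poly P w) \<le> 2 * (real k + 2 * A') * (2 ^ card J * 2 ^ card J)"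
      by (simp add: power_one_over field_simps)
    also have "(2::real) ^ card J * 2 ^ card J = 4 ^ card J"
      by (simp add: power_mult_distrib[symmetric])
    also have "(4::real) ^ card J = 4 powr real (card J)" by (simp add: powr_realpow)
    also have "\<dots> \<le> 4 powr (2 * \<eta> * (real b + 1) * real (k + 1))"
    proof (rule powr_mono)
      have "real d \<le> (real b + 1) * real (k + 1)" by (simp add: d_def algebra_simps)
      then have "\<eta> * 2 * real d \<le> \<eta> * 2 * ((real b + 1) * real (k + 1))"
        using \<eta>(1) by (intro mult_left_mono) auto
      then show "real (card J) \<le> 2 * \<eta> * (real b + 1) * real (k + 1)"
        using cJ by (simp add: N_def mult_ac)
    qed auto
    also have "\<dots> = (4 powr (2 * \<eta> * (real b + 1))) ^ (k + 1)"
      by (subst powr_realpow[symmetric]) (auto simp: powr_powr)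
    also have "\<dots> \<le> (1 + e/2) ^ (k + 1)"
      by (intro power_mono \<eta>(3)) auto
    finally have "cmod (poly P w) \<le> 2 * (real k + 2 * A') * (1 + e/2) ^ (k + 1)"
      using A'0 by (simp add: mult_left_mono)
    then show ?thesis
      using tail[of w] w norm_triangle_ineq[of "g k \<alpha> w - poly P w" "poly P w"] by simp
  qed
  \<comment> \<open>Since q < 1, the sequence k q^k is bounded, which absorbs the linear factor in
    \<open>main\<close>; the finitely many k below k0 are covered by the crude bound A'
    M'^k0.\<close>
  define q where "q = (1 + e/2) / (1 + e)"
  have q: "0 < q" "q < 1" using e by (auto simp: q_def field_simps)
  have "(\<lambda>n. real n * q ^ n) \<longlonglongrightarrow> 0"
    using q by (intro powser_times_n_limit_0) auto
  then obtain D where D: "\<And>n. \<bar>real n * q ^ n\<bar> \<le> D"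
    using convergent_imp_Bseq[of "\<lambda>n. real n * q ^ n"] by (auto simp: Bseq_def convergent_def)
  define C where "C = (2 * A' + 4 * A' * (1 + e/2)) + 2 * (1 + e/2) * D + A' * M' ^ k0"
  have D0: "D \<ge> 0" using D[of 0] by simp
  have "cmod (g k \<alpha> w) \<le> C * (1 + e) ^ k" if \<alpha>: "\<alpha> \<in> S" and w: "cmod w \<le> 1/2" for k \<alpha> w
  proof (cases "k \<ge> k0")
    case True
    have 1: "(1 + e/2) ^ k = q ^ k * (1 + e) ^ k"
      using e by (simp add: q_def power_divide)
    have "2 * A' * 1 \<le> 2 * A' * (1 + e/2) ^ k"
      using A'0 e by (intro mult_left_mono one_le_power) auto
    then have "cmod (g k \<alpha> w) \<le> 2 * A' * (1 + e/2) ^ k + 2 * (real k + 2 * A') * (1 + e/2) ^ (k + 1)"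
      using main[OF True \<alpha> w] by simp
    also have "\<dots> = ((2 * A' + 4 * A' * (1 + e/2)) * q ^ k + 2 * (1 + e/2) * (real k * q ^ k)) * (1 + e) ^ k"
      by (simp add: 1 algebra_simps)
    also have "\<dots> \<le> ((2 * A' + 4 * A' * (1 + e/2)) * 1 + 2 * (1 + e/2) * D) * (1 + e) ^ k"
      using A'0 e q D[of k] by (intro mult_right_mono add_mono mult_left_mono power_le_one) auto
    also have "\<dots> \<le> C * (1 + e) ^ k"
      using e A'0 M'1 by (intro mult_right_mono) (auto simp: C_def)
    finally show ?thesis .
  next
    case False
    have "cmod (g k \<alpha> w) \<le> A' * M' ^ k" using bound'[OF \<alpha>] w by simp
    also have "\<dots> \<le> A' * M' ^ k0"
      using A'0 M'1 False by (intro mult_left_mono power_increasing) auto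
    also have "\<dots> \<le> C" using A'0 e D0 by (simp add: C_def)
    also have "C * 1 \<le> C * (1 + e) ^ k"
      using e A'0 D0 M'1 by (intro mult_left_mono one_le_power) (auto simp: C_def)
    finally show ?thesis by simp
  qed
  then show ?thesis by blast
qed

section \<open>Separate analyticity\<close>

text \<open>On the complex line through x0 and x, Cauchy's inequality on discs of radius \<rho>/4
  bounds the derivative at parameters of modulus below \<rho>/2 by 4 C / \<rho>.\<close>

lemma line_hol_lipschitz_center:
  assumes f: "line_hol f (ball x0 \<rho>)" and C: "\<And>x. x \<in> ball x0 \<rho> \<Longrightarrow> cmod (f x) \<le> C"
    and x: "x \<in> ball x0 (\<rho> / 2)" and \<rho>: "\<rho> > 0"
  shows "cmod (f x - f x0) \<le> 4 * C / \<rho> * norm (x - x0)"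
proof (cases "x = x0")
  case False
  define u where "u = complex_of_real (1 / norm (x - x0)) *s (x - x0)"
  have nu: "norm u = 1" unfolding u_def norm_smult_vec norm_of_real using False by simp
  have inb: "x0 + t *s u \<in> ball x0 \<rho>" if "cmod t < \<rho>" for t
    using that nu by (simp add: dist_norm norm_smult_vec)
  define h where "h t = f (x0 + t *s u)" for t
  have h: "h holomorphic_on ball 0 \<rho>"
    unfolding h_def by (rule line_hol_holomorphic_on[OF f inb]) simp
  have d: "cmod (deriv h t) \<le> 4 * C / \<rho>" if t: "t \<in> ball 0 (\<rho>/2)" for t
  proof -
    have sub: "cball t (\<rho>/4) \<subseteq> ball 0 \<rho>"
    proof
      fix s assume "s \<in> cball t (\<rho>/4)"
      then have "cmod (s - t) \<le> \<rho>/4" by (simp add: dist_norm norm_minus_commute)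
      then have "cmod s < \<rho>" using t \<rho> norm_triangle_ineq[of "s - t" t] by simp
      then show "s \<in> ball 0 \<rho>" by simp
    qed
    have "cmod ((deriv ^^ 1) h t) \<le> fact 1 * C / (\<rho>/4) ^ 1"
    proof (rule Cauchy_inequality)
      show "h holomorphic_on ball t (\<rho>/4)"
        using sub by (intro holomorphic_on_subset[OF h]) auto
      show "continuous_on (cball t (\<rho>/4)) h"
        by (rule continuous_on_subset[OF holomorphic_on_imp_continuous_on[OF h] sub])
      fix s assume "cmod (t - s) = \<rho>/4"
      then have "s \<in> ball 0 \<rho>" using sub by (auto simp: dist_norm)
      then show "cmod (h s) \<le> C" unfolding h_def by (intro C inb) simp
    qed (use \<rho> in auto)
    then show ?thesis using \<rho> by (simp add: field_simps)
  qed
  have "cmod (h (norm (x - x0)) - h 0) \<le> 4 * C / \<rho> * cmod (complex_of_real (norm (x - x0)) - 0)"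
  proof (rule field_differentiable_bound[where S = "ball 0 (\<rho>/2)" and f' = "deriv h"])
    fix t :: complex assume t: "t \<in> ball 0 (\<rho>/2)"
    then have "t \<in> ball 0 \<rho>" using \<rho> by simp
    then show "(h has_field_derivative deriv h t) (at t within ball 0 (\<rho>/2))"
      by (rule holomorphic_derivI[OF h open_ball])
    show "cmod (deriv h t) \<le> 4 * C / \<rho>" by (rule d[OF t])
  qed (use x \<rho> in \<open>auto simp: dist_norm norm_minus_commute\<close>)
  moreover have "complex_of_real (norm (x - x0)) *s u = x - x0"
    using False by (simp add: u_def vector_smult_assoc)
  ultimately show ?thesis by (simp add: h_def)
qed simp

text \<open>A local bound yields Lipschitz estimates in each variable with the same constant; joint
  continuity follows by passing from (x', y') to (x, y) through (x, y').\<close>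

lemma bihol_if_locally_bounded:
  assumes l: "\<And>y. y \<in> W \<Longrightarrow> line_hol (\<lambda>x. G x y) V" "\<And>x. x \<in> V \<Longrightarrow> line_hol (\<lambda>y. cnj (G x y)) W"
    and b: "\<And>x y. x \<in> V \<Longrightarrow> y \<in> W \<Longrightarrow>
      \<exists>\<rho>>0. \<exists>C. ball x \<rho> \<subseteq> V \<and> ball y \<rho> \<subseteq> W \<and> (\<forall>x'\<in>ball x \<rho>. \<forall>y'\<in>ball y \<rho>. cmod (G x' y') \<le> C)"
  shows "bihol V W G"
  unfolding bihol_def
proof (intro conjI ballI l)
  show "continuous_on (V \<times> W) (\<lambda>p. G (fst p) (snd p))"
    unfolding continuous_on_iff
  proof (intro ballI allI impI)
    fix p e assume p: "p \<in> V \<times> W" and e: "(e::real) > 0"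
    obtain x y where xy: "p = (x, y)" "x \<in> V" "y \<in> W" using p by auto
    obtain \<rho> C where \<rho>: "\<rho> > 0" "ball x \<rho> \<subseteq> V" "ball y \<rho> \<subseteq> W" and
      C: "\<And>x' y'. x' \<in> ball x \<rho> \<Longrightarrow> y' \<in> ball y \<rho> \<Longrightarrow> cmod (G x' y') \<le> C"
      using b[OF xy(2,3)] by blast
    have "cmod (G x y) \<le> C" using \<rho>(1) by (intro C) auto
    then have C0: "C \<ge> 0" by (rule order_trans[OF norm_ge_zero])
    \<comment> \<open>The added 1 keeps M positive when C = 0.\<close>
    define M where "M = 4 * C / \<rho> + 1"
    have M: "M > 0" "4 * C / \<rho> \<le> M" using C0 \<rho>(1) by (auto simp: M_def intro!: add_nonneg_pos divide_nonneg_pos)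
    define d where "d = min (\<rho>/2) (e / (2 * M))"
    have d: "d > 0" "d \<le> \<rho>/2" "M * d \<le> e/2"
    proof -
      show "d > 0" using \<rho>(1) e M by (simp add: d_def)
      show "d \<le> \<rho>/2" by (simp add: d_def)
      have "M * d \<le> M * (e / (2 * M))" using M(1) by (intro mult_left_mono) (auto simp: d_def)
      then show "M * d \<le> e/2" using M(1) by simp
    qed
    show "\<exists>d>0. \<forall>q\<in>V \<times> W. dist q p < d \<longrightarrow> dist (G (fst q) (snd q)) (G (fst p) (snd p)) < e"
    proof (intro exI[of _ d] conjI d(1) ballI impI)
      fix q assume q: "q \<in> V \<times> W" "dist q p < d"
      obtain x' y' where q': "q = (x', y')" by (cases q)
      have dx: "dist x' x < d" using q(2) dist_fst_le[of q p] by (simp add: q' xy)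
      have dy: "dist y' y < d" using q(2) dist_snd_le[of q p] by (simp add: q' xy)
      have x': "x' \<in> ball x (\<rho>/2)" using dx d(2) by (simp add: dist_commute)
      have y': "y' \<in> ball y (\<rho>/2)" using dy d(2) by (simp add: dist_commute)
      have "y' \<in> ball y \<rho>" using y' \<rho>(1) by simp
      then have "cmod (G x' y' - G x y') \<le> 4 * C / \<rho> * norm (x' - x)"
        using C by (intro line_hol_lipschitz_center[OF line_hol_subset[OF l(1) \<rho>(2)] _ x' \<rho>(1)]) (use \<rho>(3) in auto)
      also have "\<dots> \<le> M * norm (x' - x)" using M by (intro mult_right_mono) auto
      also have "\<dots> < M * d" using dx M by (intro mult_strict_left_mono) (auto simp: dist_norm)
      finally have 1: "cmod (G x' y' - G x y') < e/2" using d(3) by simp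
      have "cmod (cnj (G x y') - cnj (G x y)) \<le> 4 * C / \<rho> * norm (y' - y)"
        using C \<rho>(1) by (intro line_hol_lipschitz_center[OF line_hol_subset[OF l(2)[OF xy(2)] \<rho>(3)] _ y' \<rho>(1)]) auto
      also have "\<dots> \<le> M * norm (y' - y)" using M by (intro mult_right_mono) auto
      also have "\<dots> < M * d" using dy M by (intro mult_strict_left_mono) (auto simp: dist_norm)
      finally have 2: "cmod (G x y' - G x y) < e/2"
        using d(3) by (simp flip: complex_cnj_diff)
      have "cmod ((G x' y' - G x y') + (G x y' - G x y)) < e"
        by (rule norm_triangle_lt) (use 1 2 in simp)
      then show "dist (G (fst q) (snd q)) (G (fst p) (snd p)) < e" by (simp add: q' xy dist_norm)
    qed
  qed
qed

text \<open>The closed sets E n, on which the bound n holds for all x in A, cover the ball, so they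
  cannot all have dense complements. The argument gives no control over where y1 lies.\<close>

lemma bounded_on_open_subset_baire:
  fixes G :: "'a \<Rightarrow> 'b::euclidean_space \<Rightarrow> complex"
  assumes R: "R > 0" and c: "\<And>x. x \<in> A \<Longrightarrow> continuous_on (cball y0 R) (G x)"
    and b: "\<And>y. y \<in> cball y0 R \<Longrightarrow> \<exists>C. \<forall>x\<in>A. cmod (G x y) \<le> C"
  obtains y1 \<delta> C where "y1 \<in> ball y0 R" "\<delta> > 0" "ball y1 \<delta> \<subseteq> ball y0 R" "\<forall>x\<in>A. \<forall>y\<in>ball y1 \<delta>. cmod (G x y) \<le> C"
proof -
  define E where "E n = {y \<in> cball y0 R. \<forall>x\<in>A. cmod (G x y) \<le> real n}" for n :: nat
  have E: "closedin (top_of_set (cball y0 R)) (E n)" for n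
  proof -
    have "closedin (top_of_set (cball y0 R)) (cball y0 R \<inter> (\<Inter>x\<in>A. cball y0 R \<inter> G x -` cball 0 (real n)))"
    proof (cases "A = {}")
      case False
      then show ?thesis
        by (intro closedin_Int closedin_INT continuous_closedin_preimage c) auto
    qed simp
    moreover have "cball y0 R \<inter> (\<Inter>x\<in>A. cball y0 R \<inter> G x -` cball 0 (real n)) = E n"
      by (auto simp: E_def)
    ultimately show ?thesis by simp
  qed
  have "\<exists>n. \<not> cball y0 R \<subseteq> closure (cball y0 R - E n)"
  proof (rule ccontr)
    assume no: "\<not> ?thesis"
    have d: "cball y0 R \<subseteq> closure (\<Inter>(range (\<lambda>n. cball y0 R - E n)))"
    proof (rule Baire)
      fix T assume "T \<in> range (\<lambda>n. cball y0 R - E n)"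
      then obtain n where T: "T = cball y0 R - E n" by auto
      show "openin (top_of_set (cball y0 R)) T \<and> cball y0 R \<subseteq> closure T"
        unfolding T using no E[of n] by (auto simp: openin_diff)
    qed auto
    have e: "\<Inter>(range (\<lambda>n. cball y0 R - E n)) = {}"
    proof -
      have "\<exists>n. y \<in> E n" if y: "y \<in> cball y0 R" for y
      proof -
        obtain C where C: "\<forall>x\<in>A. cmod (G x y) \<le> C" using b[OF y] by blast
        obtain n :: nat where "C \<le> real n" using real_arch_simple by blast
        with C y show ?thesis unfolding E_def by (intro exI[of _ n]) (auto intro: order_trans)
      qed
      then show ?thesis by blast
    qed
    show False using d[unfolded e closure_empty] R by auto
  qed
  then obtain n y where y: "y \<in> cball y0 R" "y \<notin> closure (cball y0 R - E n)" by blast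
  define U where "U = - closure (cball y0 R - E n)"
  have U: "open U" "y \<in> U" "U \<inter> cball y0 R \<subseteq> E n"
    using y closure_subset[of "cball y0 R - E n"] by (auto simp: U_def)
  \<comment> \<open>The point y may lie on the bounding sphere, where E n contains only a relative
    neighbourhood of it; it is replaced by a nearby point of the open ball.\<close>
  have "y \<in> closure (ball y0 R)" using y(1) R by simp
  then obtain y1 where y1: "y1 \<in> U \<inter> ball y0 R"
    using U(1,2) unfolding closure_iff_nhds_not_empty by blast
  obtain \<delta> where \<delta>: "\<delta> > 0" "ball y1 \<delta> \<subseteq> U \<inter> ball y0 R"
    using y1 U(1) openE[of "U \<inter> ball y0 R"] by blast
  have "ball y1 \<delta> \<subseteq> E n" using \<delta>(2) U(3) ball_subset_cball by blast
  with y1 \<delta> show thesis by (intro that[of y1 \<delta> "real n"]) (auto simp: E_def)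
qed

section \<open>Hartogs' lemma in several variables and the local bound\<close>

lemma norm_vec_le_card:
  fixes x :: "complex ^ 'n"
  assumes "\<And>i. cmod (x $ i) \<le> r"
  shows "norm x \<le> real CARD('n) * r"
proof -
  have "norm x \<le> (\<Sum>i\<in>UNIV. cmod (x $ i))"
    unfolding norm_vec_def by (rule L2_set_le_sum) simp
  also have "\<dots> \<le> (\<Sum>i\<in>(UNIV :: 'n set). r)" by (intro sum_mono assms)
  finally show ?thesis by simp
qed

text \<open>The bound is made uniform in one coordinate of x after another. In each step
  \<open>hartogs_family\<close> is applied to the new coordinate, with the coordinates already
  treated and the direction v as its index; the induction hypothesis at each fixed value of the new
  coordinate supplies the pointwise bounds.\<close>

lemma hartogs_coordinatewise:
  fixes c :: "nat \<Rightarrow> 'a \<Rightarrow> complex ^ 'm \<Rightarrow> complex" and S :: "'a set"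
  assumes R: "R > 0"
    and hol: "\<And>k v. v \<in> S \<Longrightarrow> line_hol (c k v) (ball x0 R)"
    and bound: "\<And>k v x. v \<in> S \<Longrightarrow> x \<in> ball x0 R \<Longrightarrow> cmod (c k v x) \<le> A * M ^ k"
    and pt: "\<And>x \<rho>. x \<in> ball x0 R \<Longrightarrow> 0 < \<rho> \<Longrightarrow> \<rho> < \<rho>0 \<Longrightarrow> \<exists>C. \<forall>k. \<forall>v\<in>S. cmod (c k v x) * \<rho> ^ k \<le> C"
  shows "\<exists>r>0. r \<le> R \<and> (\<forall>\<rho>. 0 < \<rho> \<and> \<rho> < \<rho>0 \<longrightarrow> (\<exists>C. \<forall>x\<in>ball x0 r. \<forall>k. \<forall>v\<in>S. cmod (c k v x) * \<rho> ^ k \<le> C))"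
proof -
  \<comment> \<open>Small enough for the closed polydisc of radius r1 around x0 to lie in the
    ball.\<close>
  define r1 where "r1 = R / (2 * real CARD('m))"
  have r1: "r1 > 0" using R by (simp add: r1_def)
  have PD: "x \<in> ball x0 R" if "\<And>i. cmod (x $ i - x0 $ i) \<le> r1" for x
  proof -
    have "norm (x - x0) \<le> real CARD('m) * r1" by (rule norm_vec_le_card) (use that in simp)
    also have "\<dots> < R" using R by (simp add: r1_def)
    finally show ?thesis by (simp add: dist_norm norm_minus_commute)
  qed
  \<comment> \<open>J holds the coordinates in which the bound is uniform; the others are frozen at
    those of x. The radius r is chosen before \<rho> and x because the induction step uses the
    hypothesis at a larger \<rho> and at points x with changed j-th coordinate.\<close>
  define P where "P J \<longleftrightarrow> (\<exists>r>0. r \<le> r1 \<and> (\<forall>\<rho> x. 0 < \<rho> \<longrightarrow> \<rho> < \<rho>0 \<longrightarrow> (\<forall>i. cmod (x $ i - x0 $ i) \<le> r1) \<longrightarrow>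
     (\<exists>C. \<forall>x'. (\<forall>i. if i \<in> J then cmod (x' $ i - x0 $ i) \<le> r else x' $ i = x $ i) \<longrightarrow>
        (\<forall>k. \<forall>v\<in>S. cmod (c k v x') * \<rho> ^ k \<le> C))))" for J :: "'m set"
  have "P J" for J
  proof (induction J rule: finite_induct[OF finite])
    case 1
    show ?case unfolding P_def
    proof (rule exI[of _ r1], intro conjI r1 order_refl allI impI)
      fix \<rho> x assume \<rho>: "0 < \<rho>" "\<rho> < \<rho>0" and x: "\<forall>i. cmod (x $ i - x0 $ i) \<le> r1"
      have "x \<in> ball x0 R" using x by (intro PD) blast
      from pt[OF this \<rho>] obtain C where C: "\<forall>k. \<forall>v\<in>S. cmod (c k v x) * \<rho> ^ k \<le> C" by blast
      have "x' = x" if "\<forall>i. if i \<in> {} then cmod (x' $ i - x0 $ i) \<le> r1 else x' $ i = x $ i" for x'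
        using that by (simp add: vec_eq_iff)
      with C show "\<exists>C. \<forall>x'. (\<forall>i. if i \<in> {} then cmod (x' $ i - x0 $ i) \<le> r1 else x' $ i = x $ i) \<longrightarrow>
          (\<forall>k. \<forall>v\<in>S. cmod (c k v x') * \<rho> ^ k \<le> C)" by blast
    qed
  next
    case (2 j J)
    from 2(3) obtain r where r: "r > 0" "r \<le> r1" and
      IH: "\<And>\<rho> x. 0 < \<rho> \<Longrightarrow> \<rho> < \<rho>0 \<Longrightarrow> (\<forall>i. cmod (x $ i - x0 $ i) \<le> r1) \<Longrightarrow>
       (\<exists>C. \<forall>x'. (\<forall>i. if i \<in> J then cmod (x' $ i - x0 $ i) \<le> r else x' $ i = x $ i) \<longrightarrow>
        (\<forall>k. \<forall>v\<in>S. cmod (c k v x') * \<rho> ^ k \<le> C))"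
      unfolding P_def by blast
    \<comment> \<open>Scaling by s turns the disc of radius 3 in \<open>hartogs_family\<close> into
      the disc of radius r, and the resulting bound for |w| \<le> 1/2 into one of radius r /
      6.\<close>
    define s where "s = r / 3"
    have s: "s > 0" using r by (simp add: s_def)
    have j: "j \<notin> J" by (rule 2(2))
    show ?case unfolding P_def
    proof (rule exI[of _ "r / 6"], intro conjI allI impI)
      fix \<rho> x assume \<rho>: "0 < \<rho>" "\<rho> < \<rho>0" and x: "\<forall>i. cmod (x $ i - x0 $ i) \<le> r1"
      \<comment> \<open>The loss (1 + e)^k with 1 + e = \<rho>2 / \<rho> is exactly what passing
        from \<rho>2 back to \<rho> pays for.\<close>
      define \<rho>2 where "\<rho>2 = (\<rho> + \<rho>0) / 2"
      have \<rho>2: "0 < \<rho>2" "\<rho> < \<rho>2" "\<rho>2 < \<rho>0" using \<rho> by (auto simp: \<rho>2_def)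
      define upd where "upd z a = (\<chi> i. if i = j then a else z $ i)" for z :: "complex ^ 'm" and a
      define Z where "Z = {(z, v). v \<in> S \<and> (\<forall>i. if i \<in> J then cmod (z $ i - x0 $ i) \<le> r else z $ i = x $ i)}"
      define g where "g k = (\<lambda>(z, v) w. of_real (\<rho>2 ^ k) * c k v (upd z (x0 $ j + of_real s * w)))" for k
      have upd_in: "upd z (x0 $ j + of_real s * w) \<in> ball x0 R" if z: "(z, v) \<in> Z" and w: "cmod w < 3" for z v w
      proof (rule PD)
        fix i
        show "cmod (upd z (x0 $ j + of_real s * w) $ i - x0 $ i) \<le> r1"
        proof (cases "i = j")
          case True
          have "s * cmod w \<le> s * 3" using w s by (intro mult_left_mono) auto
          also have "s * 3 = r" by (simp add: s_def)
          finally have "s * cmod w \<le> r1" using r(2) by simp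
          then show ?thesis using True s by (simp add: upd_def norm_mult)
        next
          case False
          have "(if i \<in> J then cmod (z $ i - x0 $ i) \<le> r else z $ i = x $ i)" using z by (simp add: Z_def)
          then show ?thesis using False r x[rule_format, of i] by (auto simp: upd_def split: if_splits)
        qed
      qed
      have "\<exists>C. \<forall>k. \<forall>\<alpha>\<in>Z. \<forall>w. cmod w \<le> 1/2 \<longrightarrow> cmod (g k \<alpha> w) \<le> C * (1 + (\<rho>2 / \<rho> - 1)) ^ k"
      proof (rule hartogs_family[where S = Z and g = g and e = "\<rho>2 / \<rho> - 1" and A = A and M = "\<rho>2 * M"])
        fix k \<alpha> assume \<alpha>: "\<alpha> \<in> Z"
        obtain z v where zv: "\<alpha> = (z, v)" by (cases \<alpha>)
        have v: "v \<in> S" using \<alpha> by (simp add: zv Z_def)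
        have line: "upd z (x0 $ j + of_real s * w) = upd z (x0 $ j) + w *s axis j (of_real s)" for w
          by (simp add: upd_def vec_eq_iff axis_def mult.commute)
        have "(\<lambda>w. c k v (upd z (x0 $ j) + w *s axis j (of_real s))) holomorphic_on ball 0 3"
          by (rule line_hol_holomorphic_on[OF hol[OF v]])
             (use upd_in[of z v] \<alpha> in \<open>auto simp: zv simp flip: line\<close>)
        then show "g k \<alpha> holomorphic_on ball 0 3"
          unfolding g_def zv prod.case line by (intro holomorphic_intros)
        show "cmod (g k \<alpha> w) \<le> A * (\<rho>2 * M) ^ k" if "cmod w \<le> 2" for w
        proof -
          have "cmod (c k v (upd z (x0 $ j + of_real s * w))) \<le> A * M ^ k"
            using \<alpha> that by (intro bound[OF v] upd_in[of z v]) (auto simp: zv)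
          then have "\<rho>2 ^ k * cmod (c k v (upd z (x0 $ j + of_real s * w))) \<le> \<rho>2 ^ k * (A * M ^ k)"
            using \<rho>2 by (intro mult_left_mono) auto
          then show ?thesis using \<rho>2 by (simp add: g_def zv norm_mult norm_power power_mult_distrib mult_ac)
        qed
      next
        fix w :: complex assume w: "cmod w = 1"
        have "\<forall>i. cmod (upd x (x0 $ j + of_real s * w) $ i - x0 $ i) \<le> r1"
        proof
          fix i
          show "cmod (upd x (x0 $ j + of_real s * w) $ i - x0 $ i) \<le> r1"
            using x[rule_format, of i] w s r by (simp add: upd_def norm_mult s_def)
        qed
        from IH[OF \<rho>2(1,3) this] obtain C where
          C: "\<And>x'. (\<forall>i. if i \<in> J then cmod (x' $ i - x0 $ i) \<le> r else x' $ i = upd x (x0 $ j + of_real s * w) $ i) \<Longrightarrow>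
            (\<forall>k. \<forall>v\<in>S. cmod (c k v x') * \<rho>2 ^ k \<le> C)" by blast
        have "cmod (g k \<alpha> w) \<le> C" if \<alpha>: "\<alpha> \<in> Z" for k \<alpha>
        proof -
          obtain z v where zv: "\<alpha> = (z, v)" by (cases \<alpha>)
          have z: "v \<in> S" "\<And>i. if i \<in> J then cmod (z $ i - x0 $ i) \<le> r else z $ i = x $ i"
            using \<alpha> by (auto simp: zv Z_def)
          have "\<forall>i. if i \<in> J then cmod (upd z (x0 $ j + of_real s * w) $ i - x0 $ i) \<le> r
               else upd z (x0 $ j + of_real s * w) $ i = upd x (x0 $ j + of_real s * w) $ i"
          proof
            fix i
            show "if i \<in> J then cmod (upd z (x0 $ j + of_real s * w) $ i - x0 $ i) \<le> r
               else upd z (x0 $ j + of_real s * w) $ i = upd x (x0 $ j + of_real s * w) $ i"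
              using z(2)[of i] j by (auto simp: upd_def)
          qed
          from C[OF this] z(1) show ?thesis
            using \<rho>2 by (simp add: g_def zv norm_mult norm_power mult.commute)
        qed
        then show "\<exists>C. \<forall>k. \<forall>\<alpha>\<in>Z. cmod (g k \<alpha> w) \<le> C" by blast
      next
        show "0 < \<rho>2 / \<rho> - 1" using \<rho> \<rho>2 by simp
      qed
      then obtain C where C: "\<And>k \<alpha> w. \<alpha> \<in> Z \<Longrightarrow> cmod w \<le> 1/2 \<Longrightarrow> cmod (g k \<alpha> w) \<le> C * (1 + (\<rho>2 / \<rho> - 1)) ^ k"
        by blast
      show "\<exists>C. \<forall>x'. (\<forall>i. if i \<in> insert j J then cmod (x' $ i - x0 $ i) \<le> r / 6 else x' $ i = x $ i) \<longrightarrow>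
          (\<forall>k. \<forall>v\<in>S. cmod (c k v x') * \<rho> ^ k \<le> C)"
      proof (intro exI[of _ C] allI impI ballI)
        fix x' k v
        assume x': "\<forall>i. if i \<in> insert j J then cmod (x' $ i - x0 $ i) \<le> r / 6 else x' $ i = x $ i" and v: "v \<in> S"
        \<comment> \<open>The j-th coordinate of x' is moved into the one-variable argument w; in z
          it is reset to that of x, which puts (z, v) into Z.\<close>
        define z where "z = (\<chi> i. if i = j then x $ j else x' $ i)"
        define w where "w = (x' $ j - x0 $ j) / of_real s"
        have "if i \<in> J then cmod (z $ i - x0 $ i) \<le> r else z $ i = x $ i" for i
          using x'[rule_format, of i] j r by (auto simp: z_def split: if_splits)
        then have zv: "(z, v) \<in> Z" using v by (simp add: Z_def)
        have "cmod (x' $ j - x0 $ j) \<le> r / 6" using x'[rule_format, of j] by simp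
        then have "cmod (x' $ j - x0 $ j) / s \<le> (r / 6) / s" using s by (intro divide_right_mono) auto
        moreover have "(r / 6) / s = 1/2" using r(1) by (simp add: s_def)
        moreover have "cmod w = cmod (x' $ j - x0 $ j) / s" using s by (simp add: w_def norm_divide)
        ultimately have w: "cmod w \<le> 1/2" by linarith
        have "upd z (x0 $ j + of_real s * w) = x'"
          using s by (simp add: upd_def w_def z_def vec_eq_iff)
        then have "\<rho>2 ^ k * cmod (c k v x') \<le> C * (\<rho>2 / \<rho>) ^ k"
          using C[OF zv w, of k] \<rho>2 by (simp add: g_def norm_mult norm_power)
        then have "\<rho>2 ^ k * cmod (c k v x') * (\<rho> / \<rho>2) ^ k \<le> C * (\<rho>2 / \<rho>) ^ k * (\<rho> / \<rho>2) ^ k"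
          using \<rho> \<rho>2 by (intro mult_right_mono) auto
        then show "cmod (c k v x') * \<rho> ^ k \<le> C"
          using \<rho> \<rho>2 by (simp add: power_divide)
      qed
    qed (use r in auto)
  qed
  from this[of UNIV, unfolded P_def if_P[OF UNIV_I]] obtain r where r: "r > 0" "r \<le> r1" and
      H: "\<And>\<rho> x. 0 < \<rho> \<Longrightarrow> \<rho> < \<rho>0 \<Longrightarrow> (\<forall>i. cmod (x $ i - x0 $ i) \<le> r1) \<Longrightarrow>
       (\<exists>C. \<forall>x'. (\<forall>i. cmod (x' $ i - x0 $ i) \<le> r) \<longrightarrow> (\<forall>k. \<forall>v\<in>S. cmod (c k v x') * \<rho> ^ k \<le> C))"
    by blast
  show ?thesis
  proof (rule exI[of _ r], intro conjI allI impI r(1))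
    have "1 \<le> real CARD('m)" by (simp add: Suc_le_eq)
    then have "r1 * 1 \<le> r1 * (2 * real CARD('m))" using r1 by (intro mult_left_mono) linarith+
    then show "r \<le> R" using r(2) R by (simp add: r1_def)
    fix \<rho> assume "0 < \<rho> \<and> \<rho> < \<rho>0"
    with H[of \<rho> x0] r1 obtain C where
      C: "\<And>x'. (\<forall>i. cmod (x' $ i - x0 $ i) \<le> r) \<Longrightarrow> (\<forall>k. \<forall>v\<in>S. cmod (c k v x') * \<rho> ^ k \<le> C)" by auto
    have "\<forall>k. \<forall>v\<in>S. cmod (c k v x) * \<rho> ^ k \<le> C" if "x \<in> ball x0 r" for x
    proof (rule C, rule allI)
      fix i
      have "cmod ((x - x0) $ i) \<le> norm (x - x0)" by (rule Finite_Cartesian_Product.norm_nth_le)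
      then show "cmod (x $ i - x0 $ i) \<le> r" using that by (simp add: dist_norm norm_minus_commute)
    qed
    then show "\<exists>C. \<forall>x\<in>ball x0 r. \<forall>k. \<forall>v\<in>S. cmod (c k v x) * \<rho> ^ k \<le> C" by blast
  qed
qed

lemma holomorphic_fun_on_imp_continuous_on: "holomorphic_fun_on f X \<Longrightarrow> continuous_on X f"
  unfolding holomorphic_fun_on_def
  by (intro continuous_at_imp_continuous_on ballI) (blast intro: has_derivative_continuous)

lemma bihol_funpow_dl:
  assumes "bihol V W G" "open V" "open W" shows "bihol V W ((dl v ^^ n) G)"
  by (induction n) (use assms in \<open>auto intro: bihol_dl\<close>)

text \<open>The function is expanded in y around the point y1 given by Baire's theorem. The
  coefficients are holomorphic in x with a crude exponential bound, and for each single x they decay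
  as required for radius 2R. Hartogs' lemma makes this decay uniform in x, and discs of radius 5/4 R
  around y1 cover a neighbourhood of y0.\<close>

lemma hartogs_locally_bounded:
  fixes V :: "(complex ^ 'm) set" and W :: "(complex ^ 'n) set"
  assumes o: "open V" "open W"
    and h: "\<And>y. y \<in> W \<Longrightarrow> holomorphic_fun_on (\<lambda>x. G x y) V" "\<And>x. x \<in> V \<Longrightarrow> holomorphic_fun_on (\<lambda>y. cnj (G x y)) W"
    and xy: "x0 \<in> V" "y0 \<in> W"
  shows "\<exists>\<rho>>0. \<exists>C. ball x0 \<rho> \<subseteq> V \<and> ball y0 \<rho> \<subseteq> W \<and> (\<forall>x\<in>ball x0 \<rho>. \<forall>y\<in>ball y0 \<rho>. cmod (G x y) \<le> C)"
proof -
  have cG: "continuous_on W (\<lambda>y. G x y)" if "x \<in> V" for x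
    using continuous_on_cnj[OF holomorphic_fun_on_imp_continuous_on[OF h(2)[OF that]]] by simp
  obtain R1 where R1: "R1 > 0" "cball x0 R1 \<subseteq> V" using o(1) xy(1) open_contains_cball by blast
  obtain R' where R': "R' > 0" "cball y0 R' \<subseteq> W" using o(2) xy(2) open_contains_cball by blast
  \<comment> \<open>With y1 within R of y0, the ball of radius 2R around y1 stays inside the ball of
    radius 3R around y0, hence inside W.\<close>
  define R where "R = R' / 3"
  have R: "R > 0" "cball y0 (3 * R) \<subseteq> W" using R' by (auto simp: R_def)
  \<comment> \<open>For fixed y, continuity in x on a compact ball gives a bound; Baire's theorem
    makes it uniform for y near y1.\<close>
  obtain y1 \<delta> C1 where y1: "y1 \<in> ball y0 R" "\<delta> > 0" "ball y1 \<delta> \<subseteq> ball y0 R"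
      and C1: "\<forall>x\<in>cball x0 R1. \<forall>y\<in>ball y1 \<delta>. cmod (G x y) \<le> C1"
  proof (rule bounded_on_open_subset_baire[of R "cball x0 R1" y0 G])
    show "continuous_on (cball y0 R) (G x)" if "x \<in> cball x0 R1" for x
      by (rule continuous_on_subset[OF cG]) (use that R1 R in auto)
    show "\<exists>C. \<forall>x\<in>cball x0 R1. cmod (G x y) \<le> C" if y: "y \<in> cball y0 R" for y
    proof -
      have "continuous_on V (\<lambda>x. G x y)"
        by (rule holomorphic_fun_on_imp_continuous_on[OF h(1)]) (use y R in auto)
      then have "continuous_on (cball x0 R1) (\<lambda>x. G x y)" by (rule continuous_on_subset[OF _ R1(2)])
      then have "bounded ((\<lambda>x. G x y) ` cball x0 R1)"
        by (intro compact_imp_bounded compact_continuous_image compact_cball)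
      then show ?thesis by (auto simp: bounded_iff)
    qed
  qed (use R in auto)
  have subV: "ball x0 R1 \<subseteq> V" using R1(2) ball_subset_cball by blast
  have subW: "ball y1 \<delta> \<subseteq> W" using y1(3) R by force
  have G: "bihol (ball x0 R1) (ball y1 \<delta>) G"
  proof (rule bihol_if_locally_bounded)
    show "line_hol (\<lambda>x. G x y) (ball x0 R1)" if "y \<in> ball y1 \<delta>" for y
      by (rule line_hol_subset[OF holomorphic_fun_on_imp_line_hol[OF h(1)] subV]) (use that subW in blast)
    show "line_hol (\<lambda>y. cnj (G x y)) (ball y1 \<delta>)" if "x \<in> ball x0 R1" for x
      by (rule line_hol_subset[OF holomorphic_fun_on_imp_line_hol[OF h(2)] subW]) (use that subV in blast)
    fix x y assume x: "x \<in> ball x0 R1" and y: "y \<in> ball y1 \<delta>"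
    obtain a where a: "a > 0" "ball x a \<subseteq> ball x0 R1" using openE[OF open_ball x] .
    obtain b where b: "b > 0" "ball y b \<subseteq> ball y1 \<delta>" using openE[OF open_ball y] .
    have "ball x (min a b) \<subseteq> ball x0 R1" "ball y (min a b) \<subseteq> ball y1 \<delta>" using a b by auto
    moreover from this have "\<forall>x'\<in>ball x (min a b). \<forall>y'\<in>ball y (min a b). cmod (G x' y') \<le> C1"
      using C1 ball_subset_cball by blast
    ultimately show "\<exists>\<rho>>0. \<exists>C. ball x \<rho> \<subseteq> ball x0 R1 \<and> ball y \<rho> \<subseteq> ball y1 \<delta> \<and> (\<forall>x'\<in>ball x \<rho>. \<forall>y'\<in>ball y \<rho>. cmod (G x' y') \<le> C)"
      using a(1) b(1) by (intro exI[of _ "min a b"]) auto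
  qed
  define S where "S = {v :: complex ^ 'n. norm v \<le> 1}"
  define f where "f x v t = cnj (G x (y1 + t *s v))" for x v t
  \<comment> \<open>\<open>adj G\<close> is holomorphic in y and antiholomorphic in x, so the outer
    conjugation makes c holomorphic in x. The Taylor coefficients of f are the conjugates of
    c.\<close>
  define c where "c k v x = cnj ((dl v ^^ k) (adj G) y1 x) / fact k" for k v x
  have y1in: "y1 \<in> ball y1 \<delta>" using y1(2) by simp
  have inW: "y1 + t *s v \<in> cball y0 (3 * R)" if "v \<in> S" "cmod t \<le> 2 * R" for v t
  proof -
    have "cmod t * norm v \<le> 2 * R * 1" using that R by (intro mult_mono) (auto simp: S_def)
    moreover have "norm (y1 - y0) < R" using y1(1) by (simp add: dist_norm norm_minus_commute)
    ultimately have "norm ((y1 - y0) + t *s v) \<le> 3 * R"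
      using norm_triangle_ineq[of "y1 - y0" "t *s v"] by (simp add: norm_smult_vec)
    then show ?thesis by (simp add: dist_norm norm_minus_commute algebra_simps)
  qed
  have fhol: "f x v holomorphic_on cball 0 (2 * R)" if "x \<in> V" "v \<in> S" for x v
    unfolding f_def
    by (rule line_hol_holomorphic_on[OF holomorphic_fun_on_imp_line_hol[OF h(2)[OF that(1)]]])
       (use inW[OF that(2)] R(2) in auto)
  have fc: "(deriv ^^ k) (f x v) 0 / fact k = cnj (c k v x)" if "x \<in> ball x0 R1" for k x v
    using higher_deriv_eq_dl[OF bihol_adj[OF G] open_ball open_ball that, of y1 0 v k] y1in
    by (simp add: c_def f_def[abs_def] adj_def[of G])
  \<comment> \<open>Used twice: on a small circle, where the bound C1 is uniform in x and yields the
    crude exponential estimate, and on circles of any radius below 2R, where the bound depends on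
    x.\<close>
  have cauchy: "cmod (c k v x) \<le> B / r ^ k" if x: "x \<in> ball x0 R1" and v: "v \<in> S" and r: "0 < r" "r \<le> 2 * R"
    and B: "\<And>t. cmod t = r \<Longrightarrow> cmod (f x v t) \<le> B" for k v x r B
  proof -
    have fh: "f x v holomorphic_on cball 0 (2 * R)" using x subV by (intro fhol v) auto
    have "cmod ((deriv ^^ k) (f x v) 0) \<le> fact k * B / r ^ k"
    proof (rule Cauchy_inequality)
      show "f x v holomorphic_on ball 0 r" by (rule holomorphic_on_subset[OF fh]) (use r in auto)
      show "continuous_on (cball 0 r) (f x v)"
        by (rule continuous_on_subset[OF holomorphic_on_imp_continuous_on[OF fh]]) (use r in auto)
    qed (use r B in auto)
    then have "cmod ((deriv ^^ k) (f x v) 0 / fact k) \<le> B / r ^ k"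
      by (simp add: norm_divide field_simps)
    then show ?thesis unfolding fc[OF x] by simp
  qed
  have "\<exists>r>0. r \<le> R1 \<and> (\<forall>\<rho>. 0 < \<rho> \<and> \<rho> < 2 * R \<longrightarrow> (\<exists>C. \<forall>x\<in>ball x0 r. \<forall>k. \<forall>v\<in>S. cmod (c k v x) * \<rho> ^ k \<le> C))"
  proof (rule hartogs_coordinatewise[OF R1(1)])
    fix k v assume v: "v \<in> S"
    have "line_hol (\<lambda>x. cnj ((dl v ^^ k) (adj G) y1 x)) (ball x0 R1)"
      by (rule bihol_line_hol(2)[OF bihol_funpow_dl[OF bihol_adj[OF G] open_ball open_ball] y1in])
    then show "line_hol (c k v) (ball x0 R1)"
      unfolding line_hol_def c_def by (auto intro!: field_differentiable_divide)
    fix x assume x: "x \<in> ball x0 R1"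
    have "cmod (c k v x) \<le> C1 / (min (\<delta>/2) R) ^ k"
    proof (rule cauchy[OF x v])
      fix t assume t: "cmod t = min (\<delta>/2) R"
      have "cmod t * norm v \<le> (\<delta>/2) * 1" using v t y1(2) by (intro mult_mono) (auto simp: S_def)
      then have "y1 + t *s v \<in> ball y1 \<delta>" using y1(2) by (simp add: dist_norm norm_smult_vec)
      then show "cmod (f x v t) \<le> C1" using C1 x by (simp add: f_def)
    qed (use y1(2) R in auto)
    then show "cmod (c k v x) \<le> C1 * (1 / min (\<delta>/2) R) ^ k" by (simp add: power_divide)
  next
    fix x \<rho> assume x: "x \<in> ball x0 R1" and \<rho>: "0 < \<rho>" "\<rho> < 2 * R"
    have "bounded (G x ` cball y0 (3 * R))"
      by (intro compact_imp_bounded compact_continuous_image compact_cball continuous_on_subset[OF cG])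
         (use x subV R in auto)
    then obtain B where B: "\<And>y. y \<in> cball y0 (3 * R) \<Longrightarrow> cmod (G x y) \<le> B"
      unfolding bounded_iff by blast
    have "cmod (c k v x) * \<rho> ^ k \<le> B" if v: "v \<in> S" for k v
    proof -
      have "cmod (c k v x) \<le> B / \<rho> ^ k"
        by (rule cauchy[OF x v]) (use \<rho> inW[OF v] B in \<open>auto simp: f_def\<close>)
      then show ?thesis using \<rho> by (simp add: field_simps)
    qed
    then show "\<exists>C. \<forall>k. \<forall>v\<in>S. cmod (c k v x) * \<rho> ^ k \<le> C" by blast
  qed
  then obtain r where r: "r > 0" "r \<le> R1" and H: "\<And>\<rho>. 0 < \<rho> \<and> \<rho> < 2 * R \<Longrightarrow> \<exists>C. \<forall>x\<in>ball x0 r. \<forall>k. \<forall>v\<in>S. cmod (c k v x) * \<rho> ^ k \<le> C"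
    by blast
  \<comment> \<open>A radius between 5/4 R, the modulus of the parameter t used below, and 2R. The
    quotient of 5/4 and 3/2 is the ratio 5/6 of the final geometric series, whose sum gives the
    factor 6.\<close>
  obtain C where C: "\<forall>x\<in>ball x0 r. \<forall>k. \<forall>v\<in>S. cmod (c k v x) * (3/2 * R) ^ k \<le> C"
    using H[of "3/2 * R"] R(1) by auto
  define \<rho> where "\<rho> = min r (R/4)"
  have \<rho>: "\<rho> > 0" "ball x0 \<rho> \<subseteq> V" "ball y0 \<rho> \<subseteq> W"
  proof -
    show "\<rho> > 0" using r R by (simp add: \<rho>_def)
    have "ball x0 \<rho> \<subseteq> ball x0 R1" using r by (auto simp: \<rho>_def)
    with subV show "ball x0 \<rho> \<subseteq> V" by blast
    have "ball y0 \<rho> \<subseteq> cball y0 (3 * R)" using R(1) by (auto simp: \<rho>_def)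
    with R(2) show "ball y0 \<rho> \<subseteq> W" by blast
  qed
  have "cmod (G x y) \<le> C * 6" if x: "x \<in> ball x0 \<rho>" and y: "y \<in> ball y0 \<rho>" for x y
  proof -
    have x': "x \<in> ball x0 r" "x \<in> ball x0 R1" "x \<in> V" using x r(2) \<rho>(2) by (auto simp: \<rho>_def)
    define t where "t = complex_of_real (5/4 * R)"
    define v where "v = inverse t *s (y - y1)"
    have t: "cmod t = 5/4 * R" "t \<noteq> 0" using R(1) by (auto simp: t_def simp del: of_real_mult)
    have "norm (y - y1) \<le> 5/4 * R"
    proof -
      have "norm (y - y0) < R / 4" using y by (simp add: \<rho>_def dist_norm norm_minus_commute)
      moreover have "norm (y0 - y1) < R" using y1(1) by (simp add: dist_norm)
      ultimately show ?thesis using norm_triangle_ineq[of "y - y0" "y0 - y1"] by simp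
    qed
    moreover have "norm v = norm (y - y1) / (5/4 * R)"
      unfolding v_def norm_smult_vec norm_inverse t(1) by (simp only: divide_inverse mult.commute)
    moreover have "norm (y - y1) / (5/4 * R) \<le> 1 \<longleftrightarrow> norm (y - y1) \<le> 5/4 * R"
      using R(1) by (intro pos_divide_le_eq[THEN trans]) auto
    ultimately have v: "v \<in> S" by (simp only: S_def mem_Collect_eq)
    have "y1 + t *s v = y" using t(2) by (simp add: v_def vector_smult_assoc)
    then have fG: "f x v t = cnj (G x y)" by (simp add: f_def)
    have "f x v holomorphic_on ball 0 (2 * R)"
      by (rule holomorphic_on_subset[OF fhol[OF x'(3) v]]) auto
    from holomorphic_power_series[OF this, of t]
    have "(\<lambda>k. cnj (c k v x) * t ^ k) sums cnj (G x y)"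
      using t R(1) by (simp add: fc[OF x'(2)] fG)
    moreover have b: "cmod (cnj (c k v x) * t ^ k) \<le> C * (5/6) ^ k" for k
    proof -
      have "cmod (c k v x) * (3/2 * R) ^ k \<le> C" using C x'(1) v by blast
      then have "cmod (c k v x) * (3/2 * R) ^ k * (5/6) ^ k \<le> C * (5/6) ^ k" by (intro mult_right_mono) auto
      also have "cmod (c k v x) * (3/2 * R) ^ k * (5/6) ^ k = cmod (c k v x) * ((3/2 * R) * (5/6)) ^ k"
        by (simp only: power_mult_distrib mult.assoc)
      also have "(3/2 * R) * (5/6) = cmod t" by (simp add: t(1))
      finally show ?thesis by (simp add: norm_mult norm_power)
    qed
    moreover have gs: "(\<lambda>k. C * (5/6) ^ k) sums (C * (1 / (1 - 5/6)))"
      by (intro sums_mult geometric_sums) auto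
    ultimately have "cmod (cnj (G x y)) \<le> C * (1 / (1 - 5/6))"
      using norm_suminf_le[OF b sums_summable[OF gs]] by (simp add: sums_iff)
    then show ?thesis by simp
  qed
  with \<rho> show ?thesis by blast
qed

theorem hartogs_bihol:
  assumes o: "open V" "open W"
    and h: "\<And>y. y \<in> W \<Longrightarrow> holomorphic_fun_on (\<lambda>x. G x y) V" "\<And>x. x \<in> V \<Longrightarrow> holomorphic_fun_on (\<lambda>y. cnj (G x y)) W"
  shows "bihol V W G"
  by (rule bihol_if_locally_bounded)
     (use h hartogs_locally_bounded[OF o h] in \<open>auto intro: holomorphic_fun_on_imp_line_hol\<close>)

section \<open>Reproducing kernel Hilbert spaces\<close>

context hilbert_function_space
begin

definition sq :: "('a \<Rightarrow> complex) \<Rightarrow> real" where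
  "sq f = Re (ip f f)"

lemma diff_mem: "f \<in> F \<Longrightarrow> g \<in> F \<Longrightarrow> (\<lambda>x. f x - g x) \<in> F"
  using add_mem[of f "\<lambda>x. (-1) * g x"] scale_mem[of g "-1"] by simp

lemma ip_add_right:
  assumes "f \<in> F" "g \<in> F" "h \<in> F" shows "ip h (\<lambda>x. f x + g x) = ip h f + ip h g"
  using assms ip_add[of f g h] ip_cnj[of "\<lambda>x. f x + g x" h] ip_cnj[of f h] ip_cnj[of g h]
  by (simp add: add_mem)

lemma ip_scale_right:
  assumes "f \<in> F" "h \<in> F" shows "ip h (\<lambda>x. c * f x) = cnj c * ip h f"
  using assms ip_scale[of f h c] ip_cnj[of "\<lambda>x. c * f x" h] ip_cnj[of f h]
  by (simp add: scale_mem)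

lemma ip_zero: "f \<in> F \<Longrightarrow> ip (\<lambda>x. 0) f = 0"
  using ip_scale[of "\<lambda>x. 0" f 0] zero_mem by simp

lemma sq_nonneg: "f \<in> F \<Longrightarrow> 0 \<le> sq f"
  using ip_pos[of f] ip_zero[OF zero_mem] by (cases "f = (\<lambda>x. 0)") (auto simp: sq_def)

lemma sq_add:
  assumes "f \<in> F" "g \<in> F" shows "sq (\<lambda>x. f x + g x) = sq f + 2 * Re (ip f g) + sq g"
proof -
  have "Re (ip g f) = Re (ip f g)" using ip_cnj[OF assms] by simp
  then show ?thesis using assms by (simp add: sq_def ip_add ip_add_right add_mem)
qed

lemma sq_scale:
  assumes "f \<in> F" shows "sq (\<lambda>x. c * f x) = (cmod c)\<^sup>2 * sq f"
proof -
  have "ip (\<lambda>x. c * f x) (\<lambda>x. c * f x) = (c * cnj c) * ip f f"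
    using assms by (simp add: ip_scale ip_scale_right scale_mem)
  then show ?thesis by (simp add: sq_def complex_norm_square[symmetric] flip: of_real_power)
qed

lemma sq_diff:
  assumes "f \<in> F" "g \<in> F" shows "sq (\<lambda>x. f x - g x) = sq f - 2 * Re (ip f g) + sq g"
  using sq_add[OF assms(1) scale_mem[OF assms(2), of "-1"]] sq_scale[OF assms(2), of "-1"]
    ip_scale_right[OF assms(2,1), of "-1"] by simp

text \<open>With \<open>d = 0\<close> a weak form of the Cauchy-Schwarz inequality; with \<open>d\<close> the distance from a subspace it gives
  orthogonality of the residuals of a minimizing sequence.\<close>

lemma ip_le_of_minimal:
  assumes h: "h \<in> F" and s: "s \<in> F" and d: "\<And>c. d \<le> sq (\<lambda>x. h x - c * s x)"
  shows "(cmod (ip h s))\<^sup>2 \<le> (sq h - d) * (sq s + 1)"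
proof -
  define p where "p = ip h s"
  \<comment> \<open>The exact minimizer would be p / sq s; the added 1 covers sq s = 0 and is
    harmless for limits.\<close>
  define t where "t = 1 / (sq s + 1)"
  have s0: "0 \<le> sq s" by (rule sq_nonneg[OF s])
  then have t: "t > 0" "t * sq s \<le> 1" by (auto simp: t_def field_simps)
  have "d \<le> sq (\<lambda>x. h x - (of_real t * p) * s x)" by (rule d)
  also have "\<dots> = sq h - 2 * Re (cnj (of_real t * p) * p) + (cmod (of_real t * p))\<^sup>2 * sq s"
    using sq_diff[OF h scale_mem[OF s]] by (simp add: ip_scale_right[OF s h] sq_scale[OF s] p_def)
  also have "Re (cnj (of_real t * p) * p) = t * (cmod p)\<^sup>2"
    unfolding cmod_power2 by (simp add: power2_eq_square algebra_simps)
  also have "(cmod (of_real t * p))\<^sup>2 * sq s = (t * (cmod p)\<^sup>2) * (t * sq s)"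
    by (simp add: norm_mult power2_eq_square)
  also have "\<dots> \<le> (t * (cmod p)\<^sup>2) * 1" using t by (intro mult_left_mono) auto
  finally have "t * (cmod p)\<^sup>2 \<le> sq h - d" by simp
  then show ?thesis using s0 by (simp add: t_def p_def pos_divide_le_eq)
qed

lemma ip_le:
  assumes h: "h \<in> F" and s: "s \<in> F"
  shows "(cmod (ip h s))\<^sup>2 \<le> sq h * (sq s + 1)"
  using ip_le_of_minimal[OF h s, of 0] sq_nonneg[OF diff_mem[OF h scale_mem[OF s]]] by simp

lemma ip_tendsto_0:
  assumes h: "\<And>n. h n \<in> F" "(\<lambda>n. sq (h n)) \<longlonglongrightarrow> 0" and s: "s \<in> F"
  shows "(\<lambda>n. ip (h n) s) \<longlonglongrightarrow> 0"
proof -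
  have "(\<lambda>n. (cmod (ip (h n) s))\<^sup>2) \<longlonglongrightarrow> 0"
  proof (rule tendsto_sandwich[OF _ _ tendsto_const])
    show "(\<lambda>n. sq (h n) * (sq s + 1)) \<longlonglongrightarrow> 0" using tendsto_mult_left_zero[OF h(2)] .
  qed (use ip_le[OF h(1) s] in auto)
  then have "(\<lambda>n. sqrt ((cmod (ip (h n) s))\<^sup>2)) \<longlonglongrightarrow> sqrt 0" by (rule tendsto_real_sqrt)
  then show ?thesis by (simp add: tendsto_norm_zero_iff)
qed

lemma sq_tendsto:
  assumes s: "\<And>n. s n \<in> F" and f: "f \<in> F" and l: "(\<lambda>n. sq (\<lambda>x. s n x - f x)) \<longlonglongrightarrow> 0"
  shows "(\<lambda>n. sq (s n)) \<longlonglongrightarrow> sq f"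
proof -
  have m: "(\<lambda>x. s n x - f x) \<in> F" for n by (rule diff_mem[OF s f])
  have e: "sq (s n) = sq (\<lambda>x. s n x - f x) + 2 * Re (ip (\<lambda>x. s n x - f x) f) + sq f" for n
    using sq_add[OF m f, of n] by simp
  have "(\<lambda>n. sq (\<lambda>x. s n x - f x) + 2 * Re (ip (\<lambda>x. s n x - f x) f) + sq f) \<longlonglongrightarrow> 0 + 2 * Re 0 + sq f"
    by (intro tendsto_intros l ip_tendsto_0 m f)
  then show ?thesis by (simp add: e)
qed

text \<open>Completeness in a form fed directly by the parallelogram law, which bounds squared
  distances by a sum of two null sequences.\<close>

lemma sq_complete:
  assumes s: "\<And>n. s n \<in> F" and a: "a \<longlonglongrightarrow> 0" and b: "\<And>k l. sq (\<lambda>x. s k x - s l x) \<le> a k + a l"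
  obtains f where "f \<in> F" "(\<lambda>n. sq (\<lambda>x. s n x - f x)) \<longlonglongrightarrow> 0"
proof -
  have "\<exists>f\<in>F. (\<lambda>k. sqrt (Re (ip (\<lambda>x. s k x - f x) (\<lambda>x. s k x - f x)))) \<longlonglongrightarrow> 0"
  proof (rule complete[OF s])
    fix e :: real assume e: "e > 0"
    then have "eventually (\<lambda>n. a n < e\<^sup>2 / 2) sequentially"
      by (intro order_tendstoD(2)[OF a]) simp
    then obtain N where N: "\<And>n. n \<ge> N \<Longrightarrow> a n < e\<^sup>2 / 2" by (auto simp: eventually_sequentially)
    have "sqrt (Re (ip (\<lambda>x. s k x - s l x) (\<lambda>x. s k x - s l x))) < e" if "k \<ge> N" "l \<ge> N" for k l
    proof -
      have "sq (\<lambda>x. s k x - s l x) < e\<^sup>2" using b[of k l] N[OF that(1)] N[OF that(2)] by linarith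
      then have "sqrt (sq (\<lambda>x. s k x - s l x)) < sqrt (e\<^sup>2)" by (rule real_sqrt_less_mono)
      then show ?thesis using e by (simp add: sq_def)
    qed
    then show "\<exists>N. \<forall>k\<ge>N. \<forall>l\<ge>N. sqrt (Re (ip (\<lambda>x. s k x - s l x) (\<lambda>x. s k x - s l x))) < e" by blast
  qed
  then obtain f where f: "f \<in> F" "(\<lambda>k. sqrt (sq (\<lambda>x. s k x - f x))) \<longlonglongrightarrow> 0"
    unfolding sq_def by blast
  from tendsto_power[OF f(2), of 2] have "(\<lambda>k. sq (\<lambda>x. s k x - f x)) \<longlonglongrightarrow> 0"
    using sq_nonneg[OF diff_mem[OF s f(1)]] by simp
  with f(1) that show thesis by blast
qed

text \<open>The parallelogram law as a substitute for the triangle inequality.\<close>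

lemma sq_diff_le:
  assumes "f \<in> F" "g \<in> F" "h \<in> F"
  shows "sq (\<lambda>x. f x - g x) \<le> 2 * sq (\<lambda>x. f x - h x) + 2 * sq (\<lambda>x. g x - h x)"
proof -
  define a b where "a = (\<lambda>x. f x - h x)" and "b = (\<lambda>x. g x - h x)"
  have ab: "a \<in> F" "b \<in> F" using assms diff_mem by (auto simp: a_def b_def)
  have "sq (\<lambda>x. a x - b x) + sq (\<lambda>x. a x + b x) = 2 * sq a + 2 * sq b"
    using sq_diff[OF ab] sq_add[OF ab] by simp
  moreover have "0 \<le> sq (\<lambda>x. a x + b x)" by (rule sq_nonneg[OF add_mem[OF ab]])
  moreover have "(\<lambda>x. a x - b x) = (\<lambda>x. f x - g x)" by (simp add: a_def b_def)
  ultimately show ?thesis by (simp add: a_def b_def)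
qed

end

section \<open>Kernel sections and weighted composition operators\<close>

context rkhs
begin

text \<open>Adding one multiple of a section at a time gives an induction rule matching the way the
  weighted composition operator acts.\<close>

inductive_set kernel_span :: "('a \<Rightarrow> complex) set" where
  zero: "(\<lambda>x. 0) \<in> kernel_span"
| add: "f \<in> kernel_span \<Longrightarrow> y \<in> X \<Longrightarrow> (\<lambda>x. f x + c * kernel_section X K y x) \<in> kernel_span"

lemma kernel_span_mem: "f \<in> kernel_span \<Longrightarrow> f \<in> F"
proof (induction rule: kernel_span.induct)
  case (add f y c)
  show ?case by (rule add_mem[OF add.IH scale_mem[OF kernel_mem[OF add.hyps(2)]]])
qed (rule zero_mem)

lemma kernel_span_plus:
  assumes "f \<in> kernel_span" "g \<in> kernel_span" shows "(\<lambda>x. f x + g x) \<in> kernel_span"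
  using assms(2)
proof induction
  case (add g y c)
  from kernel_span.add[OF add.IH add.hyps(2), of c] show ?case by (simp add: add.assoc)
qed (use assms(1) in simp)

lemma kernel_span_scale:
  assumes "f \<in> kernel_span" shows "(\<lambda>x. a * f x) \<in> kernel_span"
  using assms
proof induction
  case (add f y c)
  from kernel_span.add[OF add.IH add.hyps(2), of "a * c"] show ?case by (simp add: algebra_simps)
qed (use kernel_span.zero in simp)

lemma hermitian:
  assumes "x \<in> X" "y \<in> X" shows "K y x = cnj (K x y)"
  using reproducing[OF kernel_mem[OF assms(1)] assms(2)] reproducing[OF kernel_mem[OF assms(2)] assms(1)]
    ip_cnj[OF kernel_mem[OF assms(2)] kernel_mem[OF assms(1)]] assms
  by (simp add: kernel_section_def)

lemma pointwise_tendsto: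
  assumes h: "\<And>n. h n \<in> F" "(\<lambda>n. sq (h n)) \<longlonglongrightarrow> 0" and y: "y \<in> X"
  shows "(\<lambda>n. h n y) \<longlonglongrightarrow> 0"
  using ip_tendsto_0[OF h kernel_mem[OF y]] reproducing[OF h(1) y] by simp

text \<open>A sequence in the span minimizing the distance to f is Cauchy and has a limit g. The
  residuals become orthogonal to every kernel section, so by the reproducing property f and g agree
  at every point; no separate projection theorem is invoked.\<close>

lemma kernel_span_dense:
  assumes f: "f \<in> F"
  obtains s where "\<forall>n. s n \<in> kernel_span" "(\<lambda>n. sq (\<lambda>x. s n x - f x)) \<longlonglongrightarrow> 0"
proof -
  define D where "D = (\<lambda>s. sq (\<lambda>x. f x - s x)) ` kernel_span"
  define d where "d = Inf D"
  have ne: "D \<noteq> {}" using kernel_span.zero by (auto simp: D_def)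
  have bdd: "bdd_below D"
    using sq_nonneg[OF diff_mem[OF f kernel_span_mem]] by (auto simp: D_def bdd_below_def)
  have d: "d \<le> sq (\<lambda>x. f x - s x)" if "s \<in> kernel_span" for s
    unfolding d_def by (rule cInf_lower[OF _ bdd]) (use that in \<open>auto simp: D_def\<close>)
  have "\<exists>s\<in>kernel_span. sq (\<lambda>x. f x - s x) < d + 1 / real (Suc n)" for n
  proof -
    have "\<exists>z\<in>D. z < d + 1 / real (Suc n)"
      using cInf_lessD[OF ne, of "d + 1 / real (Suc n)"] by (simp add: d_def)
    then show ?thesis by (auto simp: D_def)
  qed
  then obtain s where s: "\<And>n. s n \<in> kernel_span" "\<And>n. sq (\<lambda>x. f x - s n x) < d + 1 / real (Suc n)"
    by metis
  have sF: "s n \<in> F" for n by (rule kernel_span_mem[OF s(1)])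
  \<comment> \<open>By the parallelogram law the squared distance of s k and s l is at most twice
    both squared residuals minus 4 d, because the midpoint of s k and s l again lies in the
    span.\<close>
  define a where "a n = 2 * (1 / real (Suc n))" for n
  have a0: "a \<longlonglongrightarrow> 0"
    unfolding a_def using tendsto_mult_right_zero[OF LIMSEQ_inverse_real_of_nat, of 2]
    by (simp add: inverse_eq_divide)
  have "sq (\<lambda>x. s k x - s l x) \<le> a k + a l" for k l
  proof -
    define u v where "u = (\<lambda>x. f x - s k x)" and "v = (\<lambda>x. f x - s l x)"
    have uv: "u \<in> F" "v \<in> F" by (auto simp: u_def v_def intro: diff_mem f sF)
    have 1: "sq (\<lambda>x. u x - v x) + sq (\<lambda>x. u x + v x) = 2 * sq u + 2 * sq v"
      using sq_diff[OF uv] sq_add[OF uv] by simp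
    have m: "(\<lambda>x. (1/2) * (s k x + s l x)) \<in> kernel_span"
      by (intro kernel_span_scale kernel_span_plus s)
    have "(\<lambda>x. u x + v x) = (\<lambda>x. 2 * (f x - (1/2) * (s k x + s l x)))"
      by (simp add: u_def v_def algebra_simps)
    then have "sq (\<lambda>x. u x + v x) = 4 * sq (\<lambda>x. f x - (1/2) * (s k x + s l x))"
      using sq_scale[OF diff_mem[OF f kernel_span_mem[OF m]], of 2] by simp
    with d[OF m] have 2: "sq (\<lambda>x. u x + v x) \<ge> 4 * d" by simp
    have 3: "(\<lambda>x. u x - v x) = (\<lambda>x. - 1 * (s k x - s l x))" by (simp add: u_def v_def)
    have "sq (\<lambda>x. u x - v x) = sq (\<lambda>x. s k x - s l x)"
      unfolding 3 by (subst sq_scale[OF diff_mem[OF sF sF]]) simp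
    with 1 2 s(2)[of k] s(2)[of l] show ?thesis by (simp add: u_def v_def a_def)
  qed
  from sq_complete[OF sF a0 this] obtain g where g: "g \<in> F" "(\<lambda>n. sq (\<lambda>x. s n x - g x)) \<longlonglongrightarrow> 0" .
  have "g y = f y" for y
  proof (cases "y \<in> X")
    case True
    have "(\<lambda>n. ip (\<lambda>x. f x - s n x) (kernel_section X K y)) \<longlonglongrightarrow> 0"
    proof -
      define M where "M = sq (kernel_section X K y) + 1"
      have b: "(cmod (ip (\<lambda>x. f x - s n x) (kernel_section X K y)))\<^sup>2 \<le> (1 / real (Suc n)) * M" for n
      proof -
        \<comment> \<open>Subtracting a multiple of the section amounts to changing s n inside the
          span, so d is still a lower bound.\<close>
        have "d \<le> sq (\<lambda>x. (f x - s n x) - c * kernel_section X K y x)" for c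
          using d[OF kernel_span.add[OF s(1) True, of n c]] by (simp add: algebra_simps)
        from ip_le_of_minimal[OF diff_mem[OF f sF] kernel_mem[OF True] this]
        have "(cmod (ip (\<lambda>x. f x - s n x) (kernel_section X K y)))\<^sup>2 \<le> (sq (\<lambda>x. f x - s n x) - d) * M"
          by (simp add: M_def)
        also have "\<dots> \<le> (1 / real (Suc n)) * M"
          using s(2)[of n] sq_nonneg[OF kernel_mem[OF True]] by (intro mult_right_mono) (auto simp: M_def)
        finally show ?thesis .
      qed
      have "(\<lambda>n. (cmod (ip (\<lambda>x. f x - s n x) (kernel_section X K y)))\<^sup>2) \<longlonglongrightarrow> 0"
      proof (rule tendsto_sandwich[OF _ _ tendsto_const])
        show "(\<lambda>n. (1 / real (Suc n)) * M) \<longlonglongrightarrow> 0"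
          using tendsto_mult_left_zero[OF LIMSEQ_inverse_real_of_nat, of M] by (simp add: inverse_eq_divide)
      qed (use b in auto)
      then have "(\<lambda>n. sqrt ((cmod (ip (\<lambda>x. f x - s n x) (kernel_section X K y)))\<^sup>2)) \<longlonglongrightarrow> sqrt 0"
        by (rule tendsto_real_sqrt)
      then show ?thesis by (simp add: tendsto_norm_zero_iff)
    qed
    then have "(\<lambda>n. f y - s n y) \<longlonglongrightarrow> 0"
      using reproducing[OF diff_mem[OF f sF] True] by simp
    moreover have "(\<lambda>n. s n y - g y) \<longlonglongrightarrow> 0"
      by (rule pointwise_tendsto[OF diff_mem[OF sF g(1)] g(2) True])
    ultimately have "(\<lambda>n. (f y - s n y) + (s n y - g y)) \<longlonglongrightarrow> 0 + 0" by (rule tendsto_add)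
    then have "f y - g y = 0" by (simp add: LIMSEQ_const_iff)
    then show ?thesis by simp
  qed (use zero_outside[OF f] zero_outside[OF g(1)] in auto)
  then have "g = f" by (rule ext)
  with g(2) s(1) show thesis by (intro that) auto
qed

text \<open>The operator T sends the section at \<Phi> y to a multiple of the section at y, so it
  maps the span into itself, isometrically by the reproducing property. For general f the images of
  approximants form a Cauchy sequence; its limit is T f because convergence in F implies pointwise
  convergence. This is also what shows that T f lies in F.\<close>

lemma weighted_comp_isometry:
  assumes \<Phi>: "bij_betw \<Phi> X X" and r: "\<And>x y. x \<in> X \<Longrightarrow> y \<in> X \<Longrightarrow> \<omega> x * cnj (\<omega> y) * K (\<Phi> x) (\<Phi> y) = K x y"
    and nz: "\<And>x. x \<in> X \<Longrightarrow> \<omega> x \<noteq> 0" and f: "f \<in> F"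
  shows "weighted_comp X \<omega> \<Phi> f \<in> F \<and> sq (weighted_comp X \<omega> \<Phi> f) = sq f"
proof -
  define T where "T = weighted_comp X \<omega> \<Phi>"
  have \<Phi>X: "\<Phi> x \<in> X" if "x \<in> X" for x using \<Phi> that by (auto simp: bij_betw_def)
  have Tadd: "T (\<lambda>x. f x + g x) = (\<lambda>x. T f x + T g x)" for f g
    by (auto simp: T_def weighted_comp_def algebra_simps)
  have Tscale: "T (\<lambda>x. c * f x) = (\<lambda>x. c * T f x)" for f c
    by (auto simp: T_def weighted_comp_def)
  have Tdiff: "T (\<lambda>x. f x - g x) = (\<lambda>x. T f x - T g x)" for f g
    by (auto simp: T_def weighted_comp_def algebra_simps)
  have Tk: "T (kernel_section X K (\<Phi> y)) = (\<lambda>x. (1 / cnj (\<omega> y)) * kernel_section X K y x)" if y: "y \<in> X" for y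
  proof
    fix x
    show "T (kernel_section X K (\<Phi> y)) x = (1 / cnj (\<omega> y)) * kernel_section X K y x"
      using r[OF _ y, of x] nz[OF y] \<Phi>X[of x] by (auto simp: T_def weighted_comp_def kernel_section_def field_simps)
  qed
  have surj: "\<exists>y\<in>X. z = \<Phi> y" if "z \<in> X" for z using \<Phi> that by (auto simp: bij_betw_def)
  have Tspan: "T g \<in> kernel_span" if "g \<in> kernel_span" for g
    using that
  proof induction
    case zero
    have "T (\<lambda>x. 0) = (\<lambda>x. 0)" by (auto simp: T_def weighted_comp_def)
    then show ?case using kernel_span.zero by simp
  next
    case (add g z c)
    obtain y where y: "y \<in> X" "z = \<Phi> y" using surj[OF add.hyps(2)] by blast
    have "T (\<lambda>x. g x + c * kernel_section X K z x) = (\<lambda>x. T g x + c * (1 / cnj (\<omega> y)) * kernel_section X K y x)"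
      unfolding Tadd Tscale y(2) Tk[OF y(1)] by (simp add: mult.assoc)
    then show ?case using kernel_span.add[OF add.IH y(1), of "c * (1 / cnj (\<omega> y))"] by simp
  qed
  have ip1: "ip (T g) (T (kernel_section X K z)) = ip g (kernel_section X K z)" if g: "g \<in> kernel_span" and z: "z \<in> X" for g z
  proof -
    obtain y where y: "y \<in> X" "z = \<Phi> y" using surj[OF z] by blast
    have "ip (T g) (T (kernel_section X K z)) = cnj (1 / cnj (\<omega> y)) * ip (T g) (kernel_section X K y)"
      unfolding y(2) Tk[OF y(1)] by (rule ip_scale_right[OF kernel_mem[OF y(1)] kernel_span_mem[OF Tspan[OF g]]])
    also have "ip (T g) (kernel_section X K y) = T g y"
      by (rule reproducing[OF kernel_span_mem[OF Tspan[OF g]] y(1), symmetric])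
    also have "T g y = \<omega> y * g z" using y by (simp add: T_def weighted_comp_def)
    also have "g z = ip g (kernel_section X K z)" by (rule reproducing[OF kernel_span_mem[OF g] z])
    finally show ?thesis using nz[OF y(1)] by simp
  qed
  have Tmem: "T (kernel_section X K z) \<in> F" if z: "z \<in> X" for z
    using Tspan[OF kernel_span.add[OF kernel_span.zero z, of 1]] kernel_span_mem by simp
  have ip2: "ip (T g) (T h) = ip g h" if g: "g \<in> kernel_span" and h: "h \<in> kernel_span" for g h
    using h
  proof induction
    case zero
    have "T (\<lambda>x. 0) = (\<lambda>x. 0)" by (auto simp: T_def weighted_comp_def)
    moreover have "ip u (\<lambda>x. 0) = 0" if "u \<in> F" for u
      using ip_zero[OF that] ip_cnj[OF zero_mem that] by simp
    ultimately show ?case using kernel_span_mem Tspan g by simp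
  next
    case (add h z c)
    have m: "T g \<in> F" "T h \<in> F" "g \<in> F" "h \<in> F" using kernel_span_mem Tspan g add.hyps by auto
    show ?case
      unfolding Tadd Tscale
      by (simp add: ip_add_right m scale_mem Tmem kernel_mem add.hyps ip_scale_right add.IH ip1[OF g])
  qed
  have sqT: "sq (T g) = sq g" if "g \<in> kernel_span" for g using ip2[OF that that] by (simp add: sq_def)
  obtain s where s': "\<forall>n. s n \<in> kernel_span" "(\<lambda>n. sq (\<lambda>x. s n x - f x)) \<longlonglongrightarrow> 0"
    by (rule kernel_span_dense[OF f])
  note s = s'(1)[rule_format] s'(2)
  have sF: "s n \<in> F" "T (s n) \<in> F" for n using kernel_span_mem[OF s(1)] kernel_span_mem[OF Tspan[OF s(1)]] by auto
  have B: "sq (\<lambda>x. T (s k) x - T (s l) x) \<le> 2 * sq (\<lambda>x. s k x - f x) + 2 * sq (\<lambda>x. s l x - f x)" for k l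
  proof -
    have "(\<lambda>x. s k x - s l x) = (\<lambda>x. s k x + (- 1) * s l x)" by simp
    then have m: "(\<lambda>x. s k x - s l x) \<in> kernel_span"
      using kernel_span_plus[OF s(1)[of k] kernel_span_scale[OF s(1)[of l], of "- 1"]] by simp
    have "sq (\<lambda>x. T (s k) x - T (s l) x) = sq (\<lambda>x. s k x - s l x)"
      using sqT[OF m] by (simp add: Tdiff)
    also have "\<dots> \<le> 2 * sq (\<lambda>x. s k x - f x) + 2 * sq (\<lambda>x. s l x - f x)"
      by (rule sq_diff_le[OF sF(1) sF(1) f])
    finally show ?thesis .
  qed
  have a0: "(\<lambda>k. 2 * sq (\<lambda>x. s k x - f x)) \<longlonglongrightarrow> 0" using tendsto_mult_right_zero[OF s(2)] .
  obtain g where g: "g \<in> F" "(\<lambda>n. sq (\<lambda>x. T (s n) x - g x)) \<longlonglongrightarrow> 0"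
    by (rule sq_complete[where s = "\<lambda>n. T (s n)", OF sF(2) a0 B])
  have "g x = T f x" for x
  proof (cases "x \<in> X")
    case True
    have "(\<lambda>n. T (s n) x - g x) \<longlonglongrightarrow> 0"
      by (rule pointwise_tendsto[OF diff_mem[OF sF(2) g(1)] g(2) True])
    then have 1: "(\<lambda>n. T (s n) x) \<longlonglongrightarrow> g x" by (rule LIM_zero_cancel)
    have "(\<lambda>n. s n (\<Phi> x) - f (\<Phi> x)) \<longlonglongrightarrow> 0"
      by (rule pointwise_tendsto[OF diff_mem[OF sF(1) f] s(2) \<Phi>X[OF True]])
    then have "(\<lambda>n. s n (\<Phi> x)) \<longlonglongrightarrow> f (\<Phi> x)" by (rule LIM_zero_cancel)
    then have "(\<lambda>n. \<omega> x * s n (\<Phi> x)) \<longlonglongrightarrow> \<omega> x * f (\<Phi> x)" by (intro tendsto_intros)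
    then have "(\<lambda>n. T (s n) x) \<longlonglongrightarrow> T f x" using True by (simp add: T_def weighted_comp_def)
    with 1 show ?thesis by (rule LIMSEQ_unique)
  next
    case False
    then show ?thesis using zero_outside[OF g(1)] by (simp add: T_def weighted_comp_def)
  qed
  then have gT: "g = T f" by (rule ext)
  have "(\<lambda>n. sq (T (s n))) \<longlonglongrightarrow> sq g" by (rule sq_tendsto[OF sF(2) g])
  moreover have "(\<lambda>n. sq (T (s n))) \<longlonglongrightarrow> sq f"
    using sq_tendsto[OF sF(1) f s(2)] by (simp add: sqT s(1))
  ultimately have "sq g = sq f" by (rule LIMSEQ_unique)
  with g(1) show ?thesis by (simp add: gT T_def)
qed

text \<open>The inverse is the weighted composition operator with \<Phi> inverted and the reciprocal
  weight, to which the isometry lemma applies as well; inner products are recovered from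
  norms.\<close>

lemma unitary_weighted_comp:
  assumes \<Phi>: "bij_betw \<Phi> X X" and r: "\<And>x y. x \<in> X \<Longrightarrow> y \<in> X \<Longrightarrow> \<omega> x * cnj (\<omega> y) * K (\<Phi> x) (\<Phi> y) = K x y"
    and nz: "\<And>x. x \<in> X \<Longrightarrow> \<omega> x \<noteq> 0"
  shows "unitary_on F ip (weighted_comp X \<omega> \<Phi>)"
proof -
  define T where "T = weighted_comp X \<omega> \<Phi>"
  define \<Psi> where "\<Psi> = inv_into X \<Phi>"
  define S where "S = weighted_comp X (\<lambda>x. 1 / \<omega> (\<Psi> x)) \<Psi>"
  have \<Phi>X: "\<Phi> x \<in> X" if "x \<in> X" for x using \<Phi> that by (auto simp: bij_betw_def)
  have \<Psi>: "bij_betw \<Psi> X X" unfolding \<Psi>_def by (rule bij_betw_inv_into[OF \<Phi>])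
  have \<Psi>X: "\<Psi> x \<in> X" if "x \<in> X" for x using \<Psi> that by (auto simp: bij_betw_def)
  have \<Phi>\<Psi>: "\<Phi> (\<Psi> x) = x" if "x \<in> X" for x
    unfolding \<Psi>_def by (rule bij_betw_inv_into_right[OF \<Phi> that])
  have \<Psi>\<Phi>: "\<Psi> (\<Phi> x) = x" if "x \<in> X" for x
    unfolding \<Psi>_def by (rule bij_betw_inv_into_left[OF \<Phi> that])
  have T: "T f \<in> F" "sq (T f) = sq f" if "f \<in> F" for f
    using weighted_comp_isometry[OF \<Phi> r nz that] by (auto simp: T_def)
  have S: "S f \<in> F" if "f \<in> F" for f
  proof -
    have "(1 / \<omega> (\<Psi> x)) * cnj (1 / \<omega> (\<Psi> y)) * K (\<Psi> x) (\<Psi> y) = K x y" if "x \<in> X" "y \<in> X" for x y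
      using r[OF \<Psi>X[OF that(1)] \<Psi>X[OF that(2)]] nz[OF \<Psi>X[OF that(1)]] nz[OF \<Psi>X[OF that(2)]] \<Phi>\<Psi> that
      by (simp add: field_simps)
    then show ?thesis
      unfolding S_def using weighted_comp_isometry[OF \<Psi> _ _ that] nz \<Psi>X by simp
  qed
  have TS: "T (S f) = f" if "f \<in> F" for f
  proof
    fix x show "T (S f) x = f x"
      using zero_outside[OF that, of x] nz[of x] \<Phi>X[of x] \<Psi>\<Phi>[of x] by (cases "x \<in> X") (auto simp: T_def S_def weighted_comp_def)
  qed
  have ST: "S (T f) = f" if "f \<in> F" for f
  proof
    fix x show "S (T f) x = f x"
      using zero_outside[OF that, of x] nz[of "\<Psi> x"] \<Psi>X[of x] \<Phi>\<Psi>[of x] by (cases "x \<in> X") (auto simp: T_def S_def weighted_comp_def)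
  qed
  have Tadd: "T (\<lambda>x. f x + g x) = (\<lambda>x. T f x + T g x)" for f g
    by (auto simp: T_def weighted_comp_def algebra_simps)
  have Tscale: "T (\<lambda>x. c * f x) = (\<lambda>x. c * T f x)" for f c
    by (auto simp: T_def weighted_comp_def)
  have Re_ip: "Re (ip (T f) (T g)) = Re (ip f g)" if "f \<in> F" "g \<in> F" for f g
    using sq_add[OF that] sq_add[OF T(1)[OF that(1)] T(1)[OF that(2)]] T(2)[OF add_mem[OF that]] T(2) that
    by (simp add: Tadd)
  have "ip (T f) (T g) = ip f g" if fg: "f \<in> F" "g \<in> F" for f g
  proof (rule complex_eqI)
    show "Re (ip (T f) (T g)) = Re (ip f g)" by (rule Re_ip[OF fg])
    \<comment> \<open>The imaginary part of p is the real part of -\<i> p.\<close>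
    have "Re (ip (T (\<lambda>x. (- \<i>) * f x)) (T g)) = Re (ip (\<lambda>x. (- \<i>) * f x) g)"
      by (rule Re_ip[OF scale_mem[OF fg(1)] fg(2)])
    then show "Im (ip (T f) (T g)) = Im (ip f g)"
      unfolding Tscale ip_scale[OF T(1)[OF fg(1)] T(1)[OF fg(2)]] ip_scale[OF fg] by simp
  qed
  moreover have "bij_betw T F F"
    by (rule bij_betw_byWitness[where f' = S]) (use T S TS ST in auto)
  ultimately show ?thesis
    unfolding unitary_on_def T_def[symmetric] by (simp add: Tadd Tscale)
qed

text \<open>The preimage g of the section at y is also its image under the adjoint, which testing
  against all f identifies as cnj (\<omega> y) times the section at \<Phi> y. Applying T to it gives
  back the section at y.\<close>

lemma unitary_weighted_comp_kernel:
  assumes u: "unitary_on F ip (weighted_comp X \<omega> \<Phi>)" and \<Phi>X: "\<And>x. x \<in> X \<Longrightarrow> \<Phi> x \<in> X"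
    and xy: "x \<in> X" "y \<in> X"
  shows "\<omega> x * cnj (\<omega> y) * K (\<Phi> x) (\<Phi> y) = K x y"
proof -
  define T where "T = weighted_comp X \<omega> \<Phi>"
  have T: "bij_betw T F F" "\<And>f g. f \<in> F \<Longrightarrow> g \<in> F \<Longrightarrow> ip (T f) (T g) = ip f g"
    using u by (auto simp: unitary_on_def T_def)
  have "kernel_section X K y \<in> T ` F" using T(1) kernel_mem[OF xy(2)] by (simp add: bij_betw_def)
  then obtain g where g': "kernel_section X K y = T g" "g \<in> F" by (rule imageE)
  note g = g'(2) g'(1)[symmetric]
  have TF: "T f \<in> F" if "f \<in> F" for f using T(1) that by (auto simp: bij_betw_def)
  have g_eq: "ip g f = cnj (\<omega> y) * cnj (f (\<Phi> y))" if f: "f \<in> F" for f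
  proof -
    have "ip f g = T f y"
      using T(2)[OF f g(1)] reproducing[OF TF[OF f] xy(2)] by (simp add: g(2))
    also have "\<dots> = \<omega> y * f (\<Phi> y)" using xy by (simp add: T_def weighted_comp_def)
    finally show ?thesis using ip_cnj[OF f g(1)] by simp
  qed
  have "g z = cnj (\<omega> y) * K z (\<Phi> y)" if z: "z \<in> X" for z
    using reproducing[OF g(1) z] g_eq[OF kernel_mem[OF z]] \<Phi>X[OF xy(2)]
    by (simp add: kernel_section_def hermitian[OF \<Phi>X[OF xy(2)] z])
  then have "T g x = \<omega> x * (cnj (\<omega> y) * K (\<Phi> x) (\<Phi> y))" using xy \<Phi>X by (simp add: T_def weighted_comp_def)
  then show ?thesis using g(2) xy by (simp add: kernel_section_def)
qed

end

section \<open>Rescalings and cross ratios\<close>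

lemma line_hol_mult: "line_hol f W \<Longrightarrow> line_hol g W \<Longrightarrow> line_hol (\<lambda>x. f x * g x) W"
  by (simp add: line_hol_def field_differentiable_mult)

lemma line_hol_diff: "line_hol f W \<Longrightarrow> line_hol g W \<Longrightarrow> line_hol (\<lambda>x. f x - g x) W"
  by (simp add: line_hol_def field_differentiable_diff)

lemma line_hol_const: "line_hol (\<lambda>x. c) W"
  by (simp add: line_hol_def)

lemma line_hol_divide:
  assumes "line_hol f W" "line_hol g W" "\<And>x. x \<in> W \<Longrightarrow> g x \<noteq> 0"
  shows "line_hol (\<lambda>x. f x / g x) W"
  unfolding line_hol_def
proof (intro ballI allI)
  fix x v assume "x \<in> W"
  then show "(\<lambda>t. f (x + t *s v) / g (x + t *s v)) field_differentiable at 0"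
    using assms by (intro field_differentiable_divide) (auto simp: line_hol_def)
qed

lemma bihol_mult: "bihol V W F \<Longrightarrow> bihol V W G \<Longrightarrow> bihol V W (\<lambda>x y. F x y * G x y)"
  unfolding bihol_def complex_cnj_mult by (auto intro!: line_hol_mult continuous_on_mult)

lemma bihol_diff: "bihol V W F \<Longrightarrow> bihol V W G \<Longrightarrow> bihol V W (\<lambda>x y. F x y - G x y)"
  unfolding bihol_def complex_cnj_diff by (auto intro!: line_hol_diff continuous_on_diff)

lemma bihol_const: "bihol V W (\<lambda>x y. c)"
  unfolding bihol_def by (simp add: line_hol_const)

lemma bihol_divide:
  assumes F: "bihol V W F" and G: "bihol V W G" and nz: "\<And>x y. x \<in> V \<Longrightarrow> y \<in> W \<Longrightarrow> G x y \<noteq> 0"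
  shows "bihol V W (\<lambda>x y. F x y / G x y)"
  unfolding bihol_def complex_cnj_divide
proof (intro conjI ballI)
  show "line_hol (\<lambda>x. F x y / G x y) V" if "y \<in> W" for y
    using that nz by (intro line_hol_divide bihol_line_hol(1)[OF F] bihol_line_hol(1)[OF G])
  show "line_hol (\<lambda>y. cnj (F x y) / cnj (G x y)) W" if "x \<in> V" for x
    using that nz by (intro line_hol_divide bihol_line_hol(2)[OF F] bihol_line_hol(2)[OF G]) auto
  show "continuous_on (V \<times> W) (\<lambda>p. F (fst p) (snd p) / G (fst p) (snd p))"
    using F G nz by (intro continuous_on_divide) (auto simp: bihol_def)
qed

lemma bihol_fix_right:
  assumes "bihol V W G" "y \<in> W" shows "bihol V U (\<lambda>x _. G x y)"
  unfolding bihol_def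
  by (intro conjI ballI bihol_line_hol(1)[OF assms] line_hol_const continuous_on_bihol[OF assms(1)])
     (auto intro!: continuous_intros simp: assms(2))

lemma bihol_fix_left:
  assumes "bihol V W G" "x \<in> V" shows "bihol U W (\<lambda>_ y. G x y)"
  unfolding bihol_def
  by (intro conjI ballI bihol_line_hol(2)[OF assms] line_hol_const continuous_on_bihol[OF assms(1)])
     (auto intro!: continuous_intros simp: assms(2))

lemma bihol_eq_0:
  assumes X: "open X" "connected X" and G: "bihol X X G"
    and U: "open U" "U \<subseteq> X" "U \<noteq> {}" "\<And>x y. x \<in> U \<Longrightarrow> y \<in> U \<Longrightarrow> G x y = 0" and xy: "x \<in> X" "y \<in> X"
  shows "G x y = 0"
proof -
  have 1: "G x y' = 0" if "y' \<in> U" for y'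
    using line_hol_eq_0[OF X bihol_line_hol(1)[OF G] U(1-3) U(4)[OF _ that] xy(1)] that U(2) by blast
  have "cnj (G x y) = 0"
    by (rule line_hol_eq_0[OF X bihol_line_hol(2)[OF G xy(1)] U(1-3) _ xy(2)]) (simp add: 1)
  then show ?thesis by simp
qed

lemma bihol_eq_0_of_diagonal:
  assumes X: "open X" "connected X" and G: "bihol X X G"
    and U: "open U" "U \<subseteq> X" "U \<noteq> {}" "\<And>x. x \<in> U \<Longrightarrow> G x x = 0" and xy: "x \<in> X" "y \<in> X"
  shows "G x y = 0"
proof -
  obtain c where "c \<in> U" using U(3) by blast
  then obtain e where e: "e > 0" "ball c e \<subseteq> U" using openE[OF U(1)] by blast
  have sub: "ball c e \<subseteq> X" using e(2) U(2) by blast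
  show ?thesis
  proof (rule bihol_eq_0[OF X G open_ball sub _ _ xy])
    show "ball c e \<noteq> {}" using e(1) by auto
    fix x' y' assume "x' \<in> ball c e" "y' \<in> ball c e"
    then show "G x' y' = 0"
      by (rule polarization[OF bihol_subset[OF G sub sub], rotated]) (use e(2) U(4) in auto)
  qed
qed

text \<open>The factorization holds on X0, where K x y does not vanish. It is then extended to X in
  the first and afterwards in the second variable by the identity theorem, each time in a form with
  denominators cleared.\<close>

lemma rescaling_if_cross_ratio:
  assumes X: "open X" "connected X" and K: "bihol X X K" and L: "bihol X X L"
    and hK: "\<And>x y. x \<in> X \<Longrightarrow> y \<in> X \<Longrightarrow> K y x = cnj (K x y)"
    and hL: "\<And>x y. x \<in> X \<Longrightarrow> y \<in> X \<Longrightarrow> L y x = cnj (L x y)"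
    and pK: "\<And>x. x \<in> X \<Longrightarrow> Re (K x x) > 0" and pL: "\<And>x. x \<in> X \<Longrightarrow> Re (L x x) > 0"
    and y: "y \<in> X"
    and cr: "\<And>x x'. x \<in> X \<Longrightarrow> x' \<in> X \<Longrightarrow> L x x' * K x y * K y x' * L y y = L x y * L y x' * K x x' * K y y"
  shows "rescaling X K L"
proof -
  have rK: "K x x = of_real (Re (K x x))" if "x \<in> X" for x
    using hK[OF that that] by (simp add: complex_eq_iff)
  have rL: "L x x = of_real (Re (L x x))" if "x \<in> X" for x
    using hL[OF that that] by (simp add: complex_eq_iff)
  have nK: "K x x \<noteq> 0" if "x \<in> X" for x using pK[OF that] by auto
  have nL: "L x x \<noteq> 0" if "x \<in> X" for x using pL[OF that] by auto
  \<comment> \<open>The normalization for which the squared modulus of \<omega>0 y equals the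
    quotient of L y y and K y y.\<close>
  define \<kappa> where "\<kappa> = sqrt (Re (K y y) / Re (L y y))"
  have \<kappa>2: "of_real \<kappa> * of_real \<kappa> = K y y / L y y"
  proof -
    have "\<kappa> * \<kappa> = Re (K y y) / Re (L y y)"
      unfolding \<kappa>_def using pK[OF y] pL[OF y] by simp
    then have "of_real (\<kappa> * \<kappa>) = of_real (Re (K y y)) / complex_of_real (Re (L y y))" by simp
    then show ?thesis using rK[OF y] rL[OF y] by simp
  qed
  define X0 where "X0 = X \<inter> (\<lambda>x. K x y) -` (- {0})"
  define \<omega>0 where "\<omega>0 x = of_real \<kappa> * L x y / K x y" for x
  have oX0: "open X0" unfolding X0_def
    by (intro continuous_open_preimage continuous_on_bihol[OF K] X continuous_intros) (use y in auto)
  have X0: "X0 \<subseteq> X" "y \<in> X0" using y nK by (auto simp: X0_def)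
  have L0: "L x x' = \<omega>0 x * cnj (\<omega>0 x') * K x x'" if x: "x \<in> X0" "x' \<in> X0" for x x'
  proof -
    have k: "K x y \<noteq> 0" "K y x' \<noteq> 0" using x hK[OF y, of x'] by (auto simp: X0_def)
    have "cnj (\<omega>0 x') = of_real \<kappa> * L y x' / K y x'"
      using x hK[OF _ y, of x'] hL[OF _ y, of x'] X0 by (auto simp: \<omega>0_def)
    then have "\<omega>0 x * cnj (\<omega>0 x') * K x x' = (of_real \<kappa> * of_real \<kappa>) * (L x y * L y x' * K x x') / (K x y * K y x')"
      by (simp add: \<omega>0_def)
    also have "\<dots> = L x y * L y x' * K x x' * K y y / (K x y * K y x' * L y y)"
      unfolding \<kappa>2 by (simp add: mult_ac)
    also have "\<dots> = L x x' * (K x y * K y x' * L y y) / (K x y * K y x' * L y y)"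
    proof -
      have "L x y * L y x' * K x x' * K y y = L x x' * (K x y * K y x' * L y y)"
        using cr[OF subsetD[OF X0(1) x(1)] subsetD[OF X0(1) x(2)]] by (simp add: mult.assoc)
      then show ?thesis by (simp only:)
    qed
    also have "\<dots> = L x x'" using k nL[OF y] by simp
    finally show ?thesis by simp
  qed
  have n0: "\<omega>0 x \<noteq> 0" if "x \<in> X0" for x
    using L0[OF that that] nL[of x] that X0 by auto
  \<comment> \<open>A base point for every x: otherwise K p y would vanish on the nonempty open set
    of p with K x p \<noteq> 0, hence for all p in X, contradicting K y y \<noteq> 0.\<close>
  have "\<exists>p. p \<in> X0 \<and> K x p \<noteq> 0" if x: "x \<in> X" for x
  proof (rule ccontr)
    assume no: "\<not> ?thesis"
    define U where "U = X \<inter> (\<lambda>p. K x p) -` (- {0})"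
    have "open U" unfolding U_def
      by (intro continuous_open_preimage continuous_on_bihol[OF K] X continuous_intros) (use x in auto)
    moreover have "U \<subseteq> X" "U \<noteq> {}" using x nK by (auto simp: U_def)
    moreover have "K p y = 0" if "p \<in> U" for p using no that by (auto simp: U_def X0_def)
    ultimately have "K y y = 0"
      by (intro line_hol_eq_0[OF X bihol_line_hol(1)[OF K y] _ _ _ _ y, of U])
    with nK[OF y] show False by simp
  qed
  then obtain p where p: "\<And>x. x \<in> X \<Longrightarrow> p x \<in> X0" "\<And>x. x \<in> X \<Longrightarrow> K x (p x) \<noteq> 0"
    by metis
  have pX: "p x \<in> X" if "x \<in> X" for x using p(1)[OF that] X0 by blast
  \<comment> \<open>The only value compatible with the factorization at the pair x, p x. That other
    points of X0 give the same value is the content of \<open>c1\<close>.\<close>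
  define \<omega> where "\<omega> x = L x (p x) / (cnj (\<omega>0 (p x)) * K x (p x))" for x
  have c1: "L x x' = \<omega> x * cnj (\<omega>0 x') * K x x'" if x: "x \<in> X" and x': "x' \<in> X0" for x x'
  proof -
    have x'X: "x' \<in> X" using x' X0 by blast
    have "L x x' * (cnj (\<omega>0 (p x)) * K x (p x)) - L x (p x) * (cnj (\<omega>0 x') * K x x') = 0"
    proof (rule line_hol_eq_0[where f = "\<lambda>z. L z x' * (cnj (\<omega>0 (p x)) * K z (p x)) - L z (p x) * (cnj (\<omega>0 x') * K z x')", OF X _ oX0 X0(1) _ _ x])
      show "line_hol (\<lambda>z. L z x' * (cnj (\<omega>0 (p x)) * K z (p x)) - L z (p x) * (cnj (\<omega>0 x') * K z x')) X"
        by (intro line_hol_diff line_hol_mult line_hol_const bihol_line_hol(1)[OF L] bihol_line_hol(1)[OF K] x'X pX[OF x])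
      show "L z x' * (cnj (\<omega>0 (p x)) * K z (p x)) - L z (p x) * (cnj (\<omega>0 x') * K z x') = 0" if "z \<in> X0" for z
        using L0[OF that x'] L0[OF that p(1)[OF x]] by simp
    qed (use X0 in auto)
    then show ?thesis using n0[OF p(1)[OF x]] p(2)[OF x] by (simp add: \<omega>_def field_simps)
  qed
  have "L x x' = \<omega> x * cnj (\<omega> x') * K x x'" if x: "x \<in> X" and x': "x' \<in> X" for x x'
  proof -
    define q where "q = p x'"
    have q: "q \<in> X0" "q \<in> X" "K q x' \<noteq> 0" "\<omega>0 q \<noteq> 0"
      using p[OF x'] pX[OF x'] hK[OF x' pX[OF x']] n0 by (auto simp: q_def)
    have "cnj (L x x' * (K q x' * \<omega>0 q)) - cnj (L q x' * (\<omega> x * K x x')) = 0"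
    proof (rule line_hol_eq_0[where f = "\<lambda>z. cnj (L x z * (K q z * \<omega>0 q)) - cnj (L q z * (\<omega> x * K x z))", OF X _ oX0 X0(1) _ _ x'])
      show "line_hol (\<lambda>z. cnj (L x z * (K q z * \<omega>0 q)) - cnj (L q z * (\<omega> x * K x z))) X"
        unfolding complex_cnj_mult
        by (intro line_hol_diff line_hol_mult line_hol_const bihol_line_hol(2)[OF L] bihol_line_hol(2)[OF K] x q)
      show "cnj (L x z * (K q z * \<omega>0 q)) - cnj (L q z * (\<omega> x * K x z)) = 0" if "z \<in> X0" for z
        using c1[OF x that] L0[OF q(1) that] by simp
    qed (use X0 in auto)
    then have e: "L x x' * (K q x' * \<omega>0 q) = L q x' * (\<omega> x * K x x')"
      by (simp only: right_minus_eq complex_cnj_cancel_iff)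
    have "L q x' = cnj (L x' q)" by (rule hL[OF x' q(2)])
    also have "\<dots> = cnj (\<omega> x') * \<omega>0 q * K q x'"
      unfolding c1[OF x' q(1)] hK[OF x' q(2)] by simp
    finally have "L x x' * (K q x' * \<omega>0 q) = (\<omega> x * cnj (\<omega> x') * K x x') * (K q x' * \<omega>0 q)"
      unfolding e by simp
    then show ?thesis using q by simp
  qed
  then show ?thesis unfolding rescaling_def by blast
qed

lemma rescaling_if_diagonal_cross_ratio:
  assumes X: "open X" "connected X" and K: "bihol X X K" and L: "bihol X X L"
    and hK: "\<And>x y. x \<in> X \<Longrightarrow> y \<in> X \<Longrightarrow> K y x = cnj (K x y)"
    and hL: "\<And>x y. x \<in> X \<Longrightarrow> y \<in> X \<Longrightarrow> L y x = cnj (L x y)"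
    and pK: "\<And>x. x \<in> X \<Longrightarrow> Re (K x x) > 0" and pL: "\<And>x. x \<in> X \<Longrightarrow> Re (L x x) > 0"
    and y: "y \<in> X" and U: "open U" "U \<noteq> {}" "U \<subseteq> X"
    and eq: "\<And>x. x \<in> U \<Longrightarrow> (cmod (L x y))\<^sup>2 / (Re (L x x) * Re (L y y)) = (cmod (K x y))\<^sup>2 / (Re (K x x) * Re (K y y))"
  shows "rescaling X K L"
proof (rule rescaling_if_cross_ratio[OF X K L hK hL pK pL y])
  define G where "G x x' = L x x' * (K x y * (K y x' * L y y)) - L x y * (L y x' * (K x x' * K y y))" for x x'
  have G: "bihol X X G" unfolding G_def
    by (intro bihol_diff bihol_mult K L bihol_fix_left[OF K y] bihol_fix_left[OF L y] bihol_fix_right[OF K y] bihol_fix_right[OF L y] bihol_const)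
  have "G x x = 0" if x: "x \<in> U" for x
  proof -
    have xX: "x \<in> X" using x U by blast
    have rK: "K x x = of_real (Re (K x x))" "K y y = of_real (Re (K y y))" "L x x = of_real (Re (L x x))" "L y y = of_real (Re (L y y))"
      using hK[OF xX xX] hL[OF xX xX] hK[OF y y] hL[OF y y] by (auto simp: complex_eq_iff)
    have kk: "K x y * K y x = of_real ((cmod (K x y))\<^sup>2)" "L x y * L y x = of_real ((cmod (L x y))\<^sup>2)"
      unfolding hK[OF xX y] hL[OF xX y] by (simp_all only: complex_norm_square)
    have "(cmod (L x y))\<^sup>2 * (Re (K x x) * Re (K y y)) = (cmod (K x y))\<^sup>2 * (Re (L x x) * Re (L y y))"
      using eq[OF x] pK[OF xX] pK[OF y] pL[OF xX] pL[OF y] by (simp add: frac_eq_eq)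
    then have "complex_of_real ((cmod (L x y))\<^sup>2) * (of_real (Re (K x x)) * of_real (Re (K y y)))
       = of_real ((cmod (K x y))\<^sup>2) * (of_real (Re (L x x)) * of_real (Re (L y y)))"
      by (metis of_real_mult)
    then have "(L x y * L y x) * (K x x * K y y) = (K x y * K y x) * (L x x * L y y)"
      unfolding kk using rK by metis
    then show ?thesis by (simp add: G_def mult_ac)
  qed
  then have "G x x' = 0" if "x \<in> X" "x' \<in> X" for x x'
    by (rule bihol_eq_0_of_diagonal[OF X G U(1,3,2) _ that])
  then show "L x x' * K x y * K y x' * L y y = L x y * L y x' * K x x' * K y y" if "x \<in> X" "x' \<in> X" for x x'
    using that by (simp add: G_def mult.assoc)
qed

section \<open>Composition with holomorphic maps\<close>

lemma holomorphic_map_on_has_derivative: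
  assumes "holomorphic_map_on \<Phi> X" "z \<in> X"
  shows "(\<Phi> has_derivative frechet_derivative \<Phi> (at z)) (at z)"
    and "frechet_derivative \<Phi> (at z) (c *s v) = c *s frechet_derivative \<Phi> (at z) v"
proof -
  have "\<forall>i. \<exists>D. ((\<lambda>z. \<Phi> z $ i) has_derivative D) (at z) \<and> (\<forall>c v. D (c *s v) = c * D v)"
    using assms unfolding holomorphic_map_on_def holomorphic_fun_on_def by blast
  then obtain D where D: "\<And>i. ((\<lambda>z. \<Phi> z $ i) has_derivative D i) (at z)" "\<And>i c v. D i (c *s v) = c * D i v"
    by metis
  have bl: "bounded_linear (axis i :: complex \<Rightarrow> complex ^ 'b)" for i
    unfolding linear_conv_bounded_linear[symmetric]
    by (rule linearI) (auto simp: axis_def vec_eq_iff)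
  have sum_axis: "(\<Sum>i\<in>UNIV. axis i (a i)) = (\<chi> i. a i)" for a :: "'b \<Rightarrow> complex"
    by (simp add: vec_eq_iff axis_def if_distrib cong: if_cong)
  have "((\<lambda>z. \<Sum>i\<in>UNIV. axis i (\<Phi> z $ i)) has_derivative (\<lambda>h. \<Sum>i\<in>UNIV. axis i (D i h))) (at z)"
    by (intro has_derivative_sum bounded_linear.has_derivative[OF bl] D)
  then have d: "(\<Phi> has_derivative (\<lambda>h. \<chi> i. D i h)) (at z)" by (simp add: sum_axis)
  have e: "frechet_derivative \<Phi> (at z) = (\<lambda>h. \<chi> i. D i h)"
    by (rule frechet_derivative_at[OF d, symmetric])
  show "(\<Phi> has_derivative frechet_derivative \<Phi> (at z)) (at z)" using d by (simp add: e)
  show "frechet_derivative \<Phi> (at z) (c *s v) = c *s frechet_derivative \<Phi> (at z) v"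
    by (simp add: e D(2) vec_eq_iff)
qed

lemma holomorphic_fun_on_compose:
  assumes f: "holomorphic_fun_on f Y" and \<Phi>: "holomorphic_map_on \<Phi> X" and XY: "\<And>x. x \<in> X \<Longrightarrow> \<Phi> x \<in> Y"
  shows "holomorphic_fun_on (\<lambda>z. f (\<Phi> z)) X"
  unfolding holomorphic_fun_on_def
proof
  fix z assume z: "z \<in> X"
  obtain D where D: "(f has_derivative D) (at (\<Phi> z))" "\<And>c v. D (c *s v) = c * D v"
    using f XY[OF z] unfolding holomorphic_fun_on_def by blast
  note P = holomorphic_map_on_has_derivative[OF \<Phi> z]
  have "((\<lambda>z. f (\<Phi> z)) has_derivative (\<lambda>h. D (frechet_derivative \<Phi> (at z) h))) (at z)"
    by (rule has_derivative_compose[OF P(1) D(1)])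
  then show "\<exists>D. ((\<lambda>z. f (\<Phi> z)) has_derivative D) (at z) \<and> (\<forall>c v. D (c *s v) = c * D v)"
    using D(2) P(2) by (intro exI[of _ "\<lambda>h. D (frechet_derivative \<Phi> (at z) h)"]) simp
qed

text \<open>\<Phi> need not map lines to lines, but at the base point only the tangent direction of
  the image curve matters.\<close>

lemma line_derivative_compose:
  assumes f: "holomorphic_fun_on f Y" and \<Phi>: "holomorphic_map_on \<Phi> X" and z: "z \<in> X" "\<Phi> z \<in> Y"
  shows "((\<lambda>t. f (\<Phi> (z + t *s v))) has_field_derivative deriv (\<lambda>t. f (\<Phi> z + t *s frechet_derivative \<Phi> (at z) v)) 0) (at 0)"
proof -
  obtain D where D: "(f has_derivative D) (at (\<Phi> z))" "\<And>c v. D (c *s v) = c * D v"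
    using f z(2) unfolding holomorphic_fun_on_def by blast
  note P = holomorphic_map_on_has_derivative[OF \<Phi> z(1)]
  have d: "((\<lambda>z. f (\<Phi> z)) has_derivative (\<lambda>h. D (frechet_derivative \<Phi> (at z) h))) (at z)"
    by (rule has_derivative_compose[OF P(1) D(1)])
  have "((\<lambda>t. f (\<Phi> (z + t *s v))) has_field_derivative D (frechet_derivative \<Phi> (at z) v)) (at 0)"
    by (rule holomorphic_fun_on_line_deriv[OF d]) (simp add: P(2) D(2))
  moreover have "deriv (\<lambda>t. f (\<Phi> z + t *s frechet_derivative \<Phi> (at z) v)) 0 = D (frechet_derivative \<Phi> (at z) v)"
    by (rule DERIV_imp_deriv[OF holomorphic_fun_on_line_deriv[OF D]])
  ultimately show ?thesis by simp
qed

section \<open>The Hermitean form of a kernel\<close>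

text \<open>The mixed second derivative of \<open>log K\<close> at \<open>(z, z)\<close>, written without the logarithm.\<close>

definition log_form :: "(complex ^ 'n \<Rightarrow> complex ^ 'n \<Rightarrow> complex) \<Rightarrow> complex ^ 'n \<Rightarrow> complex ^ 'n \<Rightarrow> complex ^ 'n \<Rightarrow> complex" where
  "log_form K z v w = (dl v (dr w K) z z * K z z - dr w K z z * dl v K z z) / (K z z * K z z)"

lemma bihol_nonzero_ball:
  assumes K: "bihol X X K" and X: "open X" and z: "z \<in> X" and nz: "K z z \<noteq> 0"
  obtains e where "e > 0" "ball z e \<subseteq> X" "\<forall>x\<in>ball z e. \<forall>y\<in>ball z e. K x y \<noteq> 0"
proof -
  have "open ((X \<times> X) \<inter> (\<lambda>p. K (fst p) (snd p)) -` (- {0}))"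
    using K by (intro continuous_open_preimage open_Times X) (auto simp: bihol_def)
  moreover have "(z, z) \<in> (X \<times> X) \<inter> (\<lambda>p. K (fst p) (snd p)) -` (- {0})"
    using z nz by simp
  ultimately obtain A B where AB: "open A" "open B" "(z, z) \<in> A \<times> B"
    "A \<times> B \<subseteq> (X \<times> X) \<inter> (\<lambda>p. K (fst p) (snd p)) -` (- {0})"
    by (rule open_prod_elim)
  have "open (A \<inter> B)" "z \<in> A \<inter> B" using AB by auto
  then obtain e where e: "e > 0" "ball z e \<subseteq> A \<inter> B" using openE by blast
  have AB': "x \<in> X \<and> K x y \<noteq> 0" if "x \<in> ball z e" "y \<in> ball z e" for x y
  proof -
    have "(x, y) \<in> A \<times> B" using that e(2) by blast
    then have "(x, y) \<in> (X \<times> X) \<inter> (\<lambda>p. K (fst p) (snd p)) -` (- {0})" using AB(4) by blast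
    then show ?thesis by simp
  qed
  show thesis
  proof (rule that[OF e(1)])
    show "ball z e \<subseteq> X" using AB' by blast
    show "\<forall>x\<in>ball z e. \<forall>y\<in>ball z e. K x y \<noteq> 0" using AB' by blast
  qed
qed

lemma dl_divide:
  assumes F: "bihol V W F" and G: "bihol V W G" and xy: "x \<in> V" "y \<in> W" and nz: "G x y \<noteq> 0"
  shows "dl v (\<lambda>x y. F x y / G x y) x y = (dl v F x y * G x y - F x y * dl v G x y) / (G x y * G x y)"
  using DERIV_divide[OF dl_deriv[OF F xy, of v] dl_deriv[OF G xy, of v]] nz
  by (intro dl_eqI) simp

lemma dr_divide:
  assumes F: "bihol V W F" and G: "bihol V W G" and xy: "x \<in> V" "y \<in> W" and nz: "G x y \<noteq> 0"
  shows "dr v (\<lambda>x y. F x y / G x y) x y = (dr v F x y * G x y - F x y * dr v G x y) / (G x y * G x y)"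
  using DERIV_divide[OF dr_deriv[OF F xy, of v] dr_deriv[OF G xy, of v]] nz
  by (intro dr_eqI) simp

text \<open>\<open>dr w K / K\<close> stands for the antiholomorphic derivative of log K; as a
  quotient it makes sense off the diagonal too, wherever K does not vanish, without choosing a
  branch.\<close>

lemma dl_log_deriv:
  assumes K: "bihol V V K" and o: "open V" and z: "z \<in> V" and nz: "K z z \<noteq> 0"
  shows "dl v (\<lambda>x y. dr w K x y / K x y) z z = log_form K z v w"
  unfolding log_form_def by (rule dl_divide[OF bihol_dr[OF K o o] K z z nz])

lemma dr_hermitian:
  assumes X: "open X" and K: "bihol X X K" and hK: "\<And>x y. x \<in> X \<Longrightarrow> y \<in> X \<Longrightarrow> K y x = cnj (K x y)"
    and xy: "x \<in> X" "y \<in> X"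
  shows "dr v K x y = cnj (dl v K y x)"
proof (rule dr_eqI)
  have "((\<lambda>t. cnj (K x (y + t *s v))) has_field_derivative dl v K y x) (at 0)"
  proof (rule has_field_derivative_transform_within_open[OF dl_deriv[OF K xy(2,1)] open_line_preimage[OF X, of y v]])
    show "K (y + t *s v) x = cnj (K x (y + t *s v))" if "t \<in> {t. y + t *s v \<in> X}" for t
      using that by (intro hK xy(1)) simp
  qed (use xy in simp)
  then show "((\<lambda>t. cnj (K x (y + t *s v))) has_field_derivative cnj (cnj (dl v K y x))) (at 0)" by simp
qed

section \<open>The form with potential log K in coordinates\<close>

lemma scaleR_eq_smult_vec: "t *\<^sub>R (v :: complex ^ 'n) = complex_of_real t *s v"
  by (simp add: vec_eq_iff scaleR_conv_of_real[where 'a = complex])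

lemma axis_i: "axis j \<i> = \<i> *s axis j 1"
  by (simp add: vec_eq_iff axis_def)

lemma partial_deriv_diagonal:
  assumes B: "open B" and G: "bihol B B G" and z: "z \<in> B" and u: "\<And>x. x \<in> B \<Longrightarrow> u x = G x x"
  shows "partial_deriv v u z = dl v G z z + dr v G z z"
proof -
  obtain e where e: "e > 0" "\<forall>t\<in>ball 0 e. \<forall>s\<in>ball 0 e. z + complex_of_real t *s v + complex_of_real s *s 0 \<in> B"
    by (rule real_line_in_open[OF B z])
  have "G (z + of_real t *s v) (z + of_real t *s v) = u (z + t *\<^sub>R v)" if "t \<in> ball 0 e" for t
    using e(1) e(2)[rule_format, of t 0] that u by (simp add: scaleR_eq_smult_vec)
  then have "((\<lambda>t. u (z + t *\<^sub>R v)) has_vector_derivative dl v G z z + dr v G z z) (at 0)"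
    using e(1) by (intro has_vector_derivative_transform_within_open[OF diagonal_vector_derivative[OF G B B z z], of "ball 0 e"]) auto
  then show ?thesis unfolding partial_deriv_def by (rule vector_derivative_at)
qed

text \<open>Passing from the direction v to \<i> v multiplies \<open>dl\<close> by \<i> and
  \<open>dr\<close> by -\<i>, so the Wirtinger combination cancels the \<open>dr\<close>
  part.\<close>

lemma wirtinger_diagonal:
  assumes B: "open B" and G: "bihol B B G" and z: "z \<in> B" and u: "\<And>x. x \<in> B \<Longrightarrow> u x = G x x"
  shows "wirtinger j u z = dl (axis j 1) G z z"
proof -
  have "partial_deriv v u z = dl v G z z + dr v G z z" for v
    by (rule partial_deriv_diagonal[OF B G z u])
  then show ?thesis
    unfolding wirtinger_def axis_i by (simp add: dl_scale[OF G z z] dr_scale[OF G z z] algebra_simps)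
qed

lemma partial_deriv_log:
  assumes X: "open X" and K: "bihol X X K" and hK: "\<And>x y. x \<in> X \<Longrightarrow> y \<in> X \<Longrightarrow> K y x = cnj (K x y)"
    and pK: "\<And>x. x \<in> X \<Longrightarrow> Re (K x x) > 0" and z: "z \<in> X"
  shows "partial_deriv v (\<lambda>x. complex_of_real (ln (Re (K x x)))) z = (dl v K z z + dr v K z z) / K z z"
proof -
  define f where "f t = K (z + of_real t *s v) (z + of_real t *s v)" for t
  define D where "D = dl v K z z + dr v K z z"
  have f: "(f has_vector_derivative D) (at 0)"
    unfolding f_def D_def by (rule diagonal_vector_derivative[OF K X X z z])
  have "((\<lambda>t. Re (f t)) has_vector_derivative Re D) (at 0)"
    by (rule bounded_linear.has_vector_derivative[OF bounded_linear_Re f])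
  then have Re: "((\<lambda>t. Re (f t)) has_real_derivative Re D) (at 0)"
    by (simp add: has_real_derivative_iff_has_vector_derivative)
  have f0: "f 0 = K z z" by (simp add: f_def)
  have "((\<lambda>t. ln (Re (f t))) has_real_derivative (1 / Re (K z z)) * Re D) (at 0)"
    by (rule DERIV_chain2[OF DERIV_ln_divide Re[unfolded has_field_derivative_def[symmetric]], unfolded f0])
       (simp add: f0 pK z)
  then have "((\<lambda>t. complex_of_real (ln (Re (f t)))) has_vector_derivative of_real (Re D / Re (K z z))) (at 0)"
    by (intro has_vector_derivative_of_real) (simp add: has_real_derivative_iff_has_vector_derivative)
  then have "partial_deriv v (\<lambda>x. complex_of_real (ln (Re (K x x)))) z = of_real (Re D / Re (K z z))"
    unfolding partial_deriv_def scaleR_eq_smult_vec f_def by (rule vector_derivative_at)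
  \<comment> \<open>On the diagonal the two derivatives are conjugate, so D is real and nothing is
    lost by the real chain rule for ln.\<close>
  moreover have "dr v K z z = cnj (dl v K z z)" by (rule dr_hermitian[OF X K hK z z])
  then have "of_real (Re D) = D" unfolding D_def by (simp add: complex_eq_iff)
  moreover have "of_real (Re (K z z)) = K z z"
    using hK[OF z z] by (simp add: complex_eq_iff)
  ultimately show ?thesis by (simp add: D_def)
qed

lemma wirtinger_cnj_log:
  assumes X: "open X" and K: "bihol X X K" and hK: "\<And>x y. x \<in> X \<Longrightarrow> y \<in> X \<Longrightarrow> K y x = cnj (K x y)"
    and pK: "\<And>x. x \<in> X \<Longrightarrow> Re (K x x) > 0" and z: "z \<in> X"
  shows "wirtinger_cnj k (\<lambda>x. complex_of_real (ln (Re (K x x)))) z = dr (axis k 1) K z z / K z z"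
proof -
  have "partial_deriv v (\<lambda>x. complex_of_real (ln (Re (K x x)))) z = (dl v K z z + dr v K z z) / K z z" for v
    by (rule partial_deriv_log[OF X K hK pK z])
  then show ?thesis
    unfolding wirtinger_cnj_def axis_i
    by (simp add: dl_scale[OF K z z] dr_scale[OF K z z] add_divide_distrib diff_divide_distrib algebra_simps)
qed

text \<open>The direction w sits under the outer derivative. Commuting the derivatives brings
  \<open>dr\<close> outside, where its conjugate-linearity applies, and commuting back restores the
  order.\<close>

lemma dl_dr_sum:
  assumes K: "bihol X X K" and X: "open X" and z: "z \<in> X"
  shows "dl v (dr w K) z z = (\<Sum>j\<in>UNIV. \<Sum>k\<in>UNIV. dl (axis j 1) (dr (axis k 1) K) z z * (v $ j) * cnj (w $ k))"
proof -
  have "dl v (dr w K) z z = dl (\<Sum>j\<in>UNIV. (v $ j) *s axis j 1) (dr w K) z z" by (simp add: basis_expansion)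
  also have "\<dots> = (\<Sum>j\<in>UNIV. (v $ j) * dl (axis j 1) (dr w K) z z)"
    by (rule dl_sum[OF bihol_dr[OF K X X] X X z z]) simp
  also have "\<dots> = (\<Sum>j\<in>UNIV. (v $ j) * dr (\<Sum>k\<in>UNIV. (w $ k) *s axis k 1) (dl (axis j 1) K) z z)"
    by (simp add: dl_dr_commute[OF K X X z z] basis_expansion)
  also have "\<dots> = (\<Sum>j\<in>UNIV. (v $ j) * (\<Sum>k\<in>UNIV. cnj (w $ k) * dr (axis k 1) (dl (axis j 1) K) z z))"
    by (subst dr_sum[OF bihol_dl[OF K X X] X X z z]) simp_all
  also have "\<dots> = (\<Sum>j\<in>UNIV. \<Sum>k\<in>UNIV. dl (axis j 1) (dr (axis k 1) K) z z * (v $ j) * cnj (w $ k))"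
    by (simp add: dl_dr_commute[OF K X X z z] sum_distrib_left mult_ac)
  finally show ?thesis .
qed

text \<open>The inner Wirtinger derivative is \<open>dr K / K\<close> on the whole diagonal near z.
  Its sesqui-holomorphic extension off the diagonal turns the outer one into a \<open>dl\<close>;
  the rest is bilinear expansion in the basis.\<close>

lemma kernel_form_eq_log_form:
  assumes X: "open X" and K: "bihol X X K" and hK: "\<And>x y. x \<in> X \<Longrightarrow> y \<in> X \<Longrightarrow> K y x = cnj (K x y)"
    and pK: "\<And>x. x \<in> X \<Longrightarrow> Re (K x x) > 0" and z: "z \<in> X"
  shows "kernel_form K z v w = log_form K z v w"
proof -
  have nz: "K z z \<noteq> 0" using pK[OF z] by auto
  obtain e where e: "e > 0" "ball z e \<subseteq> X" "\<forall>x\<in>ball z e. \<forall>y\<in>ball z e. K x y \<noteq> 0"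
    by (rule bihol_nonzero_ball[OF K X z nz])
  have zB: "z \<in> ball z e" using e(1) by simp
  have KB: "bihol (ball z e) (ball z e) K" by (rule bihol_subset[OF K e(2,2)])
  have w: "wirtinger j (wirtinger_cnj k (\<lambda>x. complex_of_real (ln (Re (K x x))))) z = log_form K z (axis j 1) (axis k 1)" for j k
  proof -
    have G: "bihol (ball z e) (ball z e) (\<lambda>x y. dr (axis k 1) K x y / K x y)"
      by (rule bihol_divide[OF bihol_dr[OF KB open_ball open_ball] KB]) (use e(3) in blast)
    have "wirtinger j (wirtinger_cnj k (\<lambda>x. complex_of_real (ln (Re (K x x))))) z
        = dl (axis j 1) (\<lambda>x y. dr (axis k 1) K x y / K x y) z z"
    proof (rule wirtinger_diagonal[OF open_ball G zB])
      fix x assume "x \<in> ball z e"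
      then have xX: "x \<in> X" using e(2) by blast
      show "wirtinger_cnj k (\<lambda>x. complex_of_real (ln (Re (K x x)))) x = dr (axis k 1) K x x / K x x"
        by (rule wirtinger_cnj_log[OF X K hK pK xX])
    qed
    then show ?thesis unfolding dl_log_deriv[OF KB open_ball zB nz] .
  qed
  define A where "A j k = dl (axis j 1) (dr (axis k 1) K) z z" for j k
  have dv: "dl v K z z = (\<Sum>j\<in>UNIV. (v $ j) * dl (axis j 1) K z z)"
    using dl_sum[OF K X X z z, of UNIV "\<lambda>j. v $ j" "\<lambda>j. axis j 1"] by (simp add: basis_expansion)
  have dw: "dr w K z z = (\<Sum>k\<in>UNIV. cnj (w $ k) * dr (axis k 1) K z z)"
    using dr_sum[OF K X X z z, of UNIV "\<lambda>j. w $ j" "\<lambda>j. axis j 1"] by (simp add: basis_expansion)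
  have "kernel_form K z v w = (\<Sum>j\<in>UNIV. \<Sum>k\<in>UNIV. (A j k * K z z - dr (axis k 1) K z z * dl (axis j 1) K z z) / (K z z * K z z) * (v $ j) * cnj (w $ k))"
    unfolding kernel_form_def w log_form_def A_def ..
  also have "\<dots> = (\<Sum>j\<in>UNIV. \<Sum>k\<in>UNIV. (A j k * (v $ j) * cnj (w $ k)) * (K z z / (K z z * K z z))
       - ((v $ j) * dl (axis j 1) K z z) * (cnj (w $ k) * dr (axis k 1) K z z) * (1 / (K z z * K z z)))"
    by (intro sum.cong refl) (simp add: diff_divide_distrib algebra_simps)
  also have "\<dots> = (\<Sum>j\<in>UNIV. \<Sum>k\<in>UNIV. A j k * (v $ j) * cnj (w $ k)) * (K z z / (K z z * K z z))
       - (\<Sum>j\<in>UNIV. (v $ j) * dl (axis j 1) K z z) * (\<Sum>k\<in>UNIV. cnj (w $ k) * dr (axis k 1) K z z) * (1 / (K z z * K z z))"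
    by (simp only: sum_subtractf sum_distrib_right[symmetric] sum_product[symmetric])
  also have "\<dots> = log_form K z v w"
    unfolding dv[symmetric] dw[symmetric] A_def dl_dr_sum[OF K X z, of v w, symmetric] log_form_def
    by (simp add: diff_divide_distrib)
  finally show ?thesis .
qed

text \<open>\<open>line_derivative_compose\<close> asks for Frechet holomorphy, which is known for K
  in each variable but not for its derivatives. The intermediate N, with \<Phi> in the first
  variable only, together with the commutation of \<open>dl\<close> and \<open>dr\<close> ensures
  that the chain rule is applied to K alone.\<close>

lemma log_form_compose:
  assumes X: "open X" and sK: "sesqui_holomorphic X K" and \<Phi>: "holomorphic_map_on \<Phi> X" and \<Phi>X: "\<And>x. x \<in> X \<Longrightarrow> \<Phi> x \<in> X"
    and z: "z \<in> X"
  shows "log_form (\<lambda>x y. K (\<Phi> x) (\<Phi> y)) z v w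
    = log_form K (\<Phi> z) (frechet_derivative \<Phi> (at z) v) (frechet_derivative \<Phi> (at z) w)"
proof -
  define L where "L = (\<lambda>x y. K (\<Phi> x) (\<Phi> y))"
  define N where "N = (\<lambda>x y. K (\<Phi> x) y)"
  define v' where "v' = frechet_derivative \<Phi> (at z) v"
  define w' where "w' = frechet_derivative \<Phi> (at z) w"
  have h: "holomorphic_fun_on (\<lambda>x. K x y) X" "holomorphic_fun_on (\<lambda>x. cnj (K y x)) X" if "y \<in> X" for y
    using sK that by (auto simp: sesqui_holomorphic_def)
  have K: "bihol X X K" by (rule hartogs_bihol[OF X X]) (use h in auto)
  have N: "bihol X X N"
    unfolding N_def
  proof (rule hartogs_bihol[OF X X])
    show "holomorphic_fun_on (\<lambda>x. K (\<Phi> x) y) X" if "y \<in> X" for y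
      by (rule holomorphic_fun_on_compose[OF h(1)[OF that] \<Phi> \<Phi>X])
    show "holomorphic_fun_on (\<lambda>y. cnj (K (\<Phi> x) y)) X" if "x \<in> X" for x
      by (rule h(2)[OF \<Phi>X[OF that]])
  qed
  have dlN: "dl v N z y = dl v' K (\<Phi> z) y" if y: "y \<in> X" for y
    unfolding N_def v'_def dl_def[of _ K]
    by (rule dl_eqI) (rule line_derivative_compose[OF h(1)[OF y] \<Phi> z \<Phi>X[OF z]])
  have dlL: "dl v L z z = dl v' K (\<Phi> z) (\<Phi> z)"
    unfolding L_def v'_def dl_def[of _ K]
    by (rule dl_eqI) (rule line_derivative_compose[OF h(1)[OF \<Phi>X[OF z]] \<Phi> z \<Phi>X[OF z]])
  have drL: "dr w L x z = dr w' K (\<Phi> x) (\<Phi> z)" if x: "x \<in> X" for x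
    unfolding L_def w'_def dr_def[of _ K]
    by (rule dr_eqI) (simp add: line_derivative_compose[OF h(2)[OF \<Phi>X[OF x]] \<Phi> z \<Phi>X[OF z]])
  have drN: "dr w' N x (\<Phi> z) = dr w' K (\<Phi> x) (\<Phi> z)" for x
    by (simp add: dr_def N_def)
  have "dl v (dr w L) z z = dl v (dr w' N) z (\<Phi> z)"
  proof (rule dl_eqI)
    show "((\<lambda>t. dr w L (z + t *s v) z) has_field_derivative dl v (dr w' N) z (\<Phi> z)) (at 0)"
    proof (rule has_field_derivative_transform_within_open[OF dl_deriv[OF bihol_dr[OF N X X] z \<Phi>X[OF z]] open_line_preimage[OF X, of z v]])
      show "dr w' N (z + t *s v) (\<Phi> z) = dr w L (z + t *s v) z" if "t \<in> {t. z + t *s v \<in> X}" for t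
        using that by (simp add: drN drL)
    qed (use z in simp)
  qed
  also have "\<dots> = dr w' (dl v N) z (\<Phi> z)"
    by (rule dl_dr_commute[OF N X X z \<Phi>X[OF z], symmetric])
  also have "\<dots> = dr w' (dl v' K) (\<Phi> z) (\<Phi> z)"
  proof (rule dr_eqI)
    show "((\<lambda>t. cnj (dl v N z (\<Phi> z + t *s w'))) has_field_derivative cnj (dr w' (dl v' K) (\<Phi> z) (\<Phi> z))) (at 0)"
    proof (rule has_field_derivative_transform_within_open[OF dr_deriv[OF bihol_dl[OF K X X] \<Phi>X[OF z] \<Phi>X[OF z]] open_line_preimage[OF X, of "\<Phi> z" w']])
      show "cnj (dl v' K (\<Phi> z) (\<Phi> z + t *s w')) = cnj (dl v N z (\<Phi> z + t *s w'))" if "t \<in> {t. \<Phi> z + t *s w' \<in> X}" for t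
        using that by (simp add: dlN)
    qed (use \<Phi>X[OF z] in simp)
  qed
  also have "\<dots> = dl v' (dr w' K) (\<Phi> z) (\<Phi> z)"
    by (rule dl_dr_commute[OF K X X \<Phi>X[OF z] \<Phi>X[OF z]])
  finally show ?thesis
    unfolding log_form_def L_def[symmetric] v'_def[symmetric] w'_def[symmetric]
    by (simp add: dlL drL[OF z]) (simp add: L_def)
qed

text \<open>Comparing the points x and z eliminates the dependence of the multiplier on y: L x y K z
  y = a L z y K x y with a independent of y. Logarithmic differentiation in y shows that
  \<open>dr w L / L\<close> - \<open>dr w K / K\<close> does not depend on x, so \<open>dl v\<close>
  annihilates it.\<close>

lemma log_form_rescaling:
  assumes X: "open X" and K: "bihol X X K" and L: "bihol X X L" and r: "rescaling X K L"
    and nK: "\<And>x. x \<in> X \<Longrightarrow> K x x \<noteq> 0" and nL: "\<And>x. x \<in> X \<Longrightarrow> L x x \<noteq> 0" and z: "z \<in> X"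
  shows "log_form L z v w = log_form K z v w"
proof -
  obtain \<omega> where \<omega>: "\<And>x y. x \<in> X \<Longrightarrow> y \<in> X \<Longrightarrow> L x y = \<omega> x * cnj (\<omega> y) * K x y"
    using r by (auto simp: rescaling_def)
  have n\<omega>: "\<omega> x \<noteq> 0" if "x \<in> X" for x using \<omega>[OF that that] nL[OF that] by auto
  obtain e where e: "e > 0" "ball z e \<subseteq> X" "\<forall>x\<in>ball z e. \<forall>y\<in>ball z e. K x y \<noteq> 0"
    by (rule bihol_nonzero_ball[OF K X z nK[OF z]])
  define B where "B = ball z e"
  have B: "open B" "z \<in> B" "B \<subseteq> X" using e by (auto simp: B_def)
  have KB: "bihol B B K" and LB: "bihol B B L" using bihol_subset[OF K B(3,3)] bihol_subset[OF L B(3,3)] .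
  have nB: "K x y \<noteq> 0" "L x y \<noteq> 0" if "x \<in> B" "y \<in> B" for x y
    using e(3) that \<omega>[OF subsetD[OF B(3) that(1)] subsetD[OF B(3) that(2)]]
      n\<omega>[OF subsetD[OF B(3) that(1)]] n\<omega>[OF subsetD[OF B(3) that(2)]] by (auto simp: B_def)
  have \<omega>B: "L x y = \<omega> x * cnj (\<omega> y) * K x y" if "x \<in> B" "y \<in> B" for x y
    by (rule \<omega>[OF subsetD[OF B(3) that(1)] subsetD[OF B(3) that(2)]])
  define c where "c = dr w L z z / L z z - dr w K z z / K z z"
  have q: "dr w L x z / L x z = c + dr w K x z / K x z" if x: "x \<in> B" for x
  proof -
    define a where "a = \<omega> x / \<omega> z"
    have "L x y * K z y = a * (L z y * K x y)" if "y \<in> B" for y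
      using n\<omega>[OF z] unfolding \<omega>B[OF x that] \<omega>B[OF B(2) that] by (simp add: a_def)
    then have "cnj (L x (z + t *s w)) * cnj (K z (z + t *s w)) = cnj a * (cnj (L z (z + t *s w)) * cnj (K x (z + t *s w)))"
      if "t \<in> {t. z + t *s w \<in> B}" for t
      using that by (simp flip: complex_cnj_mult)
    then have "((\<lambda>t. cnj a * (cnj (L z (z + t *s w)) * cnj (K x (z + t *s w)))) has_field_derivative
        cnj (dr w L x z) * cnj (K z (z + 0 *s w)) + cnj (dr w K z z) * cnj (L x (z + 0 *s w))) (at 0)"
      using B(2) by (intro has_field_derivative_transform_within_open[OF DERIV_mult[OF dr_deriv[OF LB x B(2)] dr_deriv[OF KB B(2,2)]]
          open_line_preimage[OF B(1), of z w]]) auto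
    moreover have "((\<lambda>t. cnj a * (cnj (L z (z + t *s w)) * cnj (K x (z + t *s w)))) has_field_derivative
        cnj a * (cnj (dr w L z z) * cnj (K x (z + 0 *s w)) + cnj (dr w K x z) * cnj (L z (z + 0 *s w)))) (at 0)"
      by (intro DERIV_cmult DERIV_mult dr_deriv[OF LB B(2,2)] dr_deriv[OF KB x B(2)])
    ultimately have "cnj (dr w L x z * K z z + dr w K z z * L x z) = cnj (a * (dr w L z z * K x z + dr w K x z * L z z))"
      using DERIV_unique by fastforce
    then have d: "dr w L x z * K z z + dr w K z z * L x z = a * (dr w L z z * K x z + dr w K x z * L z z)"
      by (simp only: complex_cnj_cancel_iff)
    have l: "L x z * K z z = a * (L z z * K x z)"
      using n\<omega>[OF z] unfolding \<omega>B[OF x B(2)] \<omega>B[OF B(2) B(2)] by (simp add: a_def)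
    have a0: "a \<noteq> 0" using n\<omega>[OF z] n\<omega>[OF subsetD[OF B(3) x]] by (simp add: a_def)
    have nn: "L x z \<noteq> 0" "K z z \<noteq> 0" "L z z \<noteq> 0" "K x z \<noteq> 0" using nB x B by auto
    have "dr w L x z / L x z + dr w K z z / K z z = (dr w L x z * K z z + dr w K z z * L x z) / (L x z * K z z)"
      using nn by (simp add: add_divide_distrib)
    also have "\<dots> = (dr w L z z * K x z + dr w K x z * L z z) / (L z z * K x z)"
      unfolding d l using a0 by simp
    also have "\<dots> = dr w L z z / L z z + dr w K x z / K x z"
      using nn by (simp add: add_divide_distrib)
    finally show ?thesis by (simp add: c_def algebra_simps)
  qed
  have G: "bihol B B (\<lambda>x y. dr w K x y / K x y)"
    by (rule bihol_divide[OF bihol_dr[OF KB B(1,1)] KB nB(1)])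
  have "dl v (\<lambda>x y. dr w L x y / L x y) z z = dl v (\<lambda>x y. dr w K x y / K x y) z z"
  proof (rule dl_eqI)
    have "((\<lambda>t. c + dr w K (z + t *s v) z / K (z + t *s v) z) has_field_derivative
        0 + dl v (\<lambda>x y. dr w K x y / K x y) z z) (at 0)"
      by (intro DERIV_add DERIV_const dl_deriv[OF G B(2,2)])
    then have "((\<lambda>t. dr w L (z + t *s v) z / L (z + t *s v) z) has_field_derivative
        0 + dl v (\<lambda>x y. dr w K x y / K x y) z z) (at 0)"
      by (rule has_field_derivative_transform_within_open[OF _ open_line_preimage[OF B(1), of z v]])
         (use B(2) q in auto)
    then show "((\<lambda>t. dr w L (z + t *s v) z / L (z + t *s v) z) has_field_derivative
        dl v (\<lambda>x y. dr w K x y / K x y) z z) (at 0)" by simp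
  qed
  then show ?thesis
    using dl_log_deriv[OF K X z nK[OF z]] dl_log_deriv[OF L X z nL[OF z]] by simp
qed

lemma constant_on_ball:
  fixes f :: "complex ^ 'n \<Rightarrow> complex"
  assumes d: "\<And>x v. x \<in> ball c e \<Longrightarrow> ((\<lambda>t. f (x + t *s v)) has_field_derivative 0) (at 0)"
    and xy: "x \<in> ball c e" "y \<in> ball c e"
  shows "f x = f y"
proof -
  define T where "T = {t. x + t *s (y - x) \<in> ball c e}"
  have "((\<lambda>t. f (x + t *s (y - x))) has_field_derivative 0) (at s within T)" if s: "s \<in> T" for s
  proof -
    have "x + s *s (y - x) \<in> ball c e" using s by (simp add: T_def)
    from d[OF this, of "y - x"]
    have 1: "((\<lambda>t. f ((x + s *s (y - x)) + t *s (y - x))) has_field_derivative 0) (at 0)" .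
    have "(x + s *s (y - x)) + t *s (y - x) = x + (t + s) *s (y - x)" for t
      by (simp only: vector_sadd_rdistrib add.assoc add.commute[of "t *s (y - x)"])
    with 1 have "((\<lambda>t. f (x + (t + s) *s (y - x))) has_field_derivative 0) (at 0)"
      by (simp only:)
    then have "((\<lambda>t. f (x + t *s (y - x))) has_field_derivative 0) (at s)"
      using DERIV_shift[of "\<lambda>t. f (x + t *s (y - x))" 0 0 s] by (simp only: add_0_left)
    then show ?thesis by (rule has_field_derivative_at_within)
  qed
  moreover have "convex T" unfolding T_def by (intro convex_line_preimage convex_ball)
  ultimately obtain k where k: "\<forall>t\<in>T. f (x + t *s (y - x)) = k"
    using has_field_derivative_zero_constant[of T "\<lambda>t. f (x + t *s (y - x))"] by blast
  have "0 \<in> T" "1 \<in> T" using xy by (auto simp: T_def)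
  with k have "f (x + 0 *s (y - x)) = f (x + 1 *s (y - x))" by metis
  then show ?thesis by simp
qed

lemma rescaling_if_log_form:
  assumes X: "open X" "connected X" and K: "bihol X X K" and L: "bihol X X L"
    and hK: "\<And>x y. x \<in> X \<Longrightarrow> y \<in> X \<Longrightarrow> K y x = cnj (K x y)"
    and hL: "\<And>x y. x \<in> X \<Longrightarrow> y \<in> X \<Longrightarrow> L y x = cnj (L x y)"
    and pK: "\<And>x. x \<in> X \<Longrightarrow> Re (K x x) > 0" and pL: "\<And>x. x \<in> X \<Longrightarrow> Re (L x x) > 0"
    and z: "z \<in> X" and lf: "\<And>x v w. x \<in> X \<Longrightarrow> log_form L x v w = log_form K x v w"
  shows "rescaling X K L"
proof -
  have nK: "K x x \<noteq> 0" if "x \<in> X" for x using pK[OF that] by auto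
  have nL: "L x x \<noteq> 0" if "x \<in> X" for x using pL[OF that] by auto
  obtain a where a: "a > 0" "ball z a \<subseteq> X" "\<forall>x\<in>ball z a. \<forall>y\<in>ball z a. K x y \<noteq> 0"
    by (rule bihol_nonzero_ball[OF K X(1) z nK[OF z]])
  obtain b where b: "b > 0" "ball z b \<subseteq> X" "\<forall>x\<in>ball z b. \<forall>y\<in>ball z b. L x y \<noteq> 0"
    by (rule bihol_nonzero_ball[OF L X(1) z nL[OF z]])
  define e where "e = min a b"
  have e: "e > 0" "ball z e \<subseteq> X" using a b by (auto simp: e_def)
  have zB: "z \<in> ball z e" using e by simp
  have nB: "K x y \<noteq> 0" "L x y \<noteq> 0" if "x \<in> ball z e" "y \<in> ball z e" for x y
    using a(3) b(3) that by (auto simp: e_def)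
  have KB: "bihol (ball z e) (ball z e) K" and LB: "bihol (ball z e) (ball z e) L"
    using bihol_subset[OF K e(2,2)] bihol_subset[OF L e(2,2)] .
  define r where "r = (\<lambda>x y. L x y / K x y)"
  have r: "bihol (ball z e) (ball z e) r" unfolding r_def by (rule bihol_divide[OF LB KB nB(1)])
  have nr: "r x y \<noteq> 0" if "x \<in> ball z e" "y \<in> ball z e" for x y
    using nB[OF that] by (simp add: r_def)
  define Q where "Q w = (\<lambda>x y. dr w r x y / r x y)" for w
  have Q: "bihol (ball z e) (ball z e) (Q w)" for w
    unfolding Q_def by (rule bihol_divide[OF bihol_dr[OF r open_ball open_ball] r nr])
  have drK: "bihol (ball z e) (ball z e) (\<lambda>x y. dr w K x y / K x y)" for w
    by (rule bihol_divide[OF bihol_dr[OF KB open_ball open_ball] KB nB(1)])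
  have drL: "bihol (ball z e) (ball z e) (\<lambda>x y. dr w L x y / L x y)" for w
    by (rule bihol_divide[OF bihol_dr[OF LB open_ball open_ball] LB nB(2)])
  have Q_eq: "Q w x y = dr w L x y / L x y - dr w K x y / K x y" if xy: "x \<in> ball z e" "y \<in> ball z e" for w x y
    unfolding Q_def r_def dr_divide[OF LB KB xy nB(1)[OF xy]]
    using nB[OF xy] by (simp add: field_simps)
  have Q0: "dl v (Q w) x y = 0" if xy: "x \<in> ball z e" "y \<in> ball z e" for v w x y
  proof (rule polarization[OF bihol_dl[OF Q open_ball open_ball] _ xy])
    fix x assume x: "x \<in> ball z e"
    then have xX: "x \<in> X" using e by blast
    have "((\<lambda>t. dr w L (x + t *s v) x / L (x + t *s v) x - dr w K (x + t *s v) x / K (x + t *s v) x) has_field_derivative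
        log_form L x v w - log_form K x v w) (at 0)"
      using DERIV_diff[OF dl_deriv[OF drL[of w] x x, of v] dl_deriv[OF drK[of w] x x, of v]]
      unfolding dl_log_deriv[OF K X(1) xX nK[OF xX]] dl_log_deriv[OF L X(1) xX nL[OF xX]] .
    then have "((\<lambda>t. Q w (x + t *s v) x) has_field_derivative log_form L x v w - log_form K x v w) (at 0)"
      by (rule has_field_derivative_transform_within_open[OF _ open_line_preimage[OF open_ball, of x v z e]])
         (use x Q_eq in auto)
    then show "dl v (Q w) x x = 0"
      using lf[OF xX] by (intro dl_eqI) simp
  qed
  have Qc: "Q w x y = Q w z y" if xy: "x \<in> ball z e" "y \<in> ball z e" for w x y
  proof (rule constant_on_ball[OF _ xy(1) zB])
    fix x v assume "x \<in> ball z e"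
    then show "((\<lambda>t. Q w (x + t *s v) y) has_field_derivative 0) (at 0)"
      using dl_deriv[OF Q[of w] _ xy(2), of x v] Q0[OF _ xy(2), where v = v and w = w] by simp
  qed
  \<comment> \<open>As \<open>Q w\<close> does not depend on its first argument, r x y and r z y
    have the same logarithmic derivative in y; their quotient is constant in y and is compared at y
    = x and y = z. The result is condition (iv) with base point z.\<close>
  have rc: "r x x * r z z = r x z * r z x" if x: "x \<in> ball z e" for x
  proof -
    have "cnj (r x x) / cnj (r z x) = cnj (r x z) / cnj (r z z)"
    proof (rule constant_on_ball[where f = "\<lambda>y. cnj (r x y) / cnj (r z y)", OF _ x zB])
      fix y w assume y: "y \<in> ball z e"
      have n: "cnj (r x y) \<noteq> 0" "cnj (r z y) \<noteq> 0" using nr[OF x y] nr[OF zB y] by auto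
      have "dr w r x y / r x y = dr w r z y / r z y"
        using Qc[OF x y, of w] by (simp add: Q_def)
      then have "dr w r x y * r z y = r x y * dr w r z y"
        using nr[OF x y] nr[OF zB y] by (simp add: frac_eq_eq mult.commute)
      then have "cnj (dr w r x y) * cnj (r z y) - cnj (r x y) * cnj (dr w r z y) = 0"
        by (simp flip: complex_cnj_mult)
      then show "((\<lambda>t. cnj (r x (y + t *s w)) / cnj (r z (y + t *s w))) has_field_derivative 0) (at 0)"
        using DERIV_divide[OF dr_deriv[OF r x y, of w] dr_deriv[OF r zB y, of w]] n by simp
    qed
    then have "cnj (r x x * r z z) = cnj (r x z * r z x)"
      using nr[OF zB x] nr[OF zB zB] by (simp add: frac_eq_eq)
    then show ?thesis by (simp only: complex_cnj_cancel_iff)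
  qed
  show ?thesis
  proof (rule rescaling_if_diagonal_cross_ratio[OF X K L hK hL pK pL z open_ball _ e(2)])
    show "ball z e \<noteq> {}" using zB by blast
    fix x assume x: "x \<in> ball z e"
    then have xX: "x \<in> X" using e by blast
    have rK: "K x x = of_real (Re (K x x))" "K z z = of_real (Re (K z z))" "L x x = of_real (Re (L x x))" "L z z = of_real (Re (L z z))"
      using hK[OF xX xX] hL[OF xX xX] hK[OF z z] hL[OF z z] by (auto simp: complex_eq_iff)
    have kk: "K x z * K z x = of_real ((cmod (K x z))\<^sup>2)" "L x z * L z x = of_real ((cmod (L x z))\<^sup>2)"
      unfolding hK[OF xX z] hL[OF xX z] by (simp_all only: complex_norm_square)
    have "(L x x * L z z) * (K x z * K z x) = (L x z * L z x) * (K x x * K z z)"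
      using rc[OF x] nB x zB by (simp add: r_def frac_eq_eq)
    then have "complex_of_real ((Re (L x x) * Re (L z z)) * (cmod (K x z))\<^sup>2) = of_real ((cmod (L x z))\<^sup>2 * (Re (K x x) * Re (K z z)))"
      unfolding kk of_real_mult using rK by metis
    then have "(Re (L x x) * Re (L z z)) * (cmod (K x z))\<^sup>2 = (cmod (L x z))\<^sup>2 * (Re (K x x) * Re (K z z))"
      by (simp only: of_real_eq_iff)
    then show "(cmod (L x z))\<^sup>2 / (Re (L x x) * Re (L z z)) = (cmod (K x z))\<^sup>2 / (Re (K x x) * Re (K z z))"
      using pK[OF xX] pK[OF z] pL[OF xX] pL[OF z] by (simp add: frac_eq_eq mult_ac)
  qed
qed

section \<open>Automorphism invariance\<close>

definition normalized_sq :: "('a \<Rightarrow> 'a \<Rightarrow> complex) \<Rightarrow> 'a \<Rightarrow> 'a \<Rightarrow> real" where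
  "normalized_sq K x y = (cmod (K x y))\<^sup>2 / (Re (K x x) * Re (K y y))"

lemma normalized_sq_rescaling:
  assumes r: "rescaling X K L" and nL: "\<And>x. x \<in> X \<Longrightarrow> L x x \<noteq> 0" and xy: "x \<in> X" "y \<in> X"
  shows "normalized_sq L x y = normalized_sq K x y"
proof -
  obtain \<omega> where \<omega>: "\<And>x y. x \<in> X \<Longrightarrow> y \<in> X \<Longrightarrow> L x y = \<omega> x * cnj (\<omega> y) * K x y"
    using r by (auto simp: rescaling_def)
  have n: "(cmod (\<omega> x))\<^sup>2 \<noteq> 0" if "x \<in> X" for x using \<omega>[OF that that] nL[OF that] by auto
  have d: "Re (L x x) = (cmod (\<omega> x))\<^sup>2 * Re (K x x)" if "x \<in> X" for x
    unfolding \<omega>[OF that that] complex_norm_square[symmetric] by simp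
  have "normalized_sq L x y = ((cmod (\<omega> x))\<^sup>2 * (cmod (\<omega> y))\<^sup>2 * (cmod (K x y))\<^sup>2)
      / ((cmod (\<omega> x))\<^sup>2 * (cmod (\<omega> y))\<^sup>2 * (Re (K x x) * Re (K y y)))"
    unfolding normalized_sq_def d[OF xy(1)] d[OF xy(2)] \<omega>[OF xy]
    by (simp add: norm_mult power_mult_distrib mult_ac)
  also have "\<dots> = normalized_sq K x y"
    unfolding normalized_sq_def using n[OF xy(1)] n[OF xy(2)] by simp
  finally show ?thesis .
qed

text \<open>The real \<open>sqrt\<close> is extended to negative arguments as an odd function and is
  therefore injective everywhere; no inequality for the radicand enters.\<close>

lemma delta1_eq_iff:
  "delta1 K x y = delta1 L u v \<longleftrightarrow> normalized_sq K x y = normalized_sq L u v"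
  by (simp add: delta1_def normalized_sq_def)

lemma delta2_eq_normalized_sq: "delta2 K x y = sqrt (2 - 2 * sqrt (normalized_sq K x y))"
  by (simp add: delta2_def normalized_sq_def real_sqrt_divide)

lemma delta2_eq_iff:
  "delta2 K x y = delta2 L u v \<longleftrightarrow> normalized_sq K x y = normalized_sq L u v"
  by (simp add: delta2_eq_normalized_sq)

theorem theorem4p3:
  fixes X :: "(complex ^ 'n) set"
    and K :: "complex ^ 'n \<Rightarrow> complex ^ 'n \<Rightarrow> complex"
    and F :: "(complex ^ 'n \<Rightarrow> complex) set"
    and ip :: "(complex ^ 'n \<Rightarrow> complex) \<Rightarrow> (complex ^ 'n \<Rightarrow> complex) \<Rightarrow> complex"
  assumes "open X" "connected X" "X \<noteq> {}"
    and "sesqui_holomorphic X K" "nondegenerate X K" "psd_kernel X K"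
    and "rkhs X F ip K"
  defines "i \<equiv> projectively_invariant X K"
    and "ii \<equiv> (\<forall>\<Phi>\<in>Aut X. \<exists>\<omega>. unitary_on F ip (weighted_comp X \<omega> \<Phi>))"
    and "iii \<equiv> aut_invariant_form X (kernel_form K) \<and> aut_invariant_dist X (delta1 K)
                 \<and> aut_invariant_dist X (delta2 K)"
    and "iii' \<equiv> aut_invariant_form X (kernel_form K) \<or> aut_invariant_dist X (delta1 K)
                 \<or> aut_invariant_dist X (delta2 K)"
    and "iv \<equiv> (\<forall>\<Phi>\<in>Aut X. \<exists>y\<in>X. \<exists>U. open U \<and> U \<noteq> {} \<and> U \<subseteq> X \<and>
                 (\<forall>x\<in>U. (cmod (K (\<Phi> x) (\<Phi> y)))\<^sup>2 / (Re (K (\<Phi> x) (\<Phi> x)) * Re (K (\<Phi> y) (\<Phi> y)))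
                      = (cmod (K x y))\<^sup>2 / (Re (K x x) * Re (K y y))))"
  shows "(i \<longleftrightarrow> ii) \<and> (i \<longleftrightarrow> iii) \<and> (i \<longleftrightarrow> iii') \<and> (i \<longleftrightarrow> iv)"
proof -
  interpret rkhs X F ip K by (rule assms(7))
  note X = assms(1,2)
  obtain x0 where x0: "x0 \<in> X" using assms(3) by blast
  have pK: "Re (K x x) > 0" if "x \<in> X" for x
    using assms(5) that by (simp add: nondegenerate_def)
  have nK: "K x x \<noteq> 0" if "x \<in> X" for x using pK[OF that] by auto
  have hol: "holomorphic_fun_on (\<lambda>x. K x y) X" "holomorphic_fun_on (\<lambda>x. cnj (K y x)) X" if "y \<in> X" for y
    using assms(4) that by (auto simp: sesqui_holomorphic_def)
  have K: "bihol X X K" by (rule hartogs_bihol[OF X(1) X(1) hol])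
  define L where "L \<Phi> = (\<lambda>x y. K (\<Phi> x) (\<Phi> y))" for \<Phi> :: "complex ^ 'n \<Rightarrow> complex ^ 'n"
  have bij: "bij_betw \<Phi> X X" and map: "holomorphic_map_on \<Phi> X" if "\<Phi> \<in> Aut X" for \<Phi>
    using that by (auto simp: Aut_def)
  have \<Phi>X: "\<Phi> x \<in> X" if "\<Phi> \<in> Aut X" "x \<in> X" for \<Phi> x
    using bij[OF that(1)] that(2) by (auto simp: bij_betw_def)
  \<comment> \<open>Differentiability along lines is not visibly preserved by \<Phi>, which bends
    lines. Frechet holomorphy in each variable is, so Hartogs' theorem is applied afresh to
    L.\<close>
  have L: "bihol X X (L \<Phi>)" if \<Phi>: "\<Phi> \<in> Aut X" for \<Phi>
    unfolding L_def
  proof (rule hartogs_bihol[OF X(1) X(1)])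
    show "holomorphic_fun_on (\<lambda>x. K (\<Phi> x) (\<Phi> y)) X" if "y \<in> X" for y
      by (rule holomorphic_fun_on_compose[OF hol(1)[OF \<Phi>X[OF \<Phi> that]] map[OF \<Phi>] \<Phi>X[OF \<Phi>]])
    show "holomorphic_fun_on (\<lambda>y. cnj (K (\<Phi> x) (\<Phi> y))) X" if "x \<in> X" for x
      by (rule holomorphic_fun_on_compose[OF hol(2)[OF \<Phi>X[OF \<Phi> that]] map[OF \<Phi>] \<Phi>X[OF \<Phi>]])
  qed
  have hL: "L \<Phi> y x = cnj (L \<Phi> x y)" if "\<Phi> \<in> Aut X" "x \<in> X" "y \<in> X" for \<Phi> x y
    unfolding L_def by (rule hermitian[OF \<Phi>X[OF that(1,2)] \<Phi>X[OF that(1,3)]])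
  have pL: "Re (L \<Phi> x x) > 0" if "\<Phi> \<in> Aut X" "x \<in> X" for \<Phi> x
    unfolding L_def by (rule pK[OF \<Phi>X[OF that]])
  have nL: "L \<Phi> x x \<noteq> 0" if "\<Phi> \<in> Aut X" "x \<in> X" for \<Phi> x
    unfolding L_def by (rule nK[OF \<Phi>X[OF that]])
  have i_iff: "i \<longleftrightarrow> (\<forall>\<Phi>\<in>Aut X. rescaling X K (L \<Phi>))"
    by (simp add: i_def projectively_invariant_def L_def)
  have nsq: "rescaling X K (L \<Phi>)"
    if \<Phi>: "\<Phi> \<in> Aut X" and y: "y \<in> X" and U: "open U" "U \<noteq> {}" "U \<subseteq> X"
      and eq: "\<And>x. x \<in> U \<Longrightarrow> normalized_sq (L \<Phi>) x y = normalized_sq K x y" for \<Phi> y U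
    by (rule rescaling_if_diagonal_cross_ratio[OF X K L[OF \<Phi>] hermitian hL[OF \<Phi>] pK pL[OF \<Phi>] y U eq[unfolded normalized_sq_def]])
  have pullback: "pullback_form \<Phi> (kernel_form K) z v w = log_form (L \<Phi>) z v w" if \<Phi>: "\<Phi> \<in> Aut X" and z: "z \<in> X" for \<Phi> z v w
  proof -
    have "kernel_form K (\<Phi> z) v' w' = log_form K (\<Phi> z) v' w'" for v' w'
      by (rule kernel_form_eq_log_form[OF X(1) K hermitian pK \<Phi>X[OF \<Phi> z]])
    moreover have "log_form (L \<Phi>) z v w = log_form K (\<Phi> z) (frechet_derivative \<Phi> (at z) v) (frechet_derivative \<Phi> (at z) w)"
      unfolding L_def by (rule log_form_compose[OF X(1) assms(4) map[OF \<Phi>] \<Phi>X[OF \<Phi>] z])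
    ultimately show ?thesis by (simp add: pullback_form_def)
  qed
  have form: "kernel_form K z v w = log_form K z v w" if "z \<in> X" for z v w
    by (rule kernel_form_eq_log_form[OF X(1) K hermitian pK that])
  have i_ii: "ii" if "i"
    unfolding ii_def
  proof
    fix \<Phi> assume \<Phi>: "\<Phi> \<in> Aut X"
    then obtain \<omega> where \<omega>: "\<And>x y. x \<in> X \<Longrightarrow> y \<in> X \<Longrightarrow> L \<Phi> x y = \<omega> x * cnj (\<omega> y) * K x y"
      using \<open>i\<close> unfolding i_iff rescaling_def by blast
    have n: "\<omega> x \<noteq> 0" if "x \<in> X" for x using \<omega>[OF that that] nL[OF \<Phi> that] by auto
    \<comment> \<open>The weight of the operator is the reciprocal of the rescaling multiplier: it
      has to turn the transformed kernel back into K.\<close>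
    have "unitary_on F ip (weighted_comp X (\<lambda>x. 1 / \<omega> x) \<Phi>)"
    proof (rule unitary_weighted_comp[OF bij[OF \<Phi>]])
      show "1 / \<omega> x * cnj (1 / \<omega> y) * K (\<Phi> x) (\<Phi> y) = K x y" if "x \<in> X" "y \<in> X" for x y
        using \<omega>[OF that] n[OF that(1)] n[OF that(2)] by (simp add: L_def)
      show "1 / \<omega> x \<noteq> 0" if "x \<in> X" for x using n[OF that] by simp
    qed
    then show "\<exists>\<omega>. unitary_on F ip (weighted_comp X \<omega> \<Phi>)" by blast
  qed
  have ii_i: "i" if "ii"
    unfolding i_iff
  proof
    fix \<Phi> assume \<Phi>: "\<Phi> \<in> Aut X"
    then obtain \<omega> where u: "unitary_on F ip (weighted_comp X \<omega> \<Phi>)" using \<open>ii\<close> unfolding ii_def by blast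
    have \<omega>: "\<omega> x * cnj (\<omega> y) * K (\<Phi> x) (\<Phi> y) = K x y" if "x \<in> X" "y \<in> X" for x y
      by (rule unitary_weighted_comp_kernel[OF u \<Phi>X[OF \<Phi>] that])
    have n: "\<omega> x \<noteq> 0" if "x \<in> X" for x using \<omega>[OF that that] nK[OF that] by auto
    have "L \<Phi> x y = 1 / \<omega> x * cnj (1 / \<omega> y) * K x y" if "x \<in> X" "y \<in> X" for x y
      unfolding \<omega>[OF that, symmetric] L_def using n[OF that(1)] n[OF that(2)] by simp
    then show "rescaling X K (L \<Phi>)"
      unfolding rescaling_def by (intro exI[of _ "\<lambda>x. 1 / \<omega> x"] ballI)
  qed
  have i_iii: "iii" if "i"
  proof -
    have r: "rescaling X K (L \<Phi>)" if "\<Phi> \<in> Aut X" for \<Phi> using \<open>i\<close> that by (simp add: i_iff)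
    have q: "normalized_sq K (\<Phi> x) (\<Phi> y) = normalized_sq K x y" if "\<Phi> \<in> Aut X" "x \<in> X" "y \<in> X" for \<Phi> x y
      using normalized_sq_rescaling[OF r[OF that(1)] nL[OF that(1)] that(2,3)]
      by (simp add: normalized_sq_def L_def)
    have "pullback_form \<Phi> (kernel_form K) z v w = kernel_form K z v w" if "\<Phi> \<in> Aut X" "z \<in> X" for \<Phi> z v w
      unfolding pullback[OF that] form[OF that(2)]
      by (rule log_form_rescaling[OF X(1) K L[OF that(1)] r[OF that(1)] nK nL[OF that(1)] that(2)])
    then show ?thesis
      using q by (simp add: iii_def aut_invariant_form_def aut_invariant_dist_def delta1_eq_iff delta2_eq_iff)
  qed
  have iii'_i: "i" if "iii'"
    unfolding i_iff
  proof
    fix \<Phi> assume \<Phi>: "\<Phi> \<in> Aut X"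
    \<comment> \<open>Invariance of a distance is condition (iv) with an arbitrary base point and U
      = X.\<close>
    have dist: "rescaling X K (L \<Phi>)" if "\<And>x y. x \<in> X \<Longrightarrow> y \<in> X \<Longrightarrow> normalized_sq K (\<Phi> x) (\<Phi> y) = normalized_sq K x y"
      by (rule nsq[OF \<Phi> x0 X(1) assms(3)]) (use that x0 in \<open>auto simp: normalized_sq_def L_def\<close>)
    from \<open>iii'\<close> consider "aut_invariant_form X (kernel_form K)" | "aut_invariant_dist X (delta1 K)" | "aut_invariant_dist X (delta2 K)"
      unfolding iii'_def by blast
    then show "rescaling X K (L \<Phi>)"
    proof cases
      case 1
      then have lf: "log_form (L \<Phi>) x v w = log_form K x v w" if "x \<in> X" for x v w
        using \<Phi> that pullback[OF \<Phi> that] form[OF that] by (simp add: aut_invariant_form_def)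
      show ?thesis
        by (rule rescaling_if_log_form[OF X K L[OF \<Phi>] hermitian hL[OF \<Phi>] pK pL[OF \<Phi>] x0 lf])
    next
      case 2
      then show ?thesis using \<Phi> by (intro dist) (simp add: aut_invariant_dist_def delta1_eq_iff)
    next
      case 3
      then show ?thesis using \<Phi> by (intro dist) (simp add: aut_invariant_dist_def delta2_eq_iff)
    qed
  qed
  have i_iv: "iv" if "i"
    unfolding iv_def
  proof
    fix \<Phi> assume \<Phi>: "\<Phi> \<in> Aut X"
    then have r: "rescaling X K (L \<Phi>)" using \<open>i\<close> by (simp add: i_iff)
    show "\<exists>y\<in>X. \<exists>U. open U \<and> U \<noteq> {} \<and> U \<subseteq> X \<and>
       (\<forall>x\<in>U. (cmod (K (\<Phi> x) (\<Phi> y)))\<^sup>2 / (Re (K (\<Phi> x) (\<Phi> x)) * Re (K (\<Phi> y) (\<Phi> y)))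
            = (cmod (K x y))\<^sup>2 / (Re (K x x) * Re (K y y)))"
    proof (intro bexI[OF _ x0] exI[of _ X] conjI X(1) assms(3) order_refl ballI)
      fix x assume "x \<in> X"
      from normalized_sq_rescaling[OF r nL[OF \<Phi>] this x0]
      show "(cmod (K (\<Phi> x) (\<Phi> x0)))\<^sup>2 / (Re (K (\<Phi> x) (\<Phi> x)) * Re (K (\<Phi> x0) (\<Phi> x0)))
          = (cmod (K x x0))\<^sup>2 / (Re (K x x) * Re (K x0 x0))"
        by (simp add: normalized_sq_def L_def)
    qed
  qed
  have iv_i: "i" if "iv"
    unfolding i_iff
  proof
    fix \<Phi> assume \<Phi>: "\<Phi> \<in> Aut X"
    then obtain y U where y: "y \<in> X" and U: "open U" "U \<noteq> {}" "U \<subseteq> X"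
      and eq: "\<forall>x\<in>U. (cmod (K (\<Phi> x) (\<Phi> y)))\<^sup>2 / (Re (K (\<Phi> x) (\<Phi> x)) * Re (K (\<Phi> y) (\<Phi> y)))
                      = (cmod (K x y))\<^sup>2 / (Re (K x x) * Re (K y y))"
      using \<open>iv\<close> unfolding iv_def by blast
    show "rescaling X K (L \<Phi>)"
      by (rule nsq[OF \<Phi> y U]) (use eq in \<open>simp add: normalized_sq_def L_def\<close>)
  qed
  have "iii'" if "iii" using that by (simp add: iii_def iii'_def)
  with i_ii ii_i i_iii iii'_i i_iv iv_i show ?thesis by blast
qed

end
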